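(* Every Diophantine quadruple $\{a,b,c,d\}$ in $\mathbb{Q}(i)[X]$ containing at least one non-constant polynomial is regular, that is, it satisfies $$(a+b-c-d)^2=4(ab+1)(cd+1).$$
   Context: A Diophantine quadruple (or $D(1)$-quadruple) in $\mathbb{Q}(i)[X]$ is a set $\{a,b,c,d\}$ of four distinct non-zero elements of $\mathbb{Q}(i)[X]$ such that the product of any two distinct elements of the set, increased by $1$, is the square of an element of $\mathbb{Q}(i)[X]$. Here $i^2=-1$. A Diophantine quadruple $\{a,b,c,d\}$ in $\mathbb{Q}(i)[X]$ is called regular if $(a+b-c-d)^2=4(ab+1)(cd+1)$. Equivalently, $d=a+b+c+2(abc\pm rst)$ for one of the signs, where $r,s,t\in\mathbb{Q}(i)[X]$ satisfy $ab+1=r^2$, $ac+1=s^2$, $bc+1=t^2$. *)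

theory Defs
  imports Complex_Main "HOL-Computational_Algebra.Polynomial"
begin

text \<open>The field \<open>\<rat>(i)\<close> is realised as a subfield of the complex numbers, and
  \<open>\<rat>(i)[X]\<close> as the set of complex polynomials whose coefficients all lie in it.\<close>

definition gauss_rat :: "complex set" where
  "gauss_rat = {of_rat p + of_rat q * \<i> | p q. True}"

definition gauss_rat_polys :: "complex poly set" where
  "gauss_rat_polys = {f. \<forall>n. coeff f n \<in> gauss_rat}"

definition diophantine_quadruple :: "complex poly set \<Rightarrow> bool" where
  "diophantine_quadruple S \<longleftrightarrow>
     S \<subseteq> gauss_rat_polys \<and> card S = 4 \<and> 0 \<notin> S \<and>
     (\<forall>x\<in>S. \<forall>y\<in>S. x \<noteq> y \<longrightarrow> (\<exists>r\<in>gauss_rat_polys. x * y + 1 = r\<^sup>2))"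

text \<open>The regularity equation is invariant under all permutations of the four elements,
  so it does not depend on how a quadruple is listed.\<close>

definition regular_quadruple :: "complex poly \<Rightarrow> complex poly \<Rightarrow> complex poly \<Rightarrow> complex poly \<Rightarrow> bool" where
  "regular_quadruple a b c d \<longleftrightarrow> (a + b - c - d)\<^sup>2 = 4 * (a * b + 1) * (c * d + 1)"

lemma regular_quadruple_perm:
  "regular_quadruple a b c d \<longleftrightarrow> regular_quadruple b a c d"
  "regular_quadruple a b c d \<longleftrightarrow> regular_quadruple a c b d"
  "regular_quadruple a b c d \<longleftrightarrow> regular_quadruple a b d c"
  unfolding regular_quadruple_def by algebra+

end

theory Submission
  imports Defs
begin

text \<open>
  Order a Diophantine quadruple by degree as \<open>a\<close>, \<open>b\<close>, \<open>c\<close>, \<open>d\<close>, and let \<open>r\<^sup>2 = a b + 1\<close>, \<open>s\<^sup>2 = a c + 1\<close>,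
  \<open>t\<^sup>2 = b c + 1\<close>.  The quadruple is regular iff \<open>d\<close> is one of the two regular extensions
  \<open>a + b + c + 2 a b c \<plusminus> 2 r s t\<close> of the triple \<open>{a, b, c}\<close>.  By induction on the largest degree every
  extension of the triple of degree less than \<open>degree c\<close> is regular, and one has to show that no irregular
  \<open>d\<close> of larger degree exists.

  \<^bold>\<open>Descent.\<close>  The equations \<open>a d + 1 = x\<^sup>2\<close> and \<open>c d + 1 = z\<^sup>2\<close> amount to the Pell equation
  \<open>a z\<^sup>2 - c x\<^sup>2 = a - c\<close>.  Multiplication by powers of the unit \<open>s + \<surd>(a c)\<close> moves a solution down until
  \<open>degree z < degree c\<close>.  So \<open>d\<close> is reached in some number \<open>K\<close> of steps from a base element \<open>d0\<close> with small
  \<open>z0\<close> in the chain of the pair \<open>{a, c}\<close>, and likewise in some number \<open>L\<close> of steps in the chain of the pair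
  \<open>{b, c}\<close> (\<open>resolution\<close>).  Since \<open>s\<^sup>2\<close> and \<open>t\<^sup>2\<close> are \<open>1\<close> modulo \<open>c\<close>, the two bases determine each other, and
  in the case \<open>degree b < degree c\<close> the induction hypothesis leaves only \<open>0\<close>, \<open>a\<close>, \<open>b\<close> and the smaller
  regular extension as bases (\<open>joint_resolution\<close>, \<open>common_base\<close>).

  \<^bold>\<open>Congruences become equations.\<close>  After \<open>k\<close> steps from \<open>d0\<close> one has
  \<open>d = d0 + k\<^sup>2 a + 2 k s x0 z0\<close> modulo \<open>c\<close> (\<open>step_congruence\<close>).  Equating this for the two chains gives a
  congruence modulo \<open>c\<close> between integer combinations of polynomials of degree less than \<open>degree c\<close>, hence a
  linear equation between them.  The equation is refuted by comparing degrees, or by the rigidity of squares: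
  if \<open>k X\<^sup>2 + e\<close> is a square for constants \<open>k\<close> and \<open>e \<noteq> 0\<close>, then \<open>X\<close> is constant (\<open>square_shift_const\<close>).
  What remains are integer equations in \<open>K\<close> and \<open>L\<close>, which are solved together with the equation that the two
  chains give for \<open>degree z\<close>.

  \<^bold>\<open>The shapes of a triple.\<close>  If \<open>degree b < degree c\<close>, all relevant polynomials have degree less than
  \<open>degree c\<close> (\<open>gap_contradiction\<close>).  If \<open>degree b = degree c\<close>, the smaller regular extension is
  constant, and either it is zero, so that \<open>c = a + b \<plusminus> 2 r\<close>, or it is equal to \<open>a\<close>, which is then constant
  (\<open>equal_degree_triple\<close>).  In the latter case \<open>s = \<kappa> r\<close> for a constant \<open>\<kappa>\<close>, and the two chains leave two
  families of possible \<open>(\<kappa>, degree d)\<close>.  Exchanging \<open>b\<close> and \<open>c\<close> replaces \<open>\<kappa>\<close> by \<open>- 1 / \<kappa>\<close>, and no member of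
  the families survives this.

  \<^bold>\<open>The field.\<close>  The coefficients matter in two places only, both in the case of a constant \<open>a\<close>: one needs that
  \<open>5 - 8 p\<close> is not a square for any integer \<open>p \<ge> 1\<close>.  In \<open>\<rat>(i)\<close> this holds because \<open>8 p - 5\<close> is positive and
  congruent to \<open>3\<close> modulo \<open>8\<close>.  Some such condition is indispensable: with \<open>a = \<surd>-3 / 2\<close> there are irregular
  quadruples whose other three members have degree \<open>2\<close>.
\<close>

section \<open>Squares of polynomials\<close>

lemmas square_simps = algebra_simps power2_eq_square

text \<open>Comparing leading coefficients, \<open>k = \<kappa>\<^sup>2\<close> for some \<open>\<kappa>\<close> in the field.  Then \<open>(Y - \<kappa> X) (Y + \<kappa> X) = e\<close>
  is a nonzero constant, so both factors are constants, and so is their difference \<open>2 \<kappa> X\<close>.\<close>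

lemma square_shift_const:
  fixes X Y :: "'k::field_char_0 poly"
  assumes eq: "k * X\<^sup>2 + e = Y\<^sup>2" and k: "degree k = 0" "k \<noteq> 0" and e: "degree e = 0" "e \<noteq> 0"
  shows "degree X = 0"
proof (rule ccontr)
  assume "degree X \<noteq> 0"
  then have X: "degree X > 0" "X \<noteq> 0" by auto
  obtain k0 where k0: "k = [:k0:]" using k(1) by (rule degree_eq_zeroE)
  have kX: "degree (k * X\<^sup>2) = 2 * degree X"
    using k X by (simp add: degree_mult_eq degree_power_eq)
  then have less: "degree e < degree (k * X\<^sup>2)" using e X by simp
  have lc: "lead_coeff (Y\<^sup>2) = lead_coeff (k * X\<^sup>2)"
    unfolding eq[symmetric] using lead_coeff_add_le[OF less] by (metis add.commute)
  have dY2: "degree (Y\<^sup>2) = 2 * degree X"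
    unfolding eq[symmetric] using degree_add_eq_left[OF less] kX by metis
  have Y0: "Y \<noteq> 0" using dY2 X by auto
  define W where "W = smult (lead_coeff Y / lead_coeff X) X"
  have "k0 = (lead_coeff Y / lead_coeff X)\<^sup>2"
    using lc X by (simp add: k0 lead_coeff_mult lead_coeff_power power_divide field_simps)
  then have "W\<^sup>2 = k * X\<^sup>2"
    by (simp add: W_def k0 power2_eq_square)
  then have f: "(Y - W) * (Y + W) = e" using eq by (simp add: square_simps)
  then have nz: "Y - W \<noteq> 0" "Y + W \<noteq> 0" using e(2) by auto
  then have "degree (Y - W) + degree (Y + W) = 0"
    using degree_mult_eq[OF nz] f e by simp
  then have "degree ((Y + W) - (Y - W)) = 0" by (metis add_is_0 degree_diff_le le_zero_eq)
  then have "degree (smult 2 W) = 0"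
    by (simp add: smult_add_left[of 1 1 W, simplified])
  then show False using X Y0 by (simp add: W_def)
qed

lemma self_product_succ_square:
  fixes a x :: "'k::field_char_0 poly"
  assumes "a * a + 1 = x\<^sup>2"
  shows "degree a = 0"
  using square_shift_const[of 1 a 1 x] assms by (simp add: power2_eq_square)

lemma const_root:
  fixes A w :: "'k::field_char_0 poly"
  assumes "degree A = 0" "A * A + 1 = w\<^sup>2"
  shows "degree w = 0"
proof -
  have "degree (w\<^sup>2) \<le> 0" unfolding assms(2)[symmetric]
    using assms(1) degree_mult_le[of A A] by (intro degree_add_le) auto
  then show ?thesis by (cases "w = 0") (auto simp: degree_power_eq)
qed

lemma degree_root:
  fixes a b r :: "'k::field_char_0 poly"
  assumes eq: "a * b + 1 = r\<^sup>2" and nz: "a \<noteq> 0" "b \<noteq> 0" and d: "0 < degree a + degree b"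
  shows "2 * degree r = degree a + degree b" "(lead_coeff r)\<^sup>2 = lead_coeff a * lead_coeff b" "r \<noteq> 0"
proof -
  have dab: "degree (a * b) = degree a + degree b" using nz by (rule degree_mult_eq)
  then have less: "degree (1 :: 'k poly) < degree (a * b)" using d by simp
  have dr: "degree (r\<^sup>2) = degree a + degree b"
    unfolding eq[symmetric] using degree_add_eq_left[OF less] dab by simp
  have lc: "lead_coeff (r\<^sup>2) = lead_coeff (a * b)"
    unfolding eq[symmetric] using lead_coeff_add_le[OF less] by (metis add.commute)
  show r0: "r \<noteq> 0" using dr d by auto
  show "2 * degree r = degree a + degree b" using dr by (simp only: degree_power_eq[OF r0])
  show "(lead_coeff r)\<^sup>2 = lead_coeff a * lead_coeff b"
    using lc by (simp only: lead_coeff_power lead_coeff_mult)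
qed

text \<open>Eliminating \<open>b\<close> gives \<open>(a / e) y\<^sup>2 + (1 - a / e) = r\<^sup>2\<close> with \<open>y\<close> nonconstant, and the rigidity of squares
  leaves only \<open>a / e = 1\<close>.\<close>

lemma constant_partners_eq:
  fixes a e b :: "'k::field_char_0 poly"
  assumes "degree a = 0" "degree e = 0" "a \<noteq> 0" "e \<noteq> 0" "degree b > 0"
    and ab: "a * b + 1 = r\<^sup>2" and eb: "e * b + 1 = y\<^sup>2"
  shows "a = e"
proof (rule ccontr)
  assume ne: "a \<noteq> e"
  obtain a0 where a0: "a = [:a0:]" using assms(1) by (rule degree_eq_zeroE)
  obtain e0 where e0: "e = [:e0:]" using assms(2) by (rule degree_eq_zeroE)
  have nz: "a0 \<noteq> 0" "e0 \<noteq> 0" "a0 \<noteq> e0" using assms ne by (auto simp: a0 e0)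
  have inv: "[:1/e0:] * e = 1" using nz by (simp add: e0 one_pCons)
  have "[:a0/e0:] = a * [:1/e0:]" by (simp add: a0)
  then have "[:a0/e0:] * y\<^sup>2 + (1 - a * [:1/e0:]) = a * b * ([:1/e0:] * e) + 1"
    unfolding eb[symmetric] \<open>[:a0/e0:] = a * [:1/e0:]\<close> by (simp only: algebra_simps mult_1_left mult_1_right)
  also have "\<dots> = r\<^sup>2" using inv ab by simp
  finally have "[:a0/e0:] * y\<^sup>2 + [:1 - a0/e0:] = r\<^sup>2"
    by (simp add: a0 one_pCons)
  then have "degree y = 0" by (rule square_shift_const) (use nz in \<open>auto simp: field_simps\<close>)
  moreover have "2 * degree y = degree e + degree b"
    using degree_root(1)[OF eb] assms by fastforce
  ultimately show False using assms by simp
qed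

lemma of_int_times_dominates:
  fixes X Y :: "'k::field_char_0 poly"
  assumes "of_int K * X = Y" "degree Y < degree X"
  shows "K = 0"
proof (rule ccontr)
  assume "K \<noteq> 0"
  then have "degree (of_int K * X) = degree X" by (simp add: of_int_poly)
  with assms show False by simp
qed

lemma degree_of_int_mult_less: "degree p < n \<Longrightarrow> degree (of_int K * (p::'k::field_char_0 poly)) < n"
  by (simp add: of_int_poly)

lemma degree_of_int_mult_le: "degree p \<le> n \<Longrightarrow> degree (of_int K * (p::'k::field_char_0 poly)) \<le> n"
  by (simp add: of_int_poly)

lemma degree_const_mult_less: "degree p < n \<Longrightarrow> degree k = 0 \<Longrightarrow> degree (k * (p::'k::field_char_0 poly)) < n"
  by (metis add_0 degree_mult_le le_less_trans)

text \<open>A nonconstant polynomial is transcendental over the field of constants, so coefficients in such an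
  identity may be compared.\<close>

lemma quadratic_in_nonconst:
  fixes r :: "'k::field_char_0 poly"
  assumes "[:p2:] * r\<^sup>2 + [:p1:] * r + [:p0:] = 0" "degree r > 0"
  shows "p2 = 0" "p1 = 0" "p0 = 0"
proof -
  have "pcompose [:p0, p1, p2:] r = [:p2:] * r\<^sup>2 + [:p1:] * r + [:p0:]"
    by (simp add: pcompose_pCons square_simps)
  then have "pcompose [:p0, p1, p2:] r = 0" using assms by simp
  then have "[:p0, p1, p2:] = 0" using assms(2) by (simp add: pcompose_eq_0_iff)
  then show "p2 = 0" "p1 = 0" "p0 = 0" by (auto simp: pCons_eq_0_iff)
qed

lemma eq_of_dvd_degree_less:
  fixes c X Y :: "'k::field_char_0 poly"
  assumes "c dvd X - Y" "degree X < degree c" "degree Y < degree c"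
  shows "X = Y"
  using assms by (metis degree_diff_less diff_eq_diff_eq diff_self dvd_imp_degree_le leD)

section \<open>Chains of extensions of a pair\<close>

text \<open>Multiplication of \<open>z \<surd>a + x \<surd>c\<close> by the unit \<open>s + \<surd>(a c)\<close>, on coordinates \<open>(z, x)\<close>.\<close>

definition step :: "'r::idom \<Rightarrow> 'r \<Rightarrow> 'r \<Rightarrow> 'r \<times> 'r \<Rightarrow> 'r \<times> 'r" where
  "step a c s p = (s * fst p + c * snd p, s * snd p + a * fst p)"

text \<open>A step passes from \<open>d\<close> to one of the two regular extensions of the triple \<open>{a, c, d}\<close>.\<close>

lemma step_state:
  fixes a c s d x z :: "'r::idom"
  assumes "a * c + 1 = s\<^sup>2" "a * d + 1 = x\<^sup>2" "c * d + 1 = z\<^sup>2"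
  shows "a * (a + c + d + 2 * (a * c * d + s * x * z)) + 1 = (s * x + a * z)\<^sup>2"
    and "c * (a + c + d + 2 * (a * c * d + s * x * z)) + 1 = (s * z + c * x)\<^sup>2"
  using assms by algebra+

text \<open>The trace of the unit \<open>s + \<surd>(a c)\<close> is \<open>2 s\<close>, whence the recurrence of the \<open>z\<close>-coordinates along a chain.\<close>

fun lucas :: "'r::idom \<Rightarrow> 'r \<Rightarrow> 'r \<Rightarrow> nat \<Rightarrow> 'r" where
  "lucas s p q 0 = p"
| "lucas s p q (Suc 0) = q"
| "lucas s p q (Suc (Suc k)) = 2 * s * lucas s p q (Suc k) - lucas s p q k"

lemma step_step_fst:
  assumes "a * c + 1 = s\<^sup>2"
  shows "fst (step a c s (step a c s p)) = 2 * s * fst (step a c s p) - fst p"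
  using assms unfolding step_def by simp algebra

lemma fst_funpow_step:
  assumes "a * c + 1 = s\<^sup>2"
  shows "fst ((step a c s ^^ k) (z, x)) = lucas s z (s * z + c * x) k"
proof (induction k rule: induct_nat_012)
  case (ge2 n)
  then show ?case using step_step_fst[OF assms] by simp
qed (auto simp: step_def)

lemma lucas_mult: "lucas s (e * p) (e * q) k = e * lucas s p q k"
  by (induction s p q k rule: lucas.induct) (auto simp: algebra_simps)

text \<open>The hypothesis excludes cancellation in the first application of the recurrence.  From then on
  the term \<open>2 s u\<close> dominates, and each step adds \<open>degree s\<close>.\<close>

lemma degree_lucas:
  fixes s p q :: "'k::field_char_0 poly"
  assumes "degree p < degree q + degree s" "q \<noteq> 0" "degree s > 0"
  shows "degree (lucas s p q (Suc k)) = degree q + k * degree s \<and> lucas s p q (Suc k) \<noteq> 0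
     \<and> degree (lucas s p q k) < degree (lucas s p q (Suc k)) + degree s"
proof (induction k)
  case (Suc k)
  let ?u = "lucas s p q (Suc k)" and ?v = "lucas s p q k"
  have s0: "s \<noteq> 0" using assms by auto
  have d: "degree (2 * s * ?u) = degree s + degree ?u"
    using Suc s0 by (simp add: degree_mult_eq numeral_poly)
  then have "degree ?v < degree (2 * s * ?u)" using Suc assms by linarith
  then have "degree (2 * s * ?u - ?v) = degree (2 * s * ?u)"
    by (metis degree_add_eq_left degree_minus diff_conv_add_uminus)
  moreover have "degree (2 * s * ?u) > 0" using d assms by simp
  ultimately show ?case using d Suc assms(3) by auto
qed (use assms in auto)

text \<open>Modulo \<open>c\<close> one has \<open>s\<^sup>2 = 1\<close>.  A step multiplies \<open>z\<close> by \<open>s\<close>, adds \<open>a\<close> to \<open>s x z\<close> and adds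
  \<open>a + 2 s x z\<close> to \<open>d\<close>; summing the arithmetic progression gives the term quadratic in \<open>k\<close>.\<close>

lemma step_congruence:
  fixes a c s d0 x0 z0 :: "'r::idom"
  assumes s: "a * c + 1 = s\<^sup>2" and x0: "a * d0 + 1 = x0\<^sup>2" and z0: "c * d0 + 1 = z0\<^sup>2"
    and p: "(step a c s ^^ k) (z0, x0) = (z, x)"
  shows "\<exists>d. a * d + 1 = x\<^sup>2 \<and> c * d + 1 = z\<^sup>2 \<and> c dvd z - s ^ k * z0 \<and>
     c dvd s * x * z - (s * x0 * z0 + of_nat k * a) \<and>
     c dvd d - (d0 + (of_nat k)\<^sup>2 * a + 2 * of_nat k * (s * x0 * z0))"
  using p
proof (induction k arbitrary: z x)
  case 0
  then show ?case using x0 z0 by auto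
next
  case (Suc k)
  obtain z1 x1 where p1: "(step a c s ^^ k) (z0, x0) = (z1, x1)" by fastforce
  then have zx: "z = s * z1 + c * x1" "x = s * x1 + a * z1" using Suc.prems by (auto simp: p1) (auto simp: step_def)
  from Suc.IH[OF p1] obtain d1 where x1: "a * d1 + 1 = x1\<^sup>2" and z1: "c * d1 + 1 = z1\<^sup>2"
    and 1: "c dvd z1 - s ^ k * z0" and 2: "c dvd s * x1 * z1 - (s * x0 * z0 + of_nat k * a)"
    and 3: "c dvd d1 - (d0 + (of_nat k)\<^sup>2 * a + 2 * of_nat k * (s * x0 * z0))" by auto
  let ?d = "a + c + d1 + 2 * (a * c * d1 + s * x1 * z1)"
  note st = step_state[OF s x1 z1]
  have "z - s ^ Suc k * z0 = s * (z1 - s ^ k * z0) + c * x1"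
    by (simp add: zx algebra_simps)
  then have r1: "c dvd z - s ^ Suc k * z0" using 1 by simp
  have "s * x * z = s\<^sup>2 * (s * x1 * z1) + a * c * (s * x1 * z1) + s\<^sup>2 * (c * x1\<^sup>2) + a * s\<^sup>2 * z1\<^sup>2"
    by (simp add: zx square_simps)
  also have "\<dots> = (a * c + 1) * (s * x1 * z1) + a * c * (s * x1 * z1) + s\<^sup>2 * (c * x1\<^sup>2)
      + a * (a * c + 1) * (c * d1 + 1)"
    by (simp only: s z1)
  finally have "s * x * z - (s * x1 * z1 + a) = c * (2 * a * (s * x1 * z1) + x1\<^sup>2 * s\<^sup>2 + a * (a + d1 + a * c * d1))"
    by (simp add: algebra_simps)
  then have "c dvd (s * x * z - (s * x1 * z1 + a)) + (s * x1 * z1 - (s * x0 * z0 + of_nat k * a))"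
    using 2 by (metis dvd_add dvd_triv_left)
  then have r2: "c dvd s * x * z - (s * x0 * z0 + of_nat (Suc k) * a)"
    by (simp add: algebra_simps)
  have "c dvd c * (1 + 2 * a * d1) + 2 * (s * x1 * z1 - (s * x0 * z0 + of_nat k * a))
      + (d1 - (d0 + (of_nat k)\<^sup>2 * a + 2 * of_nat k * (s * x0 * z0)))"
    by (intro dvd_add dvd_mult 2 3 dvd_triv_left)
  also have "c * (1 + 2 * a * d1) + 2 * (s * x1 * z1 - (s * x0 * z0 + of_nat k * a))
      + (d1 - (d0 + (of_nat k)\<^sup>2 * a + 2 * of_nat k * (s * x0 * z0)))
     = ?d - (d0 + (of_nat (Suc k))\<^sup>2 * a + 2 * of_nat (Suc k) * (s * x0 * z0))"
    by (simp only: of_nat_Suc) (simp add: square_simps)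
  finally have r3: "c dvd ?d - (d0 + (of_nat (Suc k))\<^sup>2 * a + 2 * of_nat (Suc k) * (s * x0 * z0))" .
  show ?case
    by (rule exI[of _ ?d]) (intro conjI r1 r2 r3 st[folded zx])
qed

text \<open>The sign of the index is the sign of \<open>X\<close>: a negative \<open>K\<close> means \<open>\<bar>K\<bar>\<close> steps from \<open>(Z, - X)\<close>.  Thus a
  base with its roots known up to sign is treated by letting \<open>K\<close> range over the integers.\<close>

definition chain :: "'r::idom \<Rightarrow> 'r \<Rightarrow> 'r \<Rightarrow> 'r \<Rightarrow> int \<Rightarrow> 'r" where
  "chain c s Z X K = lucas s Z (s * Z + of_int (sgn K) * c * X) (nat \<bar>K\<bar>)"

text \<open>The two traces of reaching \<open>d\<close> from \<open>d0\<close> by \<open>K\<close> steps: the root \<open>z\<close> up to sign, which gives its degree, and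
  the residue of \<open>d\<close> modulo \<open>c\<close>.\<close>

definition based :: "'r::idom \<Rightarrow> 'r \<Rightarrow> 'r \<Rightarrow> 'r \<Rightarrow> 'r \<Rightarrow> 'r \<Rightarrow> 'r \<Rightarrow> 'r \<Rightarrow> int \<Rightarrow> bool" where
  "based a c s d z d0 Z X K \<longleftrightarrow> z\<^sup>2 = (chain c s Z X K)\<^sup>2 \<and>
     c dvd d - (d0 + (of_int K)\<^sup>2 * a + 2 * of_int K * (s * X * Z))"

lemma square_eq_signs:
  fixes p q :: "'r::idom"
  assumes "p\<^sup>2 = q\<^sup>2"
  obtains e :: int where "e = 1 \<or> e = -1" "p = of_int e * q"
  using assms by (auto simp: power2_eq_iff) (metis of_int_1 mult_1, metis of_int_1 of_int_minus mult_minus1)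

lemma based_intro:
  assumes z: "z = lucas s z0 (s * z0 + c * x0) k"
    and d: "c dvd d - (d0 + (of_nat k)\<^sup>2 * a + 2 * of_nat k * (s * x0 * z0))"
    and sq: "z0\<^sup>2 = Z\<^sup>2" "x0\<^sup>2 = X\<^sup>2"
  shows "\<exists>K. (even K \<longleftrightarrow> even k) \<and> based a c s d z d0 Z X K"
proof -
  obtain e where e: "e = 1 \<or> e = -1" "z0 = of_int e * Z" using square_eq_signs[OF sq(1)] .
  obtain f where f: "f = 1 \<or> f = -1" "x0 = of_int f * X" using square_eq_signs[OF sq(2)] .
  let ?K = "e * f * int k"
  have K: "\<bar>?K\<bar> = int k" using e f by auto
  have q: "s * z0 + c * x0 = of_int e * (s * Z + of_int (e * f) * c * X)"
    using e f by (auto simp: algebra_simps)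
  have "z = of_int e * lucas s Z (s * Z + of_int (e * f) * c * X) k"
    unfolding z q unfolding e(2) by (rule lucas_mult)
  also have "lucas s Z (s * Z + of_int (e * f) * c * X) k = chain c s Z X ?K"
    using e f K by (cases k) (auto simp: chain_def simp del: lucas.simps(3) of_nat_Suc)
  finally have "z\<^sup>2 = (chain c s Z X ?K)\<^sup>2" using e(1) by (auto simp: power_mult_distrib)
  moreover have "(of_nat k)\<^sup>2 * a + 2 * of_nat k * (s * x0 * z0)
      = (of_int ?K)\<^sup>2 * a + 2 * of_int ?K * (s * X * Z)"
    using e f by auto
  moreover have "even ?K \<longleftrightarrow> even k" using e f by auto
  ultimately show ?thesis using d unfolding based_def by (intro exI[of _ ?K]) (simp add: add.assoc)
qed

text \<open>Other square roots for the same base only change the sign of the index.\<close>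

lemma based_rebase:
  assumes "based a c s d z d0 z0 x0 K" "z0\<^sup>2 = Z\<^sup>2" "x0\<^sup>2 = X\<^sup>2"
  shows "\<exists>L. (even L \<longleftrightarrow> even K) \<and> based a c s d z d0 Z X L"
proof -
  let ?x = "of_int (sgn K) * x0"
  show ?thesis
  proof (cases "K = 0")
    case True
    have "z\<^sup>2 = Z\<^sup>2" "c dvd d - d0" using assms True unfolding based_def by (auto simp: chain_def)
    then have "based a c s d z d0 Z X 0" by (auto simp: based_def chain_def)
    then show ?thesis using True by (intro exI[of _ 0]) auto
  next
    case False
    then have x: "?x\<^sup>2 = X\<^sup>2" using assms by (auto simp: power_mult_distrib sgn_if)
    let ?z = "lucas s z0 (s * z0 + c * ?x) (nat \<bar>K\<bar>)"
    have d: "c dvd d - (d0 + (of_nat (nat \<bar>K\<bar>))\<^sup>2 * a + 2 * of_nat (nat \<bar>K\<bar>) * (s * ?x * z0))"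
      using assms(1) False unfolding based_def by (auto simp: sgn_if)
    obtain L where "even L \<longleftrightarrow> even (nat \<bar>K\<bar>)" "based a c s d ?z d0 Z X L"
      using based_intro[OF refl d assms(2) x] by blast
    moreover have "z\<^sup>2 = ?z\<^sup>2" using assms(1) unfolding based_def chain_def by (simp add: algebra_simps)
    ultimately show ?thesis unfolding based_def by (intro exI[of _ L]) (auto simp: even_nat_iff)
  qed
qed

lemma square_mod:
  fixes a c s :: "'r::idom"
  assumes "a * c + 1 = s\<^sup>2"
  shows "even k \<Longrightarrow> c dvd s ^ k - 1" "odd k \<Longrightarrow> c dvd s ^ k - s"
proof -
  have *: "c dvd (s\<^sup>2) ^ m - 1" for m
  proof (induction m)
    case (Suc m)
    have "(s\<^sup>2) ^ Suc m - 1 = ((s\<^sup>2) ^ m - 1) * s\<^sup>2 + a * c"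
      using assms[symmetric] by (simp add: algebra_simps)
    then show ?case using Suc by simp
  qed simp
  show "even k \<Longrightarrow> c dvd s ^ k - 1" using * by (auto elim!: evenE simp: power_mult)
  show "odd k \<Longrightarrow> c dvd s ^ k - s"
  proof -
    assume "odd k"
    then obtain m where k: "k = 2 * m + 1" by (auto elim: oddE)
    have "s ^ k - s = s * ((s\<^sup>2) ^ m - 1)" unfolding k power_add power_mult by (simp add: algebra_simps)
    then show ?thesis using * by simp
  qed
qed

text \<open>One of two factors has at least the degree of their sum; if the product is not much larger, the
  other factor is small.\<close>

lemma one_factor_small:
  fixes P Q :: "'k::field_char_0 poly"
  assumes "degree (P * Q) \<le> N" "N < degree (P + Q) + m" "0 < m"
  shows "degree P < m \<or> degree Q < m"
proof (cases "P = 0 \<or> Q = 0")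
  case False
  then have "degree P + degree Q \<le> N" using assms(1) by (simp add: degree_mult_eq)
  moreover have "degree (P + Q) \<le> max (degree P) (degree Q)" by (rule degree_add_le_max)
  ultimately show ?thesis using assms by linarith
qed (use assms(3) in auto)

locale poly_subring =
  fixes S :: "'k::field_char_0 poly set"
  assumes one_mem: "1 \<in> S"
    and add_mem: "p \<in> S \<Longrightarrow> q \<in> S \<Longrightarrow> p + q \<in> S"
    and diff_mem: "p \<in> S \<Longrightarrow> q \<in> S \<Longrightarrow> p - q \<in> S"
    and mult_mem: "p \<in> S \<Longrightarrow> q \<in> S \<Longrightarrow> p * q \<in> S"
begin

lemma zero_mem: "0 \<in> S" using diff_mem[OF one_mem one_mem] by simp
lemma uminus_mem: "p \<in> S \<Longrightarrow> - p \<in> S" using diff_mem[OF zero_mem] by simp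
lemma two_mem: "2 \<in> S" using add_mem[OF one_mem one_mem] by simp
lemma power_mem: "p \<in> S \<Longrightarrow> p ^ n \<in> S" by (induction n) (auto intro: one_mem mult_mem)

lemmas mem = one_mem add_mem diff_mem mult_mem zero_mem uminus_mem two_mem power_mem

end

locale pair = poly_subring S for S :: "'k::field_char_0 poly set" +
  fixes a c s :: "'k::field_char_0 poly"
  assumes pair_mem: "a \<in> S" "c \<in> S" "s \<in> S"
    and root: "a * c + 1 = s\<^sup>2"
    and nz: "a \<noteq> 0" "c \<noteq> 0" and deg: "degree a \<le> degree c" "0 < degree c"
begin

lemma degree_s: "2 * degree s = degree a + degree c" "0 < degree s" "s \<noteq> 0"
  using degree_root[OF root nz] deg by auto

lemma unstep:
  "s * (s * z - c * x) + c * (s * x - a * z) = z" "s * (s * x - a * z) + a * (s * z - c * x) = x"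
proof -
  have 1: "s * s = a * c + 1" using root by (simp add: power2_eq_square)
  have "s * (s * z - c * x) + c * (s * x - a * z) = (s * s) * z - a * c * z" by (simp add: algebra_simps)
  then show "s * (s * z - c * x) + c * (s * x - a * z) = z" unfolding 1 by (simp add: algebra_simps)
  have "s * (s * x - a * z) + a * (s * z - c * x) = (s * s) * x - a * c * x" by (simp add: algebra_simps)
  then show "s * (s * x - a * z) + a * (s * z - c * x) = x" unfolding 1 by (simp add: algebra_simps)
qed

text \<open>The \<open>z\<close>-coordinates of the two neighbours of a solution have sum \<open>2 s z\<close>, while their product is only
  \<open>c (a - c) + z\<^sup>2\<close>.  Therefore one of them has smaller degree than \<open>z\<close> as long as \<open>degree z \<ge> degree c\<close>.\<close>

lemma neighbours:
  assumes "a * d + 1 = x\<^sup>2" "c * d + 1 = z\<^sup>2"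
  shows "(s * z + c * x) * (s * z - c * x) = c * (a - c) + z\<^sup>2"
    and "degree ((s * z + c * x) * (s * z - c * x)) \<le> 2 * max (degree c) (degree z)"
    and "degree ((s * z + c * x) + (s * z - c * x)) = degree s + degree z" "z \<noteq> 0"
proof -
  let ?P = "s * z + c * x" and ?Q = "s * z - c * x"
  have "(s * z + c * x) * (s * z - c * x) = s\<^sup>2 * z\<^sup>2 - c\<^sup>2 * x\<^sup>2"
    by (simp add: square_simps)
  also have "\<dots> = z\<^sup>2 + a * c * (c * d + 1) - c\<^sup>2 * (a * d + 1)"
    using root[symmetric] assms by (simp add: algebra_simps)
  also have "\<dots> = c * (a - c) + z\<^sup>2" by (simp add: square_simps)
  finally show *: "?P * ?Q = c * (a - c) + z\<^sup>2" .
  have "degree (c * (a - c)) \<le> degree c + degree (a - c)" by (rule degree_mult_le)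
  also have "degree (a - c) \<le> degree c" using deg(1) by (simp add: degree_diff_le)
  finally have "degree (c * (a - c)) \<le> 2 * max (degree c) (degree z)" by simp
  moreover have "degree (z\<^sup>2) \<le> 2 * max (degree c) (degree z)" using degree_power_le[of z 2] by simp
  ultimately show "degree (?P * ?Q) \<le> 2 * max (degree c) (degree z)"
    unfolding * by (rule degree_add_le)
  show "z \<noteq> 0"
  proof
    assume "z = 0"
    then have "c * d + 1 = 0" using assms(2) by simp
    then have "c * (- d) = 1" by (metis eq_neg_iff_add_eq_0 minus_minus mult_minus_right)
    then have "c dvd 1" by (metis dvd_triv_left)
    then show False using deg(2) dvd_imp_degree_le[of c 1] by simp
  qed
  have "?P + ?Q = smult 2 (s * z)" by (simp add: numeral_poly)
  then show "degree (?P + ?Q) = degree s + degree z"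
    using \<open>z \<noteq> 0\<close> degree_s(3) by (simp add: degree_mult_eq)
qed

text \<open>The second disjunct of the last hypothesis records that the backward neighbour is the smaller one.  It is
  inherited by that neighbour, whose forward neighbour is the larger \<open>z\<close>; so the descent never turns round.\<close>

lemma descent:
  assumes "a * d + 1 = x\<^sup>2" "c * d + 1 = z\<^sup>2" "d \<in> S" "x \<in> S" "z \<in> S"
    and "degree z < degree c \<or> degree (s * z - c * x) < degree z"
  shows "\<exists>k d0 x0 z0. d0 \<in> S \<and> x0 \<in> S \<and> z0 \<in> S \<and> a * d0 + 1 = x0\<^sup>2 \<and> c * d0 + 1 = z0\<^sup>2 \<and>
     degree z0 < degree c \<and> (step a c s ^^ k) (z0, x0) = (z, x)"
  using assms
proof (induction "degree z" arbitrary: d x z rule: less_induct)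
  case less
  show ?case
  proof (cases "degree z < degree c")
    case True
    then show ?thesis using less.prems by (intro exI[of _ 0] exI[of _ d] exI[of _ x] exI[of _ z]) auto
  next
    case False
    let ?z = "s * z - c * x" and ?x = "s * x - a * z"
    let ?d = "a + c + d + 2 * (a * c * d - s * x * z)"
    have lt: "degree ?z < degree z" using False less.prems by auto
    have st: "a * ?d + 1 = ?x\<^sup>2" "c * ?d + 1 = ?z\<^sup>2"
      using step_state[OF root, of d "- x" z] less.prems by (auto simp: power2_commute)
    have unst: "s * ?z + c * ?x = z" "s * ?x + a * ?z = x"
      by (rule unstep)+
    have "degree ?z < degree c \<or> degree (s * ?z - c * ?x) < degree ?z"
    proof (cases "degree ?z < degree c")
      case False
      have "degree (s * ?z + c * ?x) < degree ?z \<or> degree (s * ?z - c * ?x) < degree ?z"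
        using neighbours(2,3)[OF st] False degree_s(2) deg
        by (intro one_factor_small[of _ _ "2 * degree ?z"]) auto
      then show ?thesis using lt unst by auto
    qed auto
    moreover have "?d \<in> S" "?x \<in> S" "?z \<in> S"
      using less.prems pair_mem by (auto intro!: mem)
    ultimately obtain k d0 x0 z0 where "d0 \<in> S \<and> x0 \<in> S \<and> z0 \<in> S \<and> a * d0 + 1 = x0\<^sup>2 \<and> c * d0 + 1 = z0\<^sup>2 \<and>
     degree z0 < degree c \<and> (step a c s ^^ k) (z0, x0) = (?z, ?x)"
      using less.hyps[OF lt st] by blast
    then show ?thesis using unst
      by (intro exI[of _ "Suc k"] exI[of _ d0] exI[of _ x0] exI[of _ z0]) (simp add: step_def)
  qed
qed

text \<open>An odd number of steps can be made even: one step from \<open>d0\<close>, in one of the two directions, stays below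
  \<open>degree c\<close>.  This needs \<open>degree c < degree s + degree z0\<close> and fails only for \<open>d0 = 0\<close> and for constants
  \<open>a\<close> and \<open>d0\<close>.\<close>

lemma reachable:
  assumes st: "a * d + 1 = x\<^sup>2" "c * d + 1 = z\<^sup>2" and S: "d \<in> S" "x \<in> S" "z \<in> S"
  shows "\<exists>k d0 x0 z0 x'. d0 \<in> S \<and> x0 \<in> S \<and> z0 \<in> S \<and> a * d0 + 1 = x0\<^sup>2 \<and> c * d0 + 1 = z0\<^sup>2 \<and>
     degree z0 < degree c \<and> (step a c s ^^ k) (z0, x0) = (z, x') \<and>
     (even k \<or> d0 = 0 \<or> (degree a = 0 \<and> degree d0 = 0))"
proof -
  obtain x' where x': "x'\<^sup>2 = x\<^sup>2" "x' \<in> S" "degree z < degree c \<or> degree (s * z - c * x') < degree z"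
  proof (cases "degree z < degree c")
    case True then show ?thesis using that S by auto
  next
    case False
    have "degree (s * z + c * x) < degree z \<or> degree (s * z - c * x) < degree z"
      using neighbours(2,3)[OF st] False degree_s(2) deg
      by (intro one_factor_small[of _ _ "2 * degree z"]) auto
    then show ?thesis using that[of x] that[of "- x"] S by (auto intro: mem)
  qed
  obtain k d0 x0 z0 where S0: "d0 \<in> S" "x0 \<in> S" "z0 \<in> S" and st0: "a * d0 + 1 = x0\<^sup>2" "c * d0 + 1 = z0\<^sup>2"
    and lt: "degree z0 < degree c" and k: "(step a c s ^^ k) (z0, x0) = (z, x')"
    using descent[of d x' z] st S x' by auto
  show ?thesis
  proof (cases "even k \<or> d0 = 0 \<or> (degree a = 0 \<and> degree d0 = 0)")
    case True
    then show ?thesis using S0 st0 lt k by blast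
  next
    case False
    then obtain j where j: "k = Suc j" "even j" by (metis even_Suc not0_implies_Suc even_zero)
    have "2 * degree z0 = degree c + degree d0"
      using degree_root(1)[OF st0(2)] nz deg False by auto
    \<comment> \<open>Then one of the neighbours of \<open>d0\<close> has its root of degree less than \<open>degree c\<close>, too.\<close>
    then have "degree c < degree s + degree z0" using degree_s(1) deg False by auto
    then have "degree (s * z0 + c * x0) < degree c \<or> degree (s * z0 - c * x0) < degree c"
      using neighbours(2,3)[OF st0] lt deg by (intro one_factor_small[of _ _ "2 * degree c"]) auto
    then show ?thesis
    proof
      assume l: "degree (s * z0 + c * x0) < degree c"
      have "(step a c s ^^ j) (s * z0 + c * x0, s * x0 + a * z0) = (z, x')"
        using k unfolding j funpow_Suc_right by (simp add: step_def)
      moreover have "a + c + d0 + 2 * (a * c * d0 + s * x0 * z0) \<in> S" "s * z0 + c * x0 \<in> S" "s * x0 + a * z0 \<in> S"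
        using S0 pair_mem by (auto intro!: mem)
      ultimately show ?thesis using step_state[OF root st0] l j by blast
    next
      assume l: "degree (s * z0 - c * x0) < degree c"
      have "step a c s (s * z0 - c * x0, s * x0 - a * z0) = (z0, x0)"
        by (simp add: step_def unstep)
      then have "(step a c s ^^ Suc k) (s * z0 - c * x0, s * x0 - a * z0) = (z, x')"
        using k unfolding funpow_Suc_right by simp
      moreover have "a + c + d0 + 2 * (a * c * d0 - s * x0 * z0) \<in> S" "s * z0 - c * x0 \<in> S" "s * x0 - a * z0 \<in> S"
        using S0 pair_mem by (auto intro!: mem)
      moreover have "a * (a + c + d0 + 2 * (a * c * d0 - s * x0 * z0)) + 1 = (s * x0 - a * z0)\<^sup>2"
        "c * (a + c + d0 + 2 * (a * c * d0 - s * x0 * z0)) + 1 = (s * z0 - c * x0)\<^sup>2"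
        using step_state[OF root, of d0 "- x0" z0] st0 by (auto simp: power2_commute)
      moreover have "even (Suc k)" using j by simp
      ultimately show ?thesis using l by blast
    qed
  qed
qed

text \<open>As \<open>s\<^sup>2\<close> is \<open>1\<close> modulo \<open>c\<close>, the residue of \<open>z\<close> is that of \<open>z0\<close> after an even and that of \<open>s z0\<close> after an
  odd number of steps.  In the odd case \<open>z0\<close> is \<open>\<plusminus>1\<close> for the base \<open>0\<close> and \<open>\<plusminus>s\<close> for the base \<open>a\<close>, the only
  constant that can be a partner of \<open>c\<close>.\<close>

lemma resolution:
  assumes st: "a * d + 1 = x\<^sup>2" "c * d + 1 = z\<^sup>2" and S: "d \<in> S" "x \<in> S" "z \<in> S"
  obtains
    (even_base) d0 x0 z0 K where "d0 \<in> S" "x0 \<in> S" "z0 \<in> S" "a * d0 + 1 = x0\<^sup>2" "c * d0 + 1 = z0\<^sup>2"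
      "degree z0 < degree c" "even K" "c dvd z - z0" "based a c s d z d0 z0 x0 K"
  | (odd_zero) K where "odd K" "c dvd z - s \<or> c dvd z + s" "based a c s d z 0 1 1 K"
  | (odd_const) K w where "degree a = 0" "odd K" "a * a + 1 = w\<^sup>2" "c dvd z - 1 \<or> c dvd z + 1"
      "based a c s d z a s w K"
proof -
  obtain k d0 x0 z0 x' where S0: "d0 \<in> S" "x0 \<in> S" "z0 \<in> S"
    and st0: "a * d0 + 1 = x0\<^sup>2" "c * d0 + 1 = z0\<^sup>2" and lt: "degree z0 < degree c"
    and k: "(step a c s ^^ k) (z0, x0) = (z, x')"
    and kk: "even k \<or> d0 = 0 \<or> (degree a = 0 \<and> degree d0 = 0)"
    using reachable[OF st S] by blast
  obtain d' where d': "c * d' + 1 = z\<^sup>2" and zc: "c dvd z - s ^ k * z0"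
    and dc: "c dvd d' - (d0 + (of_nat k)\<^sup>2 * a + 2 * of_nat k * (s * x0 * z0))"
    using step_congruence[OF root st0 k] by blast
  have dd: "d' = d" using d' st(2) nz by (metis add_right_cancel mult_left_cancel)
  have zl: "z = lucas s z0 (s * z0 + c * x0) k"
    using fst_funpow_step[OF root, of k z0 x0] k by simp
  have bas: "\<exists>K. (even K \<longleftrightarrow> even k) \<and> based a c s d z d0 Z X K" if "z0\<^sup>2 = Z\<^sup>2" "x0\<^sup>2 = X\<^sup>2" for Z X
    using based_intro[OF zl dc[unfolded dd] that] .
  consider "even k" | "odd k" "d0 = 0" | "odd k" "d0 \<noteq> 0" "degree a = 0" "degree d0 = 0"
    using kk by argo
  then show thesis
  proof cases
    case 1
    obtain K where K: "(even K \<longleftrightarrow> even k)" "based a c s d z d0 z0 x0 K" using bas by blast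
    have "c dvd (z - s ^ k * z0) + (s ^ k - 1) * z0" using zc square_mod(1)[OF root 1] by simp
    then have "c dvd z - z0" by (simp add: algebra_simps)
    then show thesis using even_base S0 st0 lt K 1 by blast
  next
    case 2
    then have o: "z0\<^sup>2 = 1\<^sup>2" "x0\<^sup>2 = 1\<^sup>2" using st0 by auto
    obtain K where K: "(even K \<longleftrightarrow> even k)" "based a c s d z 0 1 1 K" using bas[OF o] 2 by blast
    have "c dvd (z - s ^ k * z0) + (s ^ k - s) * z0" using zc square_mod(2)[OF root 2(1)] by simp
    then have "c dvd z - s * z0" by (simp add: algebra_simps)
    moreover have "z0 = 1 \<or> z0 = - 1" using o(1) by (simp add: power2_eq_1_iff)
    ultimately have "c dvd z - s \<or> c dvd z + s" by auto
    then show thesis using odd_zero K 2(1) by blast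
  next
    case 3
    have da: "d0 = a"
      using constant_partners_eq[of d0 a c z0 s] 3 nz deg st0 root by (auto simp: mult.commute)
    have o: "z0\<^sup>2 = s\<^sup>2" "x0\<^sup>2 = x0\<^sup>2" using st0 root da by (auto simp: mult.commute)
    obtain K where K: "(even K \<longleftrightarrow> even k)" "based a c s d z a s x0 K" using bas[OF o] da by blast
    have "c dvd (z - s ^ k * z0) + (s ^ k - s) * z0" using zc square_mod(2)[OF root 3(1)] by simp
    then have "c dvd z - s * z0" by (simp add: algebra_simps)
    moreover have "z0 = s \<or> z0 = - s" using o(1) by (simp add: power2_eq_iff)
    moreover have "s * s = a * c + 1" using root by (simp add: power2_eq_square)
    ultimately have "c dvd z - (a * c + 1) \<or> c dvd z - - (a * c + 1)" by (metis mult_minus_right)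
    then have "c dvd z - (a * c + 1) \<or> c dvd z + (a * c + 1)" by (simp only: diff_minus_eq_add)
    then have "c dvd (z - (a * c + 1)) + a * c \<or> c dvd (z + (a * c + 1)) - a * c"
      by (metis dvd_add dvd_diff dvd_triv_right)
    then have "c dvd z - 1 \<or> c dvd z + 1" by (simp add: algebra_simps)
    then show thesis using odd_const K 3(1,3) st0(1) da by blast
  qed
qed

end

section \<open>Linear relations within a regular quadruple\<close>

text \<open>Here \<open>c\<close> and \<open>g\<close> are the two regular extensions of \<open>{a, h, l}\<close>.  Squaring the relation and eliminating
  \<open>c\<close> gives a quadratic equation for \<open>h\<close> over \<open>a\<close>, \<open>l\<close>, \<open>g\<close>.  Subtracting a multiple of the quadratic
  equation that regularity of \<open>{a, h, l, g}\<close> gives for \<open>h\<close>, one obtains \<open>h B = R\<close> with \<open>R\<close> of degree at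
  most that of the squares of \<open>a\<close> and \<open>l\<close>.  The large degree of \<open>h\<close> then forces \<open>B\<close> to lose its leading
  terms one after the other, and this determines \<open>l\<close> and \<open>H Q\<close>.\<close>

lemma linear_relation_cases:
  fixes a h l g c s q u p :: "'k::field_char_0 poly" and M H Q L :: int
  assumes rel: "of_int M * s = of_int H * h + of_int Q * a + of_int L * l"
    and s: "a * c + 1 = s\<^sup>2"
    and sum: "c + g = 2 * (a + h + l + 2 * a * h * l)"
    and prd: "c * g = a\<^sup>2 + h\<^sup>2 + l\<^sup>2 - 2 * a * h - 2 * a * l - 2 * h * l - 4"
    and q: "a * g + 1 = q\<^sup>2" and u: "l * a + 1 = u\<^sup>2" and p: "l * g + 1 = p\<^sup>2"
    and nz: "a \<noteq> 0" "l \<noteq> 0" "M \<noteq> 0" "H \<noteq> 0"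
    and da: "0 < degree a" and dg: "degree g = degree a" and dh: "degree h = 2 * degree a + degree l"
  shows "degree l = 0" "H * Q = H\<^sup>2 - 2 * M\<^sup>2" "H\<^sup>2 \<noteq> M\<^sup>2"
proof -
  define m n e f :: "'k poly" where "m = of_int M" and "n = of_int H" and "e = of_int Q" and "f = of_int L"
  note df = m_def n_def e_def f_def
  have const: "degree m = 0" "degree n = 0" "degree e = 0" "degree f = 0" by (simp_all add: df)
  have mn: "m \<noteq> 0" "n \<noteq> 0" using nz by (simp_all add: df)
  have dcm: "degree (k * w) \<le> N" if "degree k = 0" "degree w \<le> N" for k w :: "'k poly" and N
    using degree_mult_le[of k w] that by simp
  have d2: "degree (v * w) \<le> N" if "degree v + degree w \<le> N" for v w :: "'k poly" and N
    using degree_mult_le[of v w] that by simp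
  define E where "E = n\<^sup>2 * g - m\<^sup>2 * a"
  define W where "W = 2 * (n\<^sup>2 + n * e - m\<^sup>2) * a + 2 * (n\<^sup>2 + n * f) * l + 2 * n\<^sup>2 * g"
  define B where "B = 4 * (a * l * E) + W"
  define R where "R = n\<^sup>2 * (a\<^sup>2 + l\<^sup>2 + g\<^sup>2 - 2 * (a * l) - 2 * (a * g) - 2 * (l * g) - 4) - (e * a + f * l)\<^sup>2
     + m\<^sup>2 * (2 * a\<^sup>2 + 2 * (a * l) - a * g + 1)"
  have c: "c = 2 * (a + h + l + 2 * a * h * l) - g" using sum by (simp add: algebra_simps)
  \<comment> \<open>Regularity of \<open>{a, h, l, g}\<close>, as a quadratic equation for \<open>h\<close>.\<close>
  have quad: "h\<^sup>2 - 2 * h * (a + l + g + 2 * a * l * g) + (a\<^sup>2 + l\<^sup>2 + g\<^sup>2 - 2 * (a * l) - 2 * (a * g) - 2 * (l * g) - 4) = 0"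
    using prd unfolding c by (simp add: square_simps)
  have sq: "(n * h + e * a + f * l)\<^sup>2 = m\<^sup>2 * (a * c + 1)"
    using rel unfolding s df[symmetric] by (metis power_mult_distrib)
  have hB: "h * B = R"
  proof -
    have "h * B - R = (n * h + e * a + f * l)\<^sup>2 - m\<^sup>2 * (a * c + 1)
      - n\<^sup>2 * (h\<^sup>2 - 2 * h * (a + l + g + 2 * a * l * g) + (a\<^sup>2 + l\<^sup>2 + g\<^sup>2 - 2 * (a * l) - 2 * (a * g) - 2 * (l * g) - 4))"
      unfolding B_def R_def W_def E_def c by (simp add: square_simps)
    then show ?thesis using quad sq by simp
  qed
  let ?N = "max (degree a) (degree l)"
  have num: "degree (2 :: 'k poly) = 0" "degree (4 :: 'k poly) = 0" "degree (1 :: 'k poly) \<le> N" "degree (4 :: 'k poly) \<le> N" for N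
    by simp_all
  have cs: "degree (n\<^sup>2) = 0" "degree (m\<^sup>2) = 0"
    using degree_power_le[of n 2] degree_power_le[of m 2] const by auto
  have cs2: "degree (n * e) = 0" "degree (n * f) = 0"
    using degree_mult_le[of n e] degree_mult_le[of n f] const by auto
  have cs3: "degree (2 * (n\<^sup>2 + n * e - m\<^sup>2)) = 0" "degree (2 * (n\<^sup>2 + n * f)) = 0" "degree (2 * n\<^sup>2) = 0"
    using dcm[OF num(1), of "n\<^sup>2 + n * e - m\<^sup>2" 0] dcm[OF num(1), of "n\<^sup>2 + n * f" 0] dcm[OF num(1), of "n\<^sup>2" 0]
      degree_add_le[of "n\<^sup>2" 0 "n * e"] degree_add_le[of "n\<^sup>2" 0 "n * f"]
      degree_diff_le[of "n\<^sup>2 + n * e" 0 "m\<^sup>2"] cs cs2 by auto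
  have prod: "degree (a\<^sup>2) \<le> 2 * ?N" "degree (l\<^sup>2) \<le> 2 * ?N" "degree (g\<^sup>2) \<le> 2 * ?N"
    "degree (a * l) \<le> 2 * ?N" "degree (a * g) \<le> 2 * ?N" "degree (l * g) \<le> 2 * ?N"
    using dg unfolding power2_eq_square by (auto intro!: d2)
  have lin: "degree (e * a + f * l) \<le> ?N" by (intro degree_add_le dcm const) auto
  then have linsq: "degree ((e * a + f * l)\<^sup>2) \<le> 2 * ?N" using degree_power_le[of "e * a + f * l" 2] by linarith
  have dR: "degree R \<le> 2 * max (degree a) (degree l)"
    unfolding R_def by (intro degree_add_le degree_diff_le dcm prod linsq cs num)
  have dW: "degree W \<le> max (degree a) (degree l)"
    unfolding W_def by (intro degree_add_le dcm cs3) (auto simp: dg)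
  \<comment> \<open>If \<open>n\<^sup>2 g = m\<^sup>2 a\<close>, then \<open>(m a)\<^sup>2 + n\<^sup>2 = (n q)\<^sup>2\<close>, against the rigidity of squares.\<close>
  have E0: "E \<noteq> 0"
  proof
    assume "E = 0"
    then have "1 * (m * a)\<^sup>2 + n\<^sup>2 = n\<^sup>2 * (a * g + 1)"
      by (simp add: E_def square_simps)
    then have "1 * (m * a)\<^sup>2 + n\<^sup>2 = (n * q)\<^sup>2" unfolding q by (simp add: power_mult_distrib)
    then have "degree (m * a) = 0"
      by (rule square_shift_const) (use mn cs in auto)
    then show False using mn nz da by (simp add: degree_mult_eq const)
  qed
  have d4: "degree (4 * (a * l * E)) = degree a + degree l + degree E"
    using nz E0 by (simp add: degree_mult_eq numeral_poly)
  have hnz: "h \<noteq> 0" using dh da by auto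
  have big: "degree B = degree a + degree l + degree E" "B \<noteq> 0" if "degree l > 0 \<or> degree E > 0"
  proof -
    have lt: "degree W < degree (4 * (a * l * E))" using dW d4 that da by auto
    show "degree B = degree a + degree l + degree E" unfolding B_def using degree_add_eq_left[OF lt] d4 by simp
    then show "B \<noteq> 0" using da by auto
  qed
  have hBdeg: "degree h + degree B \<le> 2 * max (degree a) (degree l)" if "B \<noteq> 0"
    using dR hB degree_mult_eq[OF hnz that] by simp
  show l0: "degree l = 0"
  proof (rule ccontr)
    assume "degree l \<noteq> 0"
    then show False using big hBdeg dh da by auto
  qed
  have Ec: "degree E = 0"
  proof (rule ccontr)
    assume "degree E \<noteq> 0"
    then show False using big hBdeg dh da l0 by auto
  qed
  have B: "B = (4 * (l * E) + 2 * n\<^sup>2 + 2 * (n * e)) * a + (2 * (n\<^sup>2 + n * f) * l + 2 * E)"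
    unfolding B_def W_def E_def by (simp add: square_simps)
  \<comment> \<open>Now \<open>l\<close> and \<open>E\<close> are constant and \<open>B\<close> is linear in \<open>a\<close>; its slope vanishes, as \<open>h B\<close> has degree at most \<open>2 degree a\<close>.\<close>
  have c0: "4 * (l * E) + 2 * n\<^sup>2 + 2 * (n * e) = 0"
  proof (rule ccontr)
    let ?k = "4 * (l * E) + 2 * n\<^sup>2 + 2 * (n * e)" and ?j = "2 * (n\<^sup>2 + n * f) * l + 2 * E"
    assume k: "?k \<noteq> 0"
    have "degree ?k \<le> 0"
      by (intro degree_add_le dcm num d2) (auto simp: cs cs2 l0 Ec)
    then have dk: "degree (?k * a) = degree a" using k nz by (simp add: degree_mult_eq)
    have "degree ?j \<le> 0"
      by (intro degree_add_le dcm cs3 num) (auto simp: l0 Ec)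
    then have "degree ?j < degree (?k * a)" using da dk by simp
    then have "degree B = degree a" unfolding B using dk degree_add_eq_left by metis
    then show False using hBdeg dh da l0 by force
  qed
  \<comment> \<open>A second relation between the constants comes from the squares \<open>l a + 1\<close> and \<open>l g + 1\<close>.\<close>
  have "m\<^sup>2 * (l * a + 1) + (l * E + n\<^sup>2 - m\<^sup>2) = n\<^sup>2 * (l * g + 1)"
    unfolding E_def by (simp add: algebra_simps)
  then have pq: "m\<^sup>2 * u\<^sup>2 + (l * E + n\<^sup>2 - m\<^sup>2) = (n * p)\<^sup>2"
    unfolding u p by (simp add: power_mult_distrib)
  have "2 * degree u = degree l + degree a" using degree_root(1)[OF u] nz da by simp
  moreover have "degree (l * E + n\<^sup>2 - m\<^sup>2) \<le> 0"
    by (intro degree_add_le degree_diff_le d2) (auto simp: cs l0 Ec)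
  ultimately have lE: "l * E + n\<^sup>2 - m\<^sup>2 = 0"
    using square_shift_const[OF pq cs(2)] mn da by auto
  have "n * e = n\<^sup>2 - 2 * m\<^sup>2"
  proof -
    have "2 * (n * e) = 2 * (n\<^sup>2 - 2 * m\<^sup>2)" using c0 lE by algebra
    then show ?thesis by (metis mult_left_cancel zero_neq_numeral)
  qed
  then have "of_int (H * Q) = (of_int (H\<^sup>2 - 2 * M\<^sup>2) :: 'k poly)" by (simp add: df)
  then show "H * Q = H\<^sup>2 - 2 * M\<^sup>2" by (simp only: of_int_eq_iff)
  show "H\<^sup>2 \<noteq> M\<^sup>2"
  proof
    assume "H\<^sup>2 = M\<^sup>2"
    then have "n\<^sup>2 = m\<^sup>2" unfolding df by (metis of_int_power)
    then show False using lE nz E0 by simp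
  qed
qed

text \<open>Multiplied by \<open>a\<^sup>2\<close>, the last hypothesis, which says that \<open>{a, a, b, f}\<close> satisfies the equation of a regular
  quadruple, becomes \<open>(u\<^sup>2 - r\<^sup>2)\<^sup>2 = (2 a r u)\<^sup>2\<close>.  This is homogeneous in \<open>u\<close> and \<open>r\<close> with constant
  coefficients, so \<open>u / r\<close> is a constant \<open>\<kappa>\<close>.  Moreover \<open>\<kappa> = a + \<omega>\<close> for a square root \<open>\<omega>\<close> of \<open>a\<^sup>2 + 1\<close>.\<close>

lemma proportional_roots:
  fixes b f r u :: "'k::field_char_0 poly"
  assumes r: "[:a:] * b + 1 = r\<^sup>2" and u: "[:a:] * f + 1 = u\<^sup>2" and a: "a \<noteq> 0" and db: "degree b > 0" "f \<noteq> 0"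
    and reg: "(b + f - 2 * [:a:])\<^sup>2 = 4 * ([:a:]\<^sup>2 + 1) * (b * f + 1)"
  shows "\<exists>\<kappa> \<omega>. \<kappa> \<noteq> 0 \<and> \<kappa>\<^sup>2 - 1 = 2 * a * \<kappa> \<and> 2 * \<kappa> * \<omega> = \<kappa>\<^sup>2 + 1 \<and> \<omega>\<^sup>2 = a\<^sup>2 + 1 \<and> u\<^sup>2 = ([:\<kappa>:] * r)\<^sup>2"
proof -
  define A where "A = [:a:]"
  note r = r[folded A_def] and u = u[folded A_def] and reg = reg[folded A_def]
  have "(u\<^sup>2 - r\<^sup>2)\<^sup>2 = 4 * A\<^sup>2 * r\<^sup>2 * u\<^sup>2"
  proof -
    have "(A * b + A * f - 2 * A\<^sup>2)\<^sup>2 = 4 * (A\<^sup>2 + 1) * ((A * b) * (A * f) + A\<^sup>2)"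
      using arg_cong[OF reg, of "\<lambda>w. A\<^sup>2 * w"] by (simp add: square_simps)
    then show ?thesis using r u by algebra
  qed
  then have "(u\<^sup>2 - r\<^sup>2)\<^sup>2 = (2 * A * r * u)\<^sup>2" by (simp add: power_mult_distrib)
  then have "u\<^sup>2 - r\<^sup>2 = 2 * A * r * u \<or> u\<^sup>2 - r\<^sup>2 = 2 * A * r * (- u)" by (auto simp: power2_eq_iff)
  then obtain v where v: "v\<^sup>2 = u\<^sup>2" "v\<^sup>2 - r\<^sup>2 = 2 * A * r * v" by (metis power2_minus)
  have nzA: "A \<noteq> 0" "b \<noteq> 0" and A0: "degree A = 0" using a db by (auto simp: A_def)
  have r0: "2 * degree r = degree b" "r \<noteq> 0" using degree_root[OF r nzA] db A0 by auto
  have v0: "v \<noteq> 0" using v r0 by auto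
  have dA: "degree (2 * A * r * v) = degree r + degree v"
    using r0 v0 nzA A0 by (simp add: degree_mult_eq numeral_poly)
  have dvr: "degree v = degree r"
  proof (rule ccontr)
    assume ne: "degree v \<noteq> degree r"
    have "degree (v\<^sup>2 - r\<^sup>2) = 2 * max (degree v) (degree r)"
    proof (cases "degree v < degree r")
      case True
      then have "degree (v\<^sup>2) < degree (- (r\<^sup>2))" using r0 v0 by (simp add: degree_power_eq)
      then have "degree (v\<^sup>2 + - (r\<^sup>2)) = degree (- (r\<^sup>2))" by (rule degree_add_eq_right)
      then show ?thesis using True r0 by (simp add: degree_power_eq)
    next
      case False
      then have "degree (- (r\<^sup>2)) < degree (v\<^sup>2)" using ne r0 v0 by (simp add: degree_power_eq)
      then have "degree (v\<^sup>2 + - (r\<^sup>2)) = degree (v\<^sup>2)" by (rule degree_add_eq_left)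
      then show ?thesis using False v0 by (simp add: degree_power_eq)
    qed
    then show False using dA v(2) ne by simp
  qed
  define \<kappa> where "\<kappa> = lead_coeff v / lead_coeff r"
  have k0: "\<kappa> \<noteq> 0" using r0 v0 by (simp add: \<kappa>_def)
  have lv: "lead_coeff v = \<kappa> * lead_coeff r" using r0 by (simp add: \<kappa>_def)
  have "coeff (v\<^sup>2) (2 * degree r) - coeff (r\<^sup>2) (2 * degree r) = coeff (2 * A * r * v) (2 * degree r)"
    by (metis v(2) coeff_diff)
  moreover have "coeff (v\<^sup>2) (2 * degree r) = (\<kappa> * lead_coeff r)\<^sup>2"
    unfolding lv[symmetric] using dvr coeff_mult_degree_sum[of v v] by (simp add: power2_eq_square mult_2)
  moreover have "coeff (r\<^sup>2) (2 * degree r) = (lead_coeff r)\<^sup>2"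
    using coeff_mult_degree_sum[of r r] by (simp add: power2_eq_square mult_2)
  moreover have "coeff (2 * A * r * v) (2 * degree r) = 2 * a * lead_coeff r * (\<kappa> * lead_coeff r)"
  proof -
    have A2: "2 * A = [:2 * a:]" by (simp add: A_def numeral_poly)
    have "2 * A * r * v = [:2 * a:] * (r * v)" unfolding A2 by (rule mult.assoc)
    then have "2 * A * r * v = smult (2 * a) (r * v)" by (simp only: mult_pCons_left mult_zero_left pCons_0_0 add_0_right)
    moreover have "2 * degree r = degree r + degree v" using dvr by simp
    ultimately show ?thesis by (simp only: coeff_smult coeff_mult_degree_sum lv mult.assoc)
  qed
  ultimately have "(\<kappa> * lead_coeff r)\<^sup>2 - (lead_coeff r)\<^sup>2 = 2 * a * lead_coeff r * (\<kappa> * lead_coeff r)" by simp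
  then have "(lead_coeff r)\<^sup>2 * (\<kappa>\<^sup>2 - 1 - 2 * a * \<kappa>) = 0"
    by (simp add: square_simps)
  then have k1: "\<kappa>\<^sup>2 - 1 = 2 * a * \<kappa>" using r0 by simp
  define \<omega> where "\<omega> = (\<kappa>\<^sup>2 + 1) / (2 * \<kappa>)"
  have \<omega>: "2 * \<kappa> * \<omega> = \<kappa>\<^sup>2 + 1" using k0 by (simp add: \<omega>_def)
  have "(2 * \<kappa>)\<^sup>2 * \<omega>\<^sup>2 = (2 * \<kappa> * \<omega>)\<^sup>2" by (simp add: power_mult_distrib)
  also have "\<dots> = (\<kappa>\<^sup>2 - 1)\<^sup>2 + (2 * \<kappa>)\<^sup>2" unfolding \<omega> by (simp add: square_simps)
  also have "\<dots> = (2 * \<kappa>)\<^sup>2 * (a\<^sup>2 + 1)" unfolding k1 by (simp add: square_simps)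
  finally have \<omega>2: "\<omega>\<^sup>2 = a\<^sup>2 + 1" using k0 by simp
  define k j where "k = [:\<kappa>:]" and "j = [:1 / \<kappa>:]"
  have jk: "j * k = 1" using k0 by (simp add: j_def k_def one_pCons)
  have "1 / \<kappa> = \<kappa> - 2 * a" using k0 k1 by (simp add: field_simps power2_eq_square)
  then have j: "j = k - 2 * A" by (simp add: j_def k_def A_def numeral_poly)
  \<comment> \<open>With \<open>1 / \<kappa> = \<kappa> - 2 a\<close> the quadratic form in \<open>v\<close> and \<open>r\<close> factors; the second factor leads to the same \<open>\<kappa>\<close>.\<close>
  have "(v - k * r) * (v + j * r) = v\<^sup>2 - (k - j) * v * r - (j * k) * r\<^sup>2"
    by (simp add: square_simps)
  also have "\<dots> = v\<^sup>2 - r\<^sup>2 - 2 * A * r * v"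
    unfolding jk unfolding j by (simp add: algebra_simps)
  also have "\<dots> = 0" using v(2) by simp
  finally have "v = k * r \<or> v = - (j * r)" by (auto simp: eq_neg_iff_add_eq_0)
  then have "v = [:\<kappa>:] * r \<or> v = - ([:1 / \<kappa>:] * r)" unfolding k_def j_def .
  then show ?thesis
  proof
    assume "v = [:\<kappa>:] * r"
    then show ?thesis using k0 k1 \<omega> \<omega>2 v(1) by metis
  next
    assume w: "v = - ([:1 / \<kappa>:] * r)"
    then have "lead_coeff v = - (1 / \<kappa>) * lead_coeff r" by simp
    then have "(\<kappa> + 1 / \<kappa>) * lead_coeff r = 0" unfolding lv by (simp add: algebra_simps)
    then have e: "\<kappa> = - (1 / \<kappa>)" using r0 by (simp add: eq_neg_iff_add_eq_0)
    have "[:\<kappa>:] = [:- (1 / \<kappa>):]" using arg_cong[OF e, of "\<lambda>w. [:w:]"] .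
    also have "\<dots> = - [:1 / \<kappa>:]" by simp
    finally have "v = [:\<kappa>:] * r" unfolding w by (simp only: mult_minus_left)
    then show ?thesis using k0 k1 \<omega> \<omega>2 v(1) by metis
  qed
qed

lemma square_between: "n\<^sup>2 < m \<Longrightarrow> m < (n + 1)\<^sup>2 \<Longrightarrow> 0 \<le> n \<Longrightarrow> (L::int)\<^sup>2 \<noteq> m"
proof
  assume n: "n\<^sup>2 < m" "m < (n + 1)\<^sup>2" "0 \<le> n" and L: "L\<^sup>2 = m"
  have "n < \<bar>L\<bar>" using n L by (metis abs_le_square_iff abs_of_nonneg not_le)
  moreover have "\<bar>L\<bar> < n + 1" using n L by (metis abs_le_square_iff abs_of_nonneg add_nonneg_nonneg not_le zero_le_one)
  ultimately show False by simp
qed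

lemma divisor_of_15:
  fixes x :: int
  assumes "x dvd 15"
  shows "x \<in> {-15, -5, -3, -1, 1, 3, 5, 15}"
proof -
  have "\<bar>x\<bar> \<le> 15" using assms zdvd_imp_le[of "\<bar>x\<bar>" 15] by simp
  then have "\<bar>x\<bar> = 0 \<or> \<bar>x\<bar> = 1 \<or> \<bar>x\<bar> = 2 \<or> \<bar>x\<bar> = 3 \<or> \<bar>x\<bar> = 4 \<or> \<bar>x\<bar> = 5 \<or> \<bar>x\<bar> = 6 \<or> \<bar>x\<bar> = 7 \<or> \<bar>x\<bar> = 8 \<or> \<bar>x\<bar> = 9 \<or> \<bar>x\<bar> = 10 \<or> \<bar>x\<bar> = 11 \<or> \<bar>x\<bar> = 12 \<or> \<bar>x\<bar> = 13 \<or> \<bar>x\<bar> = 14 \<or> \<bar>x\<bar> = 15"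
    by presburger
  moreover have "\<bar>x\<bar> dvd 15" using assms by simp
  ultimately have "\<bar>x\<bar> = 1 \<or> \<bar>x\<bar> = 3 \<or> \<bar>x\<bar> = 5 \<or> \<bar>x\<bar> = 15"
    by (elim disjE) (simp_all only:, simp_all)
  then show ?thesis by auto
qed

text \<open>With \<open>K = 2 j\<close> the equation reads \<open>L\<^sup>2 (j + 4) = 4 j\<^sup>2 + j\<close>.  Modulo \<open>8\<close> this makes \<open>j\<close> odd, and
  division with remainder by \<open>j + 4\<close> shows that \<open>j + 4\<close> divides \<open>60\<close>, hence \<open>15\<close>.\<close>

lemma even_odd_relation:
  fixes K L :: int
  assumes "even K" "odd L" and eq: "(- K) * (1 + K - L\<^sup>2) = (- K)\<^sup>2 - 2 * (2 * L)\<^sup>2"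
  shows "(- K)\<^sup>2 = (2 * L)\<^sup>2"
proof -
  obtain j where j: "K = 2 * j" using assms by auto
  obtain i where i: "L = 2 * i + 1" using assms(2) by (rule oddE)
  have e1: "L\<^sup>2 * (j + 4) = 4 * j\<^sup>2 + j"
  proof -
    have "2 * (L\<^sup>2 * (j + 4)) = 2 * (4 * j\<^sup>2 + j)" using eq unfolding j by (simp add: square_simps)
    then show ?thesis by simp
  qed
  then have "4 * ((i\<^sup>2 + i) * (j + 4) + 1 - j\<^sup>2) = 0" unfolding i by (simp add: square_simps)
  then have "j\<^sup>2 = i * (i + 1) * (j + 4) + 1" by (simp add: square_simps)
  then have "odd (j\<^sup>2)" by simp
  then have jo: "odd (j + 4)" by simp
  have "2 * (2 * 15) = (j + 4) * (L\<^sup>2 - 4 * j + 15)" using e1 by (simp add: square_simps)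
  then have "j + 4 dvd 2 * (2 * 15)" by (rule dvdI)
  moreover have "coprime (j + 4) 2" using jo by simp
  ultimately have dv: "j + 4 dvd 15" by (simp only: coprime_dvd_mult_right_iff)
  then have "j + 4 \<in> {-15, -5, -3, -1, 1, 3, 5, 15}" by (rule divisor_of_15)
  then have "j = -19 \<or> j = -9 \<or> j = -7 \<or> j = -5 \<or> j = -3 \<or> j = -1 \<or> j = 1 \<or> j = 11" by auto
  moreover have "L\<^sup>2 \<noteq> 33" using square_between[of 5 33 L] by simp
  moreover have "j > -4"
  proof (rule ccontr)
    assume "\<not> j > -4"
    then have "L\<^sup>2 * (j + 4) \<le> 0" "(- j) * (- (4 * j + 1)) > 0"
      by (auto intro!: mult_nonneg_nonpos mult_pos_pos simp del: mult_minus_left mult_minus_right)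
    then show False using e1 by (simp add: square_simps)
  qed
  ultimately show ?thesis using e1 unfolding j by (elim disjE) (auto simp: power_mult_distrib)
qed

text \<open>The equation reads \<open>K\<^sup>2 (8 - (L\<^sup>2 + L)) = (L\<^sup>2 + L) (L\<^sup>2 - 1)\<close>, with positive right-hand side.  So
  \<open>L\<^sup>2 + L < 8\<close>, and \<open>L = \<plusminus>2\<close>.\<close>

lemma even_shift_relation:
  fixes K L :: int
  assumes "even L" "L \<noteq> 0" and eq: "(L\<^sup>2 + L) * (1 + L - K\<^sup>2) = (L\<^sup>2 + L)\<^sup>2 - 2 * (2 * K)\<^sup>2"
  shows "(L\<^sup>2 + L)\<^sup>2 = (2 * K)\<^sup>2"
proof -
  have e: "K\<^sup>2 * (8 - (L\<^sup>2 + L)) = (L\<^sup>2 + L) * (L\<^sup>2 - 1)" using eq by (simp add: square_simps)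
  have "\<bar>L\<bar> \<ge> 2" using assms by presburger
  then have l2: "L\<^sup>2 \<ge> 4" using power_mono[of 2 "\<bar>L\<bar>" 2] by simp
  have "L\<^sup>2 + L = L * (L + 1)" by (simp add: square_simps)
  then have "L\<^sup>2 + L > 0" using \<open>\<bar>L\<bar> \<ge> 2\<close> by (cases "L > 0") (auto simp: mult_neg_neg)
  then have "K\<^sup>2 * (8 - (L\<^sup>2 + L)) > 0" unfolding e using l2 by simp
  then have "L * (L + 1) < 8" using \<open>L\<^sup>2 + L = L * (L + 1)\<close> by (simp add: zero_less_mult_iff)
  have "L < 3"
  proof (rule ccontr)
    assume "\<not> L < 3" then have "3 * 4 \<le> L * (L + 1)" by (intro mult_mono) auto
    then show False using \<open>L * (L + 1) < 8\<close> by simp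
  qed
  moreover have "L > -4"
  proof (rule ccontr)
    assume "\<not> L > -4" then have "4 * 3 \<le> (- L) * (- L - 1)" by (intro mult_mono) auto
    then show False using \<open>L * (L + 1) < 8\<close> by (simp add: algebra_simps)
  qed
  ultimately have "L = 2 \<or> L = -2" using \<open>\<bar>L\<bar> \<ge> 2\<close> assms(1) by (presburger)
  then show ?thesis using e by (auto simp: power_mult_distrib)
qed

section \<open>Triples with an irregular extension\<close>

lemma const_simps:
  "[:p + q:] = [:p:] + [:q:]" "[:p - q:] = [:p:] - [:q:]" "[:- p:] = - [:p:]" "[:p * q:] = [:p:] * [:q:]"
  "[:p ^ n:] = [:p:] ^ n" "[:of_int k:] = of_int k" "[:numeral m:] = numeral m" "[:1:] = 1" "[:0:] = 0"
  for p q :: "'k::field_char_0"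
  by (simp_all add: of_int_poly numeral_poly poly_const_pow one_pCons)

lemma degree_of_int_power_mult_less:
  "degree p < n \<Longrightarrow> degree ((of_int K)\<^sup>2 * (p::'k::field_char_0 poly)) < n"
  using degree_of_int_mult_less[of p n "K\<^sup>2"] by simp

lemma degree_two_of_int_mult_less:
  "degree p < n \<Longrightarrow> degree (2 * of_int K * (p::'k::field_char_0 poly)) < n"
  using degree_of_int_mult_less[of p n "2 * K"] by simp

lemmas degree_less_intros = degree_add_less degree_diff_less degree_of_int_power_mult_less
  degree_two_of_int_mult_less degree_of_int_mult_less

text \<open>This form is the product of the two regular extensions of \<open>{p, q, h}\<close>.\<close>

lemma degree_dominant_form:
  fixes p q h :: "'k::field_char_0 poly"
  assumes p: "degree p < degree h" and q: "degree q < degree h"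
  shows "degree (p\<^sup>2 + q\<^sup>2 + h\<^sup>2 - 2 * p * q - 2 * p * h - 2 * q * h - 4) = 2 * degree h"
proof -
  have h: "h \<noteq> 0" "0 < degree h" using p by auto
  have two: "degree (2 * u * v) \<le> degree u + degree v" for u v :: "'k poly"
    using degree_mult_le[of "2 * u" v] by (simp add: numeral_poly)
  have "degree (p\<^sup>2) < 2 * degree h" "degree (q\<^sup>2) < 2 * degree h" "degree (2 * p * q) < 2 * degree h"
    "degree (2 * p * h) < 2 * degree h" "degree (2 * q * h) < 2 * degree h" "degree (4 :: 'k poly) < 2 * degree h"
    using p q h degree_power_le[of p 2] degree_power_le[of q 2] two[of p q] two[of p h] two[of q h] by auto
  then have "degree (p\<^sup>2 + q\<^sup>2 - 2 * p * q - 2 * p * h - 2 * q * h - 4) < degree (h\<^sup>2)"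
    using h by (simp add: degree_power_eq degree_add_less degree_diff_less)
  then have "degree (p\<^sup>2 + q\<^sup>2 - 2 * p * q - 2 * p * h - 2 * q * h - 4 + h\<^sup>2) = 2 * degree h"
    using degree_add_eq_right h by (metis degree_power_eq)
  then show ?thesis by (simp add: algebra_simps)
qed

lemma regular_extension_product:
  fixes a b c r s t :: "'r::comm_ring_1"
  assumes "a * b + 1 = r\<^sup>2" "a * c + 1 = s\<^sup>2" "b * c + 1 = t\<^sup>2"
  shows "(a + b + c + 2 * a * b * c - 2 * (r * s * t)) * (a + b + c + 2 * a * b * c + 2 * (r * s * t))
    = a\<^sup>2 + b\<^sup>2 + c\<^sup>2 - 2 * a * b - 2 * a * c - 2 * b * c - 4"
proof -
  have "(e - 2 * (r * s * t)) * (e + 2 * (r * s * t)) = e\<^sup>2 - 4 * (r\<^sup>2 * s\<^sup>2 * t\<^sup>2)" for e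
    by (simp add: square_simps)
  then show ?thesis unfolding assms[symmetric] by (simp add: square_simps)
qed

text \<open>The signs of the roots are chosen such that the leading terms of \<open>a b c\<close> and \<open>r s t\<close> agree and nothing
  cancels.\<close>

lemma degree_upper_extension:
  fixes a b c r s t :: "'k::field_char_0 poly"
  assumes r: "a * b + 1 = r\<^sup>2" and s: "a * c + 1 = s\<^sup>2" and t: "b * c + 1 = t\<^sup>2"
    and nz: "a \<noteq> 0" "b \<noteq> 0" "c \<noteq> 0" and deg: "degree a \<le> degree b" "degree b \<le> degree c" "0 < degree b"
    and lead: "lead_coeff (r * s * t) = lead_coeff (a * b * c)"
  shows "degree (a + b + c + 2 * a * b * c + 2 * (r * s * t)) = degree a + degree b + degree c"
proof -
  let ?n = "degree a + degree b + degree c"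
  have d1: "degree (a * b * c) = ?n" using nz by (simp add: degree_mult_eq)
  have "r \<noteq> 0" "s \<noteq> 0" "t \<noteq> 0" "2 * degree r = degree a + degree b" "2 * degree s = degree a + degree c" "2 * degree t = degree b + degree c"
    using degree_root[OF r] degree_root[OF s] degree_root[OF t] nz deg by auto
  then have d2: "degree (r * s * t) = ?n" by (simp add: degree_mult_eq)
  have "coeff (a * b * c + r * s * t) ?n = 2 * lead_coeff (a * b * c)"
    using lead d1 d2 by simp
  also have "\<dots> \<noteq> 0" using nz by simp
  finally have "?n \<le> degree (a * b * c + r * s * t)" by (rule le_degree)
  moreover have "degree (a * b * c + r * s * t) \<le> ?n" using d1 d2 by (simp add: degree_add_le)
  ultimately have big: "degree (2 * (a * b * c + r * s * t)) = ?n" by (simp add: numeral_poly)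
  have "degree (a + b + c) < ?n" using deg by (intro degree_add_less) auto
  then have "degree (a + b + c + 2 * (a * b * c + r * s * t)) = ?n"
    using degree_add_eq_right[of "a + b + c" "2 * (a * b * c + r * s * t)"] big by simp
  then show ?thesis by (simp add: algebra_simps)
qed

text \<open>A counterexample \<open>d\<close>, together with the induction hypothesis \<open>minimal\<close>: all extensions of the triple of degree
  less than \<open>degree c\<close> are regular.\<close>

locale extended_triple = poly_subring S for S :: "'k::field_char_0 poly set" +
  fixes a b c d r s t x y z :: "'k::field_char_0 poly"
  assumes mems: "a \<in> S" "b \<in> S" "c \<in> S" "d \<in> S" "r \<in> S" "s \<in> S" "t \<in> S" "x \<in> S" "y \<in> S" "z \<in> S"
    and ab: "a * b + 1 = r\<^sup>2" and ac: "a * c + 1 = s\<^sup>2" and bc: "b * c + 1 = t\<^sup>2"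
    and ad: "a * d + 1 = x\<^sup>2" and bd: "b * d + 1 = y\<^sup>2" and cd: "c * d + 1 = z\<^sup>2"
    and nonzero: "a \<noteq> 0" "b \<noteq> 0" "c \<noteq> 0" "d \<noteq> 0"
    and distinct: "a \<noteq> b" "a \<noteq> c" "b \<noteq> c" "d \<noteq> a" "d \<noteq> b" "d \<noteq> c"
    and degs: "degree a \<le> degree b" "degree b \<le> degree c" "0 < degree b"
    and irregular: "(d - (a + b + c + 2 * a * b * c))\<^sup>2 \<noteq> 4 * (r * s * t)\<^sup>2"
    and minimal: "\<And>e u v w. \<lbrakk>e \<in> S; u \<in> S; v \<in> S; w \<in> S; a * e + 1 = u\<^sup>2; b * e + 1 = v\<^sup>2; c * e + 1 = w\<^sup>2;
       e \<noteq> 0; e \<noteq> a; e \<noteq> b; e \<noteq> c; degree e < degree c\<rbrakk> \<Longrightarrow> (e - (a + b + c + 2 * a * b * c))\<^sup>2 = 4 * (r * s * t)\<^sup>2"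
begin

lemma deg_c: "0 < degree c" using degs by simp

sublocale A: pair S a c s
  using mems ac nonzero degs by unfold_locales auto

sublocale B: pair S b c t
  using mems bc nonzero degs by unfold_locales auto

lemma degree_r: "2 * degree r = degree a + degree b" "r \<noteq> 0"
  using degree_root[OF ab] nonzero degs by auto

lemma ext_unique: "c * e + 1 = z\<^sup>2 \<Longrightarrow> e = d"
  using cd nonzero by (metis add_right_cancel mult_left_cancel)

lemma regular_square:
  "c * (a + b + c + 2 * a * b * c + 2 * (r * s * t)) + 1 = (s * t + c * r)\<^sup>2"
  "c * (a + b + c + 2 * a * b * c - 2 * (r * s * t)) + 1 = (s * t - c * r)\<^sup>2"
proof -
  have "(s * t + c * r)\<^sup>2 = s\<^sup>2 * t\<^sup>2 + 2 * c * (r * s * t) + c\<^sup>2 * r\<^sup>2"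
    "(s * t - c * r)\<^sup>2 = s\<^sup>2 * t\<^sup>2 - 2 * c * (r * s * t) + c\<^sup>2 * r\<^sup>2"
    by (simp_all add: square_simps)
  then show "c * (a + b + c + 2 * a * b * c + 2 * (r * s * t)) + 1 = (s * t + c * r)\<^sup>2"
    "c * (a + b + c + 2 * a * b * c - 2 * (r * s * t)) + 1 = (s * t - c * r)\<^sup>2"
    unfolding ab[symmetric] ac[symmetric] bc[symmetric] by (simp_all add: square_simps)
qed

lemma not_regular: "z\<^sup>2 \<noteq> (s * t + c * r)\<^sup>2" "z\<^sup>2 \<noteq> (s * t - c * r)\<^sup>2"
proof -
  have "d \<noteq> a + b + c + 2 * a * b * c + 2 * (r * s * t)" "d \<noteq> a + b + c + 2 * a * b * c - 2 * (r * s * t)"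
    using irregular by (auto simp: power_mult_distrib)
  then show "z\<^sup>2 \<noteq> (s * t + c * r)\<^sup>2" "z\<^sup>2 \<noteq> (s * t - c * r)\<^sup>2"
    using ext_unique regular_square by metis+
qed

lemma based_zero: "based k c v d z d0 Z X 0 \<Longrightarrow> z\<^sup>2 = Z\<^sup>2"
  by (simp add: based_def chain_def)

lemma z_not_base: "z\<^sup>2 \<noteq> 1" "z\<^sup>2 \<noteq> s\<^sup>2" "z\<^sup>2 \<noteq> t\<^sup>2"
  using ext_unique[of 0] ext_unique[of a] ext_unique[of b] ac bc nonzero distinct by (auto simp: mult.commute)

lemma collision:
  assumes "based a c s d z d0 Z X K" "based b c t d z d1 W Y L"
  shows "c dvd (d0 + (of_int K)\<^sup>2 * a + 2 * of_int K * (s * X * Z)) - (d1 + (of_int L)\<^sup>2 * b + 2 * of_int L * (t * Y * W))"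
proof -
  have "c dvd d - (d1 + (of_int L)\<^sup>2 * b + 2 * of_int L * (t * Y * W))"
    "c dvd d - (d0 + (of_int K)\<^sup>2 * a + 2 * of_int K * (s * X * Z))"
    using assms unfolding based_def by auto
  from dvd_diff[OF this] show ?thesis by (simp add: algebra_simps)
qed

lemma dvd_signs:
  assumes "c dvd z - p \<or> c dvd z + p" "c dvd z - q \<or> c dvd z + q"
  shows "c dvd p - q \<or> c dvd p + q"
proof -
  have "(z - q) - (z - p) = p - q" "(z + q) - (z - p) = p + q"
    "(z - q) - (z + p) = - (p + q)" "(z + q) - (z + p) = - (p - q)" by simp_all
  then show ?thesis using assms by (metis dvd_diff dvd_minus_iff)
qed

text \<open>A base is determined by the residue of its root up to sign, because the root has degree less than \<open>degree c\<close>.\<close>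

lemma base_of_residue:
  assumes "c * e + 1 = v\<^sup>2" "c * e' + 1 = w\<^sup>2" "c dvd w - v \<or> c dvd w + v" "degree v < degree c" "degree w < degree c"
  shows "e' = e" "w\<^sup>2 = v\<^sup>2"
proof -
  have "w = v \<or> w = - v"
    using assms(3) eq_of_dvd_degree_less[of c w v] eq_of_dvd_degree_less[of c w "- v"] assms(4,5) by auto
  then show v: "w\<^sup>2 = v\<^sup>2" by auto
  then have "c * e' + 1 = c * e + 1" using assms(1,2) by simp
  then show "e' = e" using nonzero by simp
qed

text \<open>Resolving \<open>d\<close> for both pairs gives two residues of \<open>z\<close> modulo \<open>c\<close>.  If both numbers of steps are even, the
  bases coincide.  Otherwise the residue of one chain locates the base of the other: its root is \<open>\<plusminus>t\<close>,
  \<open>\<plusminus>s\<close> or \<open>\<plusminus>1\<close> modulo \<open>c\<close>.\<close>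

lemma joint_resolution:
  obtains
    (common) e u v w K L where "e \<in> S" "u \<in> S" "v \<in> S" "w \<in> S" "a * e + 1 = u\<^sup>2" "b * e + 1 = v\<^sup>2" "c * e + 1 = w\<^sup>2"
      "degree w < degree c" "even K" "even L" "based a c s d z e w u K" "based b c t d z e w v L"
  | (even_zero) e u w K L where "a * e + 1 = u\<^sup>2" "c * e + 1 = w\<^sup>2" "degree w < degree c"
      "c dvd w - t \<or> c dvd w + t" "even K" "odd L" "based a c s d z e w u K" "based b c t d z 0 1 1 L"
  | (zero_even) e v w K L where "b * e + 1 = v\<^sup>2" "c * e + 1 = w\<^sup>2" "degree w < degree c"
      "c dvd w - s \<or> c dvd w + s" "odd K" "even L" "based a c s d z 0 1 1 K" "based b c t d z e w v L"
  | (zero_zero) K L where "c dvd s - t \<or> c dvd s + t" "odd K" "odd L" "based a c s d z 0 1 1 K" "based b c t d z 0 1 1 L"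
  | (const_zero) w K L where "degree a = 0" "a * a + 1 = w\<^sup>2" "odd K" "even L \<or> c dvd 1 - t \<or> c dvd 1 + t"
      "based a c s d z a s w K" "based b c t d z 0 1 1 L"
proof -
  from ad cd mems(4,8,10) show thesis
  proof (cases rule: A.resolution)
    case A: (even_base e u w K)
    from bd cd mems(4,9,10) show thesis
    proof (cases rule: B.resolution)
      case B: (even_base e' v w' L)
      have "w' = w"
        using eq_of_dvd_degree_less[OF _ B(6) A(6)] dvd_diff[OF A(8) B(8)] by simp
      then have "e' = e" using A(5) B(5) nonzero by (metis add_right_cancel mult_left_cancel)
      then show thesis using common[of e u v w K L] A B \<open>w' = w\<close> by simp
    next
      case B: (odd_zero L)
      then show thesis using even_zero[of e u w K L] A dvd_signs[OF disjI1[OF A(8)] B(2)] by simp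
    qed (use degs in simp)
  next
    case A: (odd_zero K)
    from bd cd mems(4,9,10) show thesis
    proof (cases rule: B.resolution)
      case B: (even_base e v w L)
      then show thesis using zero_even[of e v w K L] A dvd_signs[OF disjI1[OF B(8)] A(2)] by simp
    next
      case B: (odd_zero L)
      then show thesis using zero_zero[of K L] A dvd_signs[OF A(2) B(2)] by simp
    qed (use degs in simp)
  next
    case A: (odd_const K u)
    from bd cd mems(4,9,10) show thesis
    proof (cases rule: B.resolution)
      case B: (even_base e v w L)
      have "e = 0" "w\<^sup>2 = 1\<^sup>2"
        using base_of_residue[of 0 1 e w] B(5,6) dvd_signs[OF disjI1[OF B(8)] A(4)] deg_c by simp_all
      then show thesis using const_zero[of u K] A B(4,7) based_rebase[OF B(9), of 1 1] by auto
    next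
      case B: (odd_zero L)
      then show thesis using const_zero[of u K L] A dvd_signs[OF A(4) B(2)] by simp
    qed (use degs in simp)
  qed
qed

text \<open>A common base is an extension of the triple, and its degree is less than \<open>degree c\<close> because the degree of its
  root is; so the induction hypothesis applies.\<close>

lemma common_base:
  assumes "e \<in> S" "u \<in> S" "v \<in> S" "w \<in> S" and eq: "a * e + 1 = u\<^sup>2" "b * e + 1 = v\<^sup>2" "c * e + 1 = w\<^sup>2"
    and lt: "degree w < degree c"
  shows "e = 0 \<or> (e = a \<and> degree a = 0)
    \<or> e = a + b + c + 2 * a * b * c - 2 * (r * s * t) \<or> e = a + b + c + 2 * a * b * c + 2 * (r * s * t)"
proof (cases "e = 0")
  case False
  have "2 * degree w = degree c + degree e"
    using degree_root(1)[OF eq(3)] False nonzero deg_c by simp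
  then have lte: "degree e < degree c" using lt by simp
  have "e \<noteq> b" using self_product_succ_square[of b v] eq(2) degs by auto
  moreover have "degree a = 0" if "e = a" using self_product_succ_square[of a u] eq(1) that by auto
  moreover have "e \<noteq> c" using lte by auto
  moreover have "e = a + b + c + 2 * a * b * c - 2 * (r * s * t) \<or> e = a + b + c + 2 * a * b * c + 2 * (r * s * t)"
    if "e \<noteq> a" "e \<noteq> b" "e \<noteq> c"
  proof -
    have "(e - (a + b + c + 2 * a * b * c))\<^sup>2 = 4 * (r * s * t)\<^sup>2"
      using minimal assms False that lte by blast
    then have "(e - (a + b + c + 2 * a * b * c))\<^sup>2 = (2 * (r * s * t))\<^sup>2" by (simp add: power_mult_distrib)
    then have "e - (a + b + c + 2 * a * b * c) = 2 * (r * s * t) \<or> e - (a + b + c + 2 * a * b * c) = - (2 * (r * s * t))"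
      by (simp only: power2_eq_iff)
    then show ?thesis by (auto simp: algebra_simps)
  qed
  ultimately show ?thesis by blast
qed simp

end

section \<open>Triples with a gap between the two largest degrees\<close>

text \<open>The choice of signs makes \<open>hi\<close> the larger and \<open>lo\<close> the smaller regular extension of \<open>{a, b, c}\<close>.  Conversely
  \<open>c\<close> is a regular extension of \<open>{a, b, lo}\<close>, and \<open>co\<close> is the other one.  All of \<open>a\<close>, \<open>b\<close>, \<open>lo\<close>, \<open>s\<close>, \<open>t\<close>
  have degree less than \<open>degree c\<close>, and \<open>2 r s t\<close> is \<open>a + b - lo\<close> modulo \<open>c\<close>; this turns every collision
  of two chains into an integral linear relation between these polynomials.\<close>

locale gap_triple = extended_triple S a b c d r s t x y z
  for S :: "'k::field_char_0 poly set" and a b c d r s t x y z +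
  assumes gap: "degree b < degree c" and lead: "lead_coeff (r * s * t) = lead_coeff (a * b * c)"
begin

definition lo where "lo = a + b + c + 2 * a * b * c - 2 * (r * s * t)"
definition hi where "hi = a + b + c + 2 * a * b * c + 2 * (r * s * t)"
definition co where "co = 2 * (a + b + lo + 2 * a * b * lo) - c"

lemma rst_square: "(r * s * t)\<^sup>2 = (a * b + 1) * (a * c + 1) * (b * c + 1)"
  unfolding ab ac bc by (simp add: power_mult_distrib)

lemma lo_hi: "lo * hi = a\<^sup>2 + b\<^sup>2 + c\<^sup>2 - 2 * a * b - 2 * a * c - 2 * b * c - 4"
  unfolding lo_def hi_def by (rule regular_extension_product[OF ab ac bc])

lemma lo_roots: "a * lo + 1 = (r * s - a * t)\<^sup>2" "b * lo + 1 = (r * t - b * s)\<^sup>2" "c * lo + 1 = (s * t - c * r)\<^sup>2"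
  "c * hi + 1 = (s * t + c * r)\<^sup>2"
proof -
  have "(r * s - a * t)\<^sup>2 = r\<^sup>2 * s\<^sup>2 - 2 * a * (r * s * t) + a\<^sup>2 * t\<^sup>2"
    "(r * t - b * s)\<^sup>2 = r\<^sup>2 * t\<^sup>2 - 2 * b * (r * s * t) + b\<^sup>2 * s\<^sup>2"
    by (simp_all add: square_simps)
  then show "a * lo + 1 = (r * s - a * t)\<^sup>2" "b * lo + 1 = (r * t - b * s)\<^sup>2"
    unfolding ab[symmetric] ac[symmetric] bc[symmetric] lo_def by (simp_all add: square_simps)
  show "c * lo + 1 = (s * t - c * r)\<^sup>2" "c * hi + 1 = (s * t + c * r)\<^sup>2"
    using regular_square unfolding lo_def hi_def by auto
qed

lemma degree_hi: "degree hi = degree a + degree b + degree c" "hi \<noteq> 0"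
proof -
  show *: "degree hi = degree a + degree b + degree c"
    unfolding hi_def by (rule degree_upper_extension[OF ab ac bc nonzero(1-3) degs lead])
  show "hi \<noteq> 0" using * deg_c by auto
qed

lemma degree_lo: "degree a + degree b + degree lo = degree c" "lo \<noteq> 0"
proof -
  have dd: "degree (lo * hi) = 2 * degree c"
    unfolding lo_hi using gap degs by (intro degree_dominant_form) auto
  then show lo0: "lo \<noteq> 0" using deg_c by auto
  show "degree a + degree b + degree lo = degree c"
    using dd degree_mult_eq[OF lo0 degree_hi(2)] degree_hi(1) by simp
qed

lemma degree_uv: "2 * degree (s * t - c * r) = degree c + degree lo"
  "2 * degree (s * t + c * r) = degree a + degree b + 2 * degree c"
  using degree_root(1)[OF lo_roots(3)] degree_root(1)[OF lo_roots(4)] nonzero deg_c degree_lo degree_hi by auto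

lemma co_c: "co * c = a\<^sup>2 + b\<^sup>2 + lo\<^sup>2 - 2 * a * b - 2 * a * lo - 2 * b * lo - 4"
proof -
  have "co * c - (a\<^sup>2 + b\<^sup>2 + lo\<^sup>2 - 2 * a * b - 2 * a * lo - 2 * b * lo - 4)
    = - ((a + b + c + 2 * a * b * c - lo)\<^sup>2 - 4 * ((a * b + 1) * (a * c + 1) * (b * c + 1)))"
    unfolding co_def by (simp add: square_simps)
  also have "a + b + c + 2 * a * b * c - lo = 2 * (r * s * t)" by (simp add: lo_def)
  finally show ?thesis unfolding rst_square[symmetric] by (simp add: power_mult_distrib)
qed

lemma co_roots: "a * co + 1 = (a * (r * t - b * s) - r * (r * s - a * t))\<^sup>2"
  "b * co + 1 = (b * (r * s - a * t) - r * (r * t - b * s))\<^sup>2"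
  "lo * co + 1 = ((r * s - a * t) * (r * t - b * s) - lo * r)\<^sup>2"
proof -
  define u w where "u = r * s - a * t" and "w = r * t - b * s"
  have uw: "a * lo + 1 = u\<^sup>2" "b * lo + 1 = w\<^sup>2" using lo_roots by (simp_all add: u_def w_def)
  have "r * u * w = r * (r * s * (r * t) - r * s * (b * s) - a * t * (r * t) + a * t * (b * s))"
    by (simp add: u_def w_def algebra_simps)
  also have "\<dots> = r\<^sup>2 * (r * s * t) - r\<^sup>2 * b * s\<^sup>2 - r\<^sup>2 * a * t\<^sup>2 + a * b * (r * s * t)"
    by (simp add: square_simps)
  finally have ruw: "r * u * w = r\<^sup>2 * (r * s * t) - r\<^sup>2 * b * s\<^sup>2 - r\<^sup>2 * a * t\<^sup>2 + a * b * (r * s * t)" .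
  have "2 * (r * u * w) = a + b + lo + 2 * a * b * lo - co"
    unfolding ruw ab[symmetric] ac[symmetric] bc[symmetric] co_def lo_def by (simp add: square_simps)
  then have co: "co = a + b + lo + 2 * a * b * lo - 2 * (r * u * w)" by simp
  have "(a * w - r * u)\<^sup>2 = a\<^sup>2 * w\<^sup>2 - 2 * a * (r * u * w) + r\<^sup>2 * u\<^sup>2"
    "(b * u - r * w)\<^sup>2 = b\<^sup>2 * u\<^sup>2 - 2 * b * (r * u * w) + r\<^sup>2 * w\<^sup>2"
    "(u * w - lo * r)\<^sup>2 = u\<^sup>2 * w\<^sup>2 - 2 * lo * (r * u * w) + lo\<^sup>2 * r\<^sup>2"
    by (simp_all add: square_simps)
  then show "a * co + 1 = (a * (r * t - b * s) - r * (r * s - a * t))\<^sup>2"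
    "b * co + 1 = (b * (r * s - a * t) - r * (r * t - b * s))\<^sup>2"
    "lo * co + 1 = ((r * s - a * t) * (r * t - b * s) - lo * r)\<^sup>2"
    unfolding u_def[symmetric] w_def[symmetric] uw[symmetric] ab[symmetric] co
    by (simp_all add: square_simps)
qed

lemma degree_lt: "degree a < degree c" "degree b < degree c" "degree lo < degree c" "degree s < degree c" "degree t < degree c"
  using gap degs A.degree_s B.degree_s degree_lo by auto

lemma rst_mod: "c dvd 2 * (r * s * t) - (a + b - lo)"
proof -
  have "2 * (r * s * t) - (a + b - lo) = c * (1 + 2 * a * b)" by (simp add: lo_def algebra_simps)
  then show ?thesis by simp
qed

text \<open>The relation is \<open>K\<^sup>2 a + 2 K s = L\<^sup>2 b + 2 L t\<close>.  With \<open>D = K\<^sup>2 a - L\<^sup>2 b = 2 L t - 2 K s\<close>, multiplication by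
  \<open>2 L t + 2 K s\<close> gives \<open>D (4 c + 2 L t + 2 K s) = 4 (L\<^sup>2 - K\<^sup>2)\<close>, whose right-hand side is constant.  So
  \<open>D = 0\<close>, then \<open>K\<^sup>2 = L\<^sup>2\<close>, and \<open>a \<noteq> b\<close> leaves only \<open>K = 0\<close>.\<close>

lemma no_common_zero_base:
  assumes "based a c s d z 0 1 1 K" "based b c t d z 0 1 1 L"
  shows False
proof -
  let ?m = "of_int K :: 'k poly" and ?n = "of_int L :: 'k poly"
  have "c dvd (?m\<^sup>2 * a + 2 * ?m * s) - (?n\<^sup>2 * b + 2 * ?n * t)"
    using collision[OF assms] by simp
  then have eq: "?m\<^sup>2 * a + 2 * ?m * s = ?n\<^sup>2 * b + 2 * ?n * t"
    by (rule eq_of_dvd_degree_less) (intro degree_less_intros degree_lt)+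
  define D where "D = ?m\<^sup>2 * a - ?n\<^sup>2 * b"
  have D: "D = 2 * ?n * t - 2 * ?m * s" using eq by (simp add: D_def algebra_simps)
  have "D * (2 * ?n * t + 2 * ?m * s) = 4 * ?n\<^sup>2 * t\<^sup>2 - 4 * ?m\<^sup>2 * s\<^sup>2"
    unfolding D by (simp add: square_simps)
  also have "\<dots> = - (4 * c * D) + 4 * (?n\<^sup>2 - ?m\<^sup>2)"
    unfolding ac[symmetric] bc[symmetric] D_def by (simp add: algebra_simps)
  finally have prod: "D * (4 * c + (2 * ?n * t + 2 * ?m * s)) = 4 * (?n\<^sup>2 - ?m\<^sup>2)"
    by (simp add: algebra_simps)
  have "degree (2 * ?n * t + 2 * ?m * s) < degree c" by (intro degree_less_intros degree_lt)
  then have dc: "degree (4 * c + (2 * ?n * t + 2 * ?m * s)) = degree c"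
    using degree_add_eq_left[of "2 * ?n * t + 2 * ?m * s" "4 * c"] by (simp add: numeral_poly)
  have "degree (4 * (?n\<^sup>2 - ?m\<^sup>2)) = degree (of_int (4 * (L\<^sup>2 - K\<^sup>2)) :: 'k poly)" by simp
  also have "\<dots> = 0" by (rule degree_of_int)
  finally have "D = 0 \<or> degree c = 0"
    using prod dc degree_mult_eq[of D "4 * c + (2 * ?n * t + 2 * ?m * s)"] by fastforce
  then have D0: "D = 0" using deg_c by simp
  then have mn: "?m\<^sup>2 = ?n\<^sup>2" using prod by simp
  then have "?m\<^sup>2 * (a - b) = 0" using D0 by (simp add: D_def algebra_simps)
  then have "K = 0" using distinct by simp
  then show False using based_zero assms(1) z_not_base(1) by fastforce
qed

lemma degree_co_lo: "degree b < degree lo \<Longrightarrow> degree co + degree c = 2 * degree lo \<and> co \<noteq> 0"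
proof -
  assume lt: "degree b < degree lo"
  then have "degree (co * c) = 2 * degree lo"
    unfolding co_c using degs by (intro degree_dominant_form) auto
  moreover from this have "co \<noteq> 0" using lt by auto
  ultimately show ?thesis using nonzero by (simp add: degree_mult_eq)
qed

lemma degree_co_b: "degree lo < degree b \<Longrightarrow> degree a < degree b \<Longrightarrow> degree co + degree c = 2 * degree b \<and> co \<noteq> 0"
proof -
  assume lt: "degree lo < degree b" "degree a < degree b"
  have "co * c = a\<^sup>2 + lo\<^sup>2 + b\<^sup>2 - 2 * a * lo - 2 * a * b - 2 * lo * b - 4"
    unfolding co_c by (simp add: algebra_simps)
  then have "degree (co * c) = 2 * degree b"
    using degree_dominant_form[OF lt(2,1)] by simp
  moreover from this have "co \<noteq> 0" using lt by auto
  ultimately show ?thesis using nonzero by (simp add: degree_mult_eq)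
qed

lemma degree_s_gt: "degree a < degree s" and degree_t_gt: "degree b < degree t"
  using A.degree_s B.degree_s degree_lt by auto

text \<open>In the relation the term \<open>2 L t\<close> has larger degree than all others.\<close>

lemma no_const_zero_base:
  assumes "degree a = 0" "a * a + 1 = w\<^sup>2" "based a c s d z a s w K" "based b c t d z 0 1 1 L"
  shows False
proof -
  let ?m = "of_int K :: 'k poly" and ?n = "of_int L :: 'k poly"
  have dw: "degree w = 0" using const_root[OF assms(1,2)] .
  have "(a + ?m\<^sup>2 * a + 2 * ?m * w) - (?n\<^sup>2 * b + 2 * ?n * t)
    = ((a + ?m\<^sup>2 * a + 2 * ?m * (s * w * s)) - (0 + ?n\<^sup>2 * b + 2 * ?n * (t * 1 * 1))) - c * (2 * ?m * a * w)"
    using ac by (simp add: square_simps) algebra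
  then have "c dvd (a + ?m\<^sup>2 * a + 2 * ?m * w) - (?n\<^sup>2 * b + 2 * ?n * t)"
    using collision[OF assms(3,4)] by (metis dvd_diff dvd_triv_left)
  then have eq: "a + ?m\<^sup>2 * a + 2 * ?m * w = ?n\<^sup>2 * b + 2 * ?n * t"
    by (rule eq_of_dvd_degree_less) (use deg_c dw in \<open>intro degree_less_intros degree_lt; simp\<close>)+
  have "of_int (2 * L) * t = a + ?m\<^sup>2 * a + 2 * ?m * w - ?n\<^sup>2 * b"
    using eq by (simp add: algebra_simps)
  moreover have "degree (a + ?m\<^sup>2 * a + 2 * ?m * w - ?n\<^sup>2 * b) < degree t"
    using degree_t_gt dw assms(1) by (intro degree_less_intros) auto
  ultimately have "2 * L = 0" by (rule of_int_times_dominates)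
  then show False using based_zero assms(4) z_not_base(1) by fastforce
qed

text \<open>The relation expresses \<open>2 L t\<close> by \<open>lo\<close>, \<open>b\<close> and \<open>a\<close>.  Comparison of degrees gives
  \<open>degree lo = degree t\<close>, so that \<open>linear_relation_cases\<close> applies to the quadruple \<open>{b, lo, a, c}\<close>; the
  resulting equation has no solution with \<open>K\<close> even and \<open>L\<close> odd.\<close>

lemma no_b_zero_base:
  assumes "even K" "odd L" and A: "based a c s d z b t r K" and B: "based b c t d z 0 1 1 L"
  shows False
proof -
  let ?m = "of_int K :: 'k poly" and ?n = "of_int L :: 'k poly"
  have "(b + ?m\<^sup>2 * a + ?m * (a + b - lo)) - (?n\<^sup>2 * b + 2 * ?n * t)
    = ((b + ?m\<^sup>2 * a + 2 * ?m * (s * r * t)) - (0 + ?n\<^sup>2 * b + 2 * ?n * (t * 1 * 1))) - ?m * (2 * (r * s * t) - (a + b - lo))"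
    by (simp add: algebra_simps)
  then have "c dvd (b + ?m\<^sup>2 * a + ?m * (a + b - lo)) - (?n\<^sup>2 * b + 2 * ?n * t)"
    using collision[OF A B] rst_mod by (metis dvd_diff dvd_mult)
  then have eq: "b + ?m\<^sup>2 * a + ?m * (a + b - lo) = ?n\<^sup>2 * b + 2 * ?n * t"
    by (rule eq_of_dvd_degree_less) (intro degree_less_intros degree_lt)+
  have rel: "of_int (2 * L) * t = of_int (- K) * lo + of_int (1 + K - L\<^sup>2) * b + of_int (K\<^sup>2 + K) * a"
    using eq by (simp add: square_simps)
  have L0: "2 * L \<noteq> 0" using assms(2) by auto
  have lt: "degree (of_int (1 + K - L\<^sup>2) * b + of_int (K\<^sup>2 + K) * a) < degree t"
    using degree_t_gt degs by (intro degree_less_intros) auto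
  have le: "degree t \<le> degree lo" and K0: "K \<noteq> 0"
  proof -
    have *: False if "degree (of_int (- K) * lo) < degree t"
    proof -
      have "degree (of_int (- K) * lo + (of_int (1 + K - L\<^sup>2) * b + of_int (K\<^sup>2 + K) * a)) < degree t"
        by (rule degree_add_less[OF that lt])
      moreover have "of_int (2 * L) * t = of_int (- K) * lo + (of_int (1 + K - L\<^sup>2) * b + of_int (K\<^sup>2 + K) * a)"
        unfolding rel by (rule add.assoc)
      ultimately show False using of_int_times_dominates L0 by blast
    qed
    show "K \<noteq> 0" using * lt by force
    show "degree t \<le> degree lo" using * degree_of_int_mult_less not_le by blast
  qed
  have "degree lo \<le> degree t"
  proof (rule ccontr)
    assume "\<not> degree lo \<le> degree t"
    moreover have "of_int (- K) * lo = of_int (2 * L) * t - (of_int (1 + K - L\<^sup>2) * b + of_int (K\<^sup>2 + K) * a)"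
      using rel by simp
    moreover have "degree (of_int (2 * L) * t - (of_int (1 + K - L\<^sup>2) * b + of_int (K\<^sup>2 + K) * a)) < degree lo"
      using lt le calculation(1) by (intro degree_diff_less degree_of_int_mult_less) auto
    ultimately have "- K = 0" using of_int_times_dominates by blast
    then show False using K0 by simp
  qed
  then have dlo: "degree lo = 2 * degree b + degree a"
    using le B.degree_s(1) degree_lo(1) by auto
  have dco: "degree co = degree b"
    using degree_co_lo dlo degs degree_lo(1) by auto
  have sum: "c + co = 2 * (b + lo + a + 2 * b * lo * a)" by (simp add: co_def algebra_simps)
  have prd: "c * co = b\<^sup>2 + lo\<^sup>2 + a\<^sup>2 - 2 * b * lo - 2 * b * a - 2 * lo * a - 4"
    using co_c by (simp add: algebra_simps)
  have mK: "- K \<noteq> 0" using K0 by simp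
  note lin = linear_relation_cases[OF rel bc sum prd co_roots(2) ab co_roots(1) nonzero(2,1) L0 mK degs(3) dco dlo]
  show False using even_odd_relation[OF assms(1,2)] lin(2,3) by blast
qed

text \<open>The term \<open>2 K s\<close> of the relation has larger degree than \<open>a\<close> and must be cancelled by \<open>b\<close> or \<open>lo\<close>.  Three
  configurations of degrees remain: \<open>degree s\<close> is that of \<open>b\<close>, or that of \<open>lo\<close>, or \<open>b\<close> and \<open>lo\<close>
  have equal degree.\<close>

lemma zero_a_base_shape:
  assumes "odd K" "even L" and A: "based a c s d z 0 1 1 K" and B: "based b c t d z a s r L"
  shows "of_int (2 * K) * s = of_int (L\<^sup>2 + L) * b + of_int (1 + L - K\<^sup>2) * a + of_int (- L) * lo" (is ?rel)
    and "L \<noteq> 0" and "L\<^sup>2 + L \<noteq> 0"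
    and "(degree lo < degree b \<and> degree a < degree b \<and> degree b = 2 * degree a + degree lo)
      \<or> (degree b < degree lo \<and> degree lo = 2 * degree a + degree b)
      \<or> (degree lo = degree b \<and> degree a = 0)" (is ?cases)
proof -
  let ?m = "of_int K :: 'k poly" and ?n = "of_int L :: 'k poly"
  have "(?m\<^sup>2 * a + 2 * ?m * s) - (a + ?n\<^sup>2 * b + ?n * (a + b - lo))
    = ((0 + ?m\<^sup>2 * a + 2 * ?m * (s * 1 * 1)) - (a + ?n\<^sup>2 * b + 2 * ?n * (t * r * s))) + ?n * (2 * (r * s * t) - (a + b - lo))"
    by (simp add: algebra_simps)
  then have "c dvd (?m\<^sup>2 * a + 2 * ?m * s) - (a + ?n\<^sup>2 * b + ?n * (a + b - lo))"
    using collision[OF A B] rst_mod by (metis dvd_add dvd_mult)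
  then have eq: "?m\<^sup>2 * a + 2 * ?m * s = a + ?n\<^sup>2 * b + ?n * (a + b - lo)"
    by (rule eq_of_dvd_degree_less) (intro degree_less_intros degree_lt)+
  show rel: ?rel
    using eq by (simp add: square_simps)
  have K0: "2 * K \<noteq> 0" using assms(1) by auto
  have small: "degree s \<le> max (degree b) (degree lo)" and L0: "L \<noteq> 0"
  proof -
    have *: False if "degree (of_int (L\<^sup>2 + L) * b + of_int (- L) * lo) < degree s"
    proof -
      have "degree (of_int (L\<^sup>2 + L) * b + of_int (- L) * lo + of_int (1 + L - K\<^sup>2) * a) < degree s"
        by (rule degree_add_less[OF that degree_of_int_mult_less[OF degree_s_gt]])
      moreover have "of_int (2 * K) * s = of_int (L\<^sup>2 + L) * b + of_int (- L) * lo + of_int (1 + L - K\<^sup>2) * a"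
        unfolding rel by (simp only: ac_simps)
      ultimately show False using of_int_times_dominates K0 by blast
    qed
    show "L \<noteq> 0" using * degree_s_gt by force
    show "degree s \<le> max (degree b) (degree lo)"
    proof (rule ccontr)
      assume "\<not> degree s \<le> max (degree b) (degree lo)"
      then have "degree (of_int (L\<^sup>2 + L) * b + of_int (- L) * lo) < degree s"
        by (intro degree_add_less degree_of_int_mult_less) auto
      then show False by (rule *)
    qed
  qed
  show "L \<noteq> 0" by (rule L0)
  show LL: "L\<^sup>2 + L \<noteq> 0"
  proof
    assume "L\<^sup>2 + L = 0"
    then have "L * (L + 1) = 0" by (simp add: square_simps)
    then have "L = -1" using L0 by auto
    then show False using assms(2) by simp
  qed
  have ds: "2 * degree s = 2 * degree a + degree b + degree lo" using A.degree_s(1) degree_lo(1) by simp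
  consider "degree lo < degree b" | "degree b < degree lo" | "degree lo = degree b" by linarith
  then show ?cases
  proof cases
    case 1
    have sb: "degree s \<le> degree b" using small 1 by simp
    have ab': "degree a < degree b" using sb degree_s_gt by simp
    have "degree b \<le> degree s"
    proof (rule ccontr)
      assume "\<not> degree b \<le> degree s"
      moreover have "of_int (L\<^sup>2 + L) * b = of_int (2 * K) * s - of_int (1 + L - K\<^sup>2) * a - of_int (- L) * lo"
        using rel by simp
      moreover have "degree (of_int (2 * K) * s - of_int (1 + L - K\<^sup>2) * a - of_int (- L) * lo) < degree b"
        using calculation(1) ab' 1 by (intro degree_diff_less degree_of_int_mult_less) auto
      ultimately have "L\<^sup>2 + L = 0" using of_int_times_dominates by blast
      then show False using LL by simp
    qed
    then show ?thesis using 1 ab' sb ds by simp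
  next
    case 2
    have sb: "degree s \<le> degree lo" using small 2 by simp
    have "degree lo \<le> degree s"
    proof (rule ccontr)
      assume "\<not> degree lo \<le> degree s"
      moreover have "of_int (- L) * lo = of_int (2 * K) * s - of_int (1 + L - K\<^sup>2) * a - of_int (L\<^sup>2 + L) * b"
        using rel by simp
      moreover have "degree (of_int (2 * K) * s - of_int (1 + L - K\<^sup>2) * a - of_int (L\<^sup>2 + L) * b) < degree lo"
        using calculation(1) degs 2 by (intro degree_diff_less degree_of_int_mult_less) auto
      ultimately have "- L = 0" using of_int_times_dominates by blast
      then show False using L0 by simp
    qed
    then show ?thesis using 2 sb ds by simp
  next
    case 3
    then show ?thesis using small ds by simp
  qed
qed

text \<open>The first two configurations are those of \<open>linear_relation_cases\<close>, with \<open>b\<close> or \<open>lo\<close> as the dominant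
  element; the third one requires \<open>a\<close> to be constant.\<close>

lemma no_zero_a_base_nonconst:
  assumes "odd K" "even L" "0 < degree a" and A: "based a c s d z 0 1 1 K" and B: "based b c t d z a s r L"
  shows False
proof -
  note shape = zero_a_base_shape[OF assms(1,2) A B]
  note rel = shape(1) and L0 = shape(2) and LL = shape(3)
  have K0: "2 * K \<noteq> 0" using assms(1) by auto
  consider "degree lo < degree b" "degree a < degree b" "degree b = 2 * degree a + degree lo"
    | "degree b < degree lo" "degree lo = 2 * degree a + degree b"
    using shape(4) assms(3) by auto
  then show False
  proof cases
    case 1
    have dco: "degree co = degree a" using degree_co_b[OF 1(1,2)] degree_lo(1) 1(3) by auto
    have sum: "c + co = 2 * (a + b + lo + 2 * a * b * lo)" by (simp add: co_def algebra_simps)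
    have prd: "c * co = a\<^sup>2 + b\<^sup>2 + lo\<^sup>2 - 2 * a * b - 2 * a * lo - 2 * b * lo - 4"
      using co_c by (simp add: algebra_simps)
    have la: "lo * a + 1 = (r * s - a * t)\<^sup>2" using lo_roots(1) by (simp add: mult.commute)
    note lin = linear_relation_cases[OF rel ac sum prd co_roots(1) la co_roots(3) nonzero(1) degree_lo(2) K0 LL assms(3) dco 1(3)]
    show False using even_shift_relation[OF assms(2) L0] lin(2,3) by blast
  next
    case 2
    have dco: "degree co = degree a" using degree_co_lo[OF 2(1)] degree_lo(1) 2(2) by auto
    have sum: "c + co = 2 * (a + lo + b + 2 * a * lo * b)" by (simp add: co_def algebra_simps)
    have prd: "c * co = a\<^sup>2 + lo\<^sup>2 + b\<^sup>2 - 2 * a * lo - 2 * a * b - 2 * lo * b - 4"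
      using co_c by (simp add: algebra_simps)
    have rel': "of_int (2 * K) * s = of_int (- L) * lo + of_int (1 + L - K\<^sup>2) * a + of_int (L\<^sup>2 + L) * b"
      using rel by (simp add: algebra_simps)
    have ba: "b * a + 1 = r\<^sup>2" using ab by (simp add: mult.commute)
    have mL: "- L \<noteq> 0" using L0 by simp
    show False
      using linear_relation_cases(1)[OF rel' ac sum prd co_roots(1) ba co_roots(2) nonzero(1,2) K0 mL assms(3) dco 2(2)] degs by simp
  qed
qed

end

text \<open>The comparison of this formula for the two chains supplies a second integral relation between \<open>K\<close> and \<open>L\<close>.\<close>

lemma based_degree:
  fixes c s z Z X :: "'k::field_char_0 poly"
  assumes "based k c s d z d0 Z X K" "K \<noteq> 0"
    and q: "q = s * Z + of_int (sgn K) * c * X" "q \<noteq> 0" "degree Z < degree q + degree s" and s: "0 < degree s"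
  shows "int (degree z) = int (degree q) + (\<bar>K\<bar> - 1) * int (degree s)"
proof -
  obtain n where n: "nat \<bar>K\<bar> = Suc n" using assms(2) by (metis abs_eq_0 abs_ge_zero nat_eq_iff2 not0_implies_Suc of_nat_0)
  have "z = chain c s Z X K \<or> z = - chain c s Z X K" using assms(1) by (simp add: based_def power2_eq_iff)
  then have "degree z = degree (lucas s Z q (Suc n))" by (auto simp: chain_def n q(1))
  also have "\<dots> = degree q + n * degree s" using degree_lucas[OF q(3,2) s] by blast
  finally have "degree z = degree q + n * degree s" .
  moreover have "int n = \<bar>K\<bar> - 1" using n by linarith
  ultimately show ?thesis by simp
qed

text \<open>This evaluates \<open>2 s x0 z0\<close> modulo \<open>c\<close> for the base \<open>lo\<close>, where \<open>x0 = r s - a t\<close> and \<open>z0 = s t - c r\<close>.\<close>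

lemma lower_base_product:
  fixes a b c r s t :: "'r::comm_ring_1"
  assumes "a * c + 1 = s\<^sup>2" "b * c + 1 = t\<^sup>2"
  shows "2 * (s * (r * s - a * t) * (s * t - c * r))
    = 2 * (r * s * t) - 2 * a + c * (2 * (2 * a * (r * s * t) - r\<^sup>2 * s\<^sup>2 - a * (a + b + a * b * c)))"
proof -
  have "s * (r * s - a * t) * (s * t - c * r)
    = s\<^sup>2 * (r * s * t) - c * r\<^sup>2 * s\<^sup>2 - a * s\<^sup>2 * t\<^sup>2 + a * c * (r * s * t)"
    by (simp add: square_simps)
  also have "\<dots> = (a * c + 1) * (r * s * t) - c * r\<^sup>2 * s\<^sup>2 - a * (a * c + 1) * (b * c + 1) + a * c * (r * s * t)"
    unfolding assms ..
  finally have h: "s * (r * s - a * t) * (s * t - c * r)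
    = (a * c + 1) * (r * s * t) - c * r\<^sup>2 * s\<^sup>2 - a * (a * c + 1) * (b * c + 1) + a * c * (r * s * t)" .
  show ?thesis unfolding h by (simp add: algebra_simps)
qed

text \<open>The forward step from the base leads to the small value \<open>t\<close>, so the degree grows at a different rate in
  the two directions.\<close>

lemma lower_base_degree:
  fixes c s t z Z X :: "'k::field_char_0 poly"
  assumes B: "based k c s d z e Z X K" and t: "s * Z + c * X = t" "t \<noteq> 0" and Z: "Z \<noteq> 0" and s: "0 < degree s"
    and deg: "degree t < degree s + degree Z" "degree Z < degree t + degree s"
  shows "int (degree z) = (if K > 0 then int (degree t) + (K - 1) * int (degree s) else int (degree Z) - K * int (degree s))"
proof (cases "K = 0")
  case True
  then have "z = Z \<or> z = - Z" using B by (simp add: based_def chain_def power2_eq_iff)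
  then show ?thesis using True by auto
next
  case False
  define q where "q = s * Z + of_int (sgn K) * c * X"
  have q: "q = (if K > 0 then t else 2 * s * Z - t)"
    using False unfolding q_def t(1)[symmetric] by (simp add: sgn_if algebra_simps)
  have "s \<noteq> 0" using s by auto
  then have "degree (2 * s * Z) = degree s + degree Z"
    using Z by (simp add: degree_mult_eq numeral_poly)
  then have dm: "degree (2 * s * Z - t) = degree s + degree Z"
    using deg(1) degree_add_eq_left[of "- t" "2 * s * Z"] by simp
  have "q \<noteq> 0" using q dm t(2) s by auto
  moreover have "degree Z < degree q + degree s" using q dm deg(2) s by auto
  ultimately have "int (degree z) = int (degree q) + (\<bar>K\<bar> - 1) * int (degree s)"
    using based_degree[OF B False q_def] s by blast
  then show ?thesis using q dm False by (auto simp: algebra_simps)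
qed

text \<open>The integral equations of this and the next two lemmas arise by eliminating the constant \<open>\<kappa>\<close> of
  \<open>exceptional_parameter\<close> from a comparison of coefficients; the linear conditions come from the two formulas
  for \<open>degree z\<close>.  After the substitution of the latter a polynomial in one integer remains.\<close>

lemma flat_relation_a:
  fixes K L :: int
  assumes "odd K" "even L" and eq: "L\<^sup>2 * K\<^sup>2 + 6 * K * L\<^sup>2 + 3 * L ^ 3 + 8 * K\<^sup>2 + 12 * K * L + 3 * L\<^sup>2 = 0"
    and "(L > 0 \<and> 2 * \<bar>K\<bar> = 3 * L) \<or> (L < 0 \<and> 2 * \<bar>K\<bar> + 2 = - 3 * L)"
  shows "K = - 3 \<and> L = 2"
proof -
  obtain n where n: "L = 2 * n" using assms(2) by auto
  have "4 * (n\<^sup>2 * K\<^sup>2 + 2 * K\<^sup>2 + 6 * K * n + 3 * n\<^sup>2 + 6 * K * n\<^sup>2 + 6 * n ^ 3) = 0"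
    using eq unfolding n by (simp add: square_simps power3_eq_cube)
  then have e: "n\<^sup>2 * K\<^sup>2 + 2 * K\<^sup>2 + 6 * K * n + 3 * n\<^sup>2 + 6 * K * n\<^sup>2 + 6 * n ^ 3 = 0" by simp
  consider "n > 0" "K = 3 * n" | "n > 0" "K = - 3 * n" | "n < 0" "\<bar>K\<bar> = - 3 * n - 1"
    using assms(4) n by linarith
  then show ?thesis
  proof cases
    case 1
    then have "0 < n\<^sup>2 * K\<^sup>2" "0 \<le> 2 * K\<^sup>2" "0 \<le> 6 * K * n" "0 \<le> 3 * n\<^sup>2" "0 \<le> 6 * K * n\<^sup>2" "0 \<le> 6 * n ^ 3" by auto
    then show ?thesis using e by linarith
  next
    case 2
    have "3 * n\<^sup>2 * ((3 * n - 1) * (n - 1)) = 0"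
      using e unfolding 2 by (simp add: square_simps power3_eq_cube)
    moreover have "3 * n\<^sup>2 \<noteq> 0" "3 * n - 1 \<noteq> 0" using 2(1) by (simp, presburger)
    ultimately have "n - 1 = 0" using mult_eq_0_iff[of "3 * n\<^sup>2" "(3 * n - 1) * (n - 1)"] mult_eq_0_iff[of "3 * n - 1" "n - 1"] by blast
    then have n1: "n = 1" by simp
    show ?thesis unfolding 2(2) n n1 by simp
  next
    case 3
    have "odd \<bar>K\<bar>" using assms(1) by simp
    then have "even n" unfolding 3(2) by simp
    then obtain j where j: "n = 2 * j" by auto
    have "2 * K\<^sup>2 = 4 * (- (j\<^sup>2 * K\<^sup>2) - 3 * K * j - 3 * j\<^sup>2 - 6 * K * j\<^sup>2 - 12 * j ^ 3)"
      using e unfolding j by (simp add: square_simps power3_eq_cube)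
    then have "K\<^sup>2 = 2 * (- (j\<^sup>2 * K\<^sup>2) - 3 * K * j - 3 * j\<^sup>2 - 6 * K * j\<^sup>2 - 12 * j ^ 3)" by simp
    then have "even (K\<^sup>2)" by (metis dvd_triv_left)
    then show ?thesis using assms(1) by simp
  qed
qed

lemma flat_relation_const:
  fixes K L :: int
  assumes "even L" and eq: "K\<^sup>2 * L + 2 * K * (L + 2) + 3 * L\<^sup>2 + 4 * L = 0"
    and "(L > 0 \<and> 2 * \<bar>K\<bar> = 3 * L) \<or> (L < 0 \<and> 2 * \<bar>K\<bar> + 2 = - 3 * L)"
  shows False
proof -
  obtain n where n: "L = 2 * n" using assms(1) by auto
  consider "n > 0" "K = 3 * n" | "n > 0" "K = - 3 * n" | "n < 0" "K = - 3 * n - 1" | "n < 0" "K = 3 * n + 1"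
    using assms(3) n by linarith
  then show ?thesis
  proof cases
    case 1
    then have "0 < K\<^sup>2 * L" "0 \<le> 2 * K * (L + 2)" "0 \<le> 3 * L\<^sup>2" "0 < 4 * L" using n by auto
    then show ?thesis using eq by linarith
  next
    case 2
    have "2 * n * (9 * n\<^sup>2 - 2) = 0"
      using eq unfolding 2 n by (simp add: square_simps)
    then have "9 * n\<^sup>2 = 2" using 2 by simp
    then show ?thesis by presburger
  next
    case 3
    define N where "N = - n"
    have N: "n = - N" "N \<ge> 1" using 3 by (auto simp: N_def)
    have "2 * (- (N * (3 * N - 1)\<^sup>2) + 2 * (3 * N - 1) * (1 - N) + 6 * N\<^sup>2 - 4 * N) = 0"
      using eq unfolding 3 n N by (simp add: square_simps)
    then have "N * (9 * N\<^sup>2 - 6 * N - 3) + 2 = 0" by (simp add: square_simps)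
    moreover have "9 * N\<^sup>2 - 6 * N - 3 = (N - 1) * (9 * N + 3)" by (simp add: square_simps)
    moreover have "0 \<le> N * ((N - 1) * (9 * N + 3))" using N by simp
    ultimately show ?thesis by simp
  next
    case 4
    define N where "N = - n"
    have N: "n = - N" "N \<ge> 1" using 4 by (auto simp: N_def)
    have "2 * (- (N * (3 * N - 1)\<^sup>2) - 2 * (3 * N - 1) * (1 - N) + 6 * N\<^sup>2 - 4 * N) = 0"
      using eq unfolding 4 n N by (simp add: square_simps)
    then have "9 * N ^ 3 - 18 * N\<^sup>2 + 13 * N - 2 = 0" by (simp add: square_simps power3_eq_cube)
    moreover have "9 * N ^ 3 - 18 * N\<^sup>2 + 13 * N - 2 = 9 * (N * (N - 1)\<^sup>2) + 4 * N - 2"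
      by (simp add: square_simps power3_eq_cube)
    moreover have "0 \<le> N * (N - 1)\<^sup>2" using N by simp
    ultimately show ?thesis using N by linarith
  qed
qed

lemma flat_relation_lo:
  fixes K L :: int
  assumes "even K" "even L" "L \<noteq> 0" "L \<noteq> 2"
    and eq: "L * (L - 2) * (K\<^sup>2 - 5 * K + 3 * L) + 4 * (L - K)\<^sup>2 = 0"
    and "if K > 0 then (if L > 0 then 2 * K + 1 = 3 * L - 1 else 2 * K + 1 = 3 - 3 * L)
         else (if L > 0 then 3 - 2 * K = 3 * L - 1 else 3 - 2 * K = 3 - 3 * L)"
  shows False
proof -
  have LL: "L * (L - 2) > 0"
  proof (cases "L > 0")
    case True then have "L > 2" using assms(2,4) by presburger
    then show ?thesis by simp
  qed (use assms(3) in \<open>auto intro: mult_neg_neg\<close>)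
  have neg: "K\<^sup>2 - 5 * K + 3 * L \<le> 0"
  proof (rule ccontr)
    assume "\<not> ?thesis"
    then have "L * (L - 2) * (K\<^sup>2 - 5 * K + 3 * L) > 0" using LL by simp
    moreover have "0 \<le> 4 * (L - K)\<^sup>2" by simp
    ultimately show False using eq by linarith
  qed
  consider "L > 2" "2 * K = 3 * L - 2" | "L < 0" "2 * K = 2 - 3 * L" | "K \<le> 0" "L > 2" | "K \<le> 0" "L < 0" "2 * K = 3 * L"
    using assms by (auto split: if_splits)
  then show False
  proof cases
    case 1
    then have "4 * (K\<^sup>2 - 5 * K + 3 * L) = 9 * L\<^sup>2 - 30 * L + 24"
    proof -
      have "4 * (K\<^sup>2 - 5 * K + 3 * L) = (2 * K)\<^sup>2 - 10 * (2 * K) + 12 * L" by (simp add: power2_eq_square)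
      then show ?thesis unfolding 1 by (simp add: square_simps)
    qed
    moreover have "9 * L\<^sup>2 - 30 * L + 24 = (3 * L - 4) * (3 * L - 6)" by (simp add: square_simps)
    moreover have "0 < (3 * L - 4) * (3 * L - 6)" using 1 by simp
    ultimately have "0 < 4 * (K\<^sup>2 - 5 * K + 3 * L)" by metis
    then show False using neg by simp
  next
    case 2
    define N where "N = - L"
    have N: "L = - N" "N \<ge> 2" "2 * K = 2 + 3 * N" using 2 assms(2) by (auto simp: N_def)
    show False
    proof (cases "N = 2")
      case True
      then show False using N eq by simp
    next
      case False
      then have "N \<ge> 4" using N assms(2) by presburger
      have "4 * (K\<^sup>2 - 5 * K + 3 * L) = (2 * K)\<^sup>2 - 10 * (2 * K) + 12 * L" by (simp add: power2_eq_square)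
      then have "4 * (K\<^sup>2 - 5 * K + 3 * L) = 9 * N\<^sup>2 - 30 * N - 16"
        unfolding N by (simp add: square_simps)
      also have "\<dots> = (N - 4) * (9 * N + 6) + 8" by (simp add: square_simps)
      also have "\<dots> > 0" using \<open>N \<ge> 4\<close> by (simp add: add_nonneg_pos)
      finally show False using neg by simp
    qed
  next
    case 3
    then have "0 \<le> K\<^sup>2" by simp
    then show False using 3 neg by linarith
  next
    case 4
    have "4 * (K\<^sup>2 - 5 * K + 3 * L) = (2 * K)\<^sup>2 - 10 * (2 * K) + 12 * L" by (simp add: power2_eq_square)
    then have "4 * (K\<^sup>2 - 5 * K + 3 * L) = 9 * L\<^sup>2 - 18 * L" unfolding 4 by (simp add: power2_eq_square)
    also have "\<dots> = 9 * (L * (L - 2))" by (simp add: square_simps)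
    also have "\<dots> > 0" using LL by simp
    finally show False using neg by simp
  qed
qed

text \<open>For a constant \<open>A\<close> both \<open>A B\<close> and \<open>A F\<close> are quadratic in \<open>r\<close>; hence \<open>A c + 1\<close> is of degree four in
  \<open>r\<close>, and it is a square because \<open>2 k w = k\<^sup>2 + 1\<close>.\<close>

lemma exceptional_square:
  fixes A k w r B F c :: "'k::field_char_0 poly"
  assumes "A * B + 1 = r\<^sup>2" "A * F + 1 = k\<^sup>2 * r\<^sup>2" "c + A = 2 * (A + B + F + 2 * A * B * F)"
    and w: "2 * k * w = k\<^sup>2 + 1" "w\<^sup>2 = A\<^sup>2 + 1"
  shows "A * c + 1 = (2 * k * r\<^sup>2 - w)\<^sup>2"
proof -
  have B: "A * B = r\<^sup>2 - 1" and F: "A * F = k\<^sup>2 * r\<^sup>2 - 1" using assms(1,2) by (simp_all add: algebra_simps)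
  have "A * c + A * A = A * (c + A)" by (simp add: algebra_simps)
  also have "\<dots> = 2 * (A\<^sup>2 + A * B + A * F + 2 * (A * B) * (A * F))"
    unfolding assms(3) by (simp add: square_simps)
  finally have "A * c + 1 = A\<^sup>2 + 1 - 2 * r\<^sup>2 - 2 * (k\<^sup>2 * r\<^sup>2) + 4 * (k\<^sup>2 * r\<^sup>2 * r\<^sup>2)"
    unfolding B F by (simp add: square_simps)
  also have "\<dots> = 4 * (k\<^sup>2 * r\<^sup>2 * r\<^sup>2) - 2 * r\<^sup>2 * (k\<^sup>2 + 1) + w\<^sup>2"
    unfolding w(2) by (simp add: algebra_simps)
  also have "\<dots> = (2 * k * r\<^sup>2 - w)\<^sup>2"
    unfolding w(1)[symmetric] by (simp add: square_simps)
  finally show ?thesis .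
qed

lemma repeated_regular:
  fixes A B F c :: "'k::field_char_0 poly"
  assumes sum: "c + A = 2 * (A + B + F + 2 * A * B * F)"
    and prod: "A * c = A\<^sup>2 + B\<^sup>2 + F\<^sup>2 - 2 * A * B - 2 * A * F - 2 * B * F - 4"
  shows "(B + F - 2 * A)\<^sup>2 = 4 * (A\<^sup>2 + 1) * (B * F + 1)"
proof -
  have c: "c = 2 * (A + B + F + 2 * A * B * F) - A" using sum by (simp add: algebra_simps)
  show ?thesis using prod unfolding c by (simp add: square_simps)
qed

lemma tight_square:
  fixes A B F c r e :: "'k::field_char_0 poly"
  assumes c: "c = 2 * (A + B + F + 2 * A * B * F)" and F: "F = A + B + 2 * e * r" and e: "e\<^sup>2 = 1"
    and r: "A * B + 1 = r\<^sup>2"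
  shows "A * c + 1 = (2 * r\<^sup>2 + 2 * e * A * r - 1)\<^sup>2"
proof -
  have AB: "A * B = r\<^sup>2 - 1" using r by (simp add: algebra_simps)
  have AF: "A * F = A\<^sup>2 + A * B + 2 * e * A * r" unfolding F by (simp add: square_simps)
  have "A * c + 1 = 2 * (A\<^sup>2 + A * B + A * F) + 4 * (A * B) * (A * F) + 1"
    unfolding c by (simp add: square_simps)
  also have "\<dots> = (2 * r\<^sup>2 + 2 * e * A * r - 1)\<^sup>2 + 4 * (1 - e\<^sup>2) * A\<^sup>2 * r\<^sup>2"
    unfolding AF AB by (simp add: square_simps)
  finally show ?thesis unfolding e by simp
qed

context gap_triple begin

text \<open>By the product formula \<open>co c\<close> has degree at most \<open>2 degree b\<close>, while
  \<open>degree c = degree a + 2 degree b\<close>.  So \<open>co\<close> is zero, or it is a constant along with \<open>a\<close>; in that case both are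
  constant partners of \<open>b\<close> and coincide.\<close>

lemma flat_cases:
  assumes flat: "degree lo = degree b"
  obtains (sum) e :: int where "e = 1 \<or> e = -1" "lo = a + b + 2 * of_int e * r"
  | (exceptional) "degree a = 0" "co = a"
proof (cases "co = 0")
  case True
  then have "(lo - a - b)\<^sup>2 = 4 * (a * b + 1)"
    using co_c by (simp add: square_simps)
  then have "(lo - a - b)\<^sup>2 = (2 * r)\<^sup>2" unfolding ab by (simp add: power_mult_distrib)
  then obtain e :: int where e: "e = 1 \<or> e = -1" "lo - a - b = of_int e * (2 * r)" by (rule square_eq_signs)
  then have "lo = a + b + 2 * of_int e * r" by (simp add: algebra_simps)
  with e(1) show thesis by (rule sum)
next
  case False
  have two: "degree (2 * p * q) \<le> degree p + degree q" for p q :: "'k poly"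
    using degree_mult_le[of "2 * p" q] by (simp add: numeral_poly)
  have "degree (co * c) \<le> 2 * degree b" unfolding co_c
    using degs flat two[of a b] two[of a lo] two[of b lo] degree_power_le[of a 2] degree_power_le[of b 2] degree_power_le[of lo 2]
    by (intro degree_add_le degree_diff_le) auto
  moreover have "degree c = degree a + 2 * degree b" using degree_lo(1) flat by simp
  ultimately have "degree co = 0" and a0: "degree a = 0" using degree_mult_eq[OF False nonzero(3)] by simp_all
  then have "co = a"
    using constant_partners_eq[OF _ _ False nonzero(1) degs(3), of _ r] co_roots(2) ab a0 by (auto simp: mult.commute)
  with a0 show thesis by (rule exceptional)
qed

text \<open>Since \<open>co = a\<close>, the triple \<open>{a, b, lo}\<close> has \<open>a\<close> itself as an extension, and \<open>proportional_roots\<close> applies.\<close>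

lemma exceptional_parameter:
  assumes a0: "degree a = 0" and flat: "degree lo = degree b" and co: "co = a"
  obtains \<alpha> \<kappa> \<omega> where "a = [:\<alpha>:]" "\<alpha> \<noteq> 0" "\<kappa> \<noteq> 0" "\<kappa>\<^sup>2 - 1 = 2 * \<alpha> * \<kappa>" "2 * \<kappa> * \<omega> = \<kappa>\<^sup>2 + 1" "\<omega>\<^sup>2 = \<alpha>\<^sup>2 + 1"
    "a * lo + 1 = [:\<kappa>:]\<^sup>2 * r\<^sup>2" "s\<^sup>2 = (2 * [:\<kappa>:] * r\<^sup>2 - [:\<omega>:])\<^sup>2"
proof -
  obtain \<alpha> where \<alpha>: "a = [:\<alpha>:]" using a0 by (rule degree_eq_zeroE)
  have \<alpha>0: "\<alpha> \<noteq> 0" using nonzero \<alpha> by auto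
  have sum: "c + a = 2 * (a + b + lo + 2 * a * b * lo)" using co unfolding co_def by (simp add: algebra_simps)
  have "a * c = a\<^sup>2 + b\<^sup>2 + lo\<^sup>2 - 2 * a * b - 2 * a * lo - 2 * b * lo - 4" using co_c co by simp
  then have "(b + lo - 2 * a)\<^sup>2 = 4 * (a\<^sup>2 + 1) * (b * lo + 1)"
    by (rule repeated_regular[OF sum])
  then obtain \<kappa> \<omega> where \<kappa>: "\<kappa> \<noteq> 0" "\<kappa>\<^sup>2 - 1 = 2 * \<alpha> * \<kappa>" "(r * s - a * t)\<^sup>2 = ([:\<kappa>:] * r)\<^sup>2"
    and \<omega>: "2 * \<kappa> * \<omega> = \<kappa>\<^sup>2 + 1" and \<omega>2: "\<omega>\<^sup>2 = \<alpha>\<^sup>2 + 1"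
    using proportional_roots[of \<alpha> b r lo "r * s - a * t"] ab lo_roots(1) \<alpha>0 degs degree_lo(2) unfolding \<alpha> by blast
  have lo: "a * lo + 1 = [:\<kappa>:]\<^sup>2 * r\<^sup>2" using lo_roots(1) \<kappa>(3) by (simp only: power_mult_distrib)
  have "[:2 * \<kappa> * \<omega>:] = [:\<kappa>\<^sup>2 + 1:]" "[:\<omega>\<^sup>2:] = [:\<alpha>\<^sup>2 + 1:]" using \<omega> \<omega>2 by simp_all
  then have "a * c + 1 = (2 * [:\<kappa>:] * r\<^sup>2 - [:\<omega>:])\<^sup>2"
    unfolding const_simps \<alpha>[symmetric] by (intro exceptional_square[OF ab lo sum])
  then show thesis using that[OF \<alpha> \<alpha>0 \<kappa>(1,2) \<omega> \<omega>2 lo] ac by simp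
qed

lemma a_base_degree:
  assumes flat: "degree a = 0" "degree lo = degree b"
    and B: "based b c t d z a s r L" and L: "L \<noteq> 0"
  shows "2 * int (degree z) = (if L > 0 then 2 + 3 * L else - 3 * L) * int (degree b)"
proof -
  have dc: "degree c = 2 * degree b" using degree_lo(1) flat by simp
  have d: "2 * degree (s * t - c * r) = 3 * degree b" "2 * degree (s * t + c * r) = 5 * degree b"
    "2 * degree t = 3 * degree b" "degree s = degree b"
    using degree_uv dc flat B.degree_s A.degree_s by auto
  define q where "q = t * s + of_int (sgn L) * c * r"
  have q: "q = (if L > 0 then s * t + c * r else s * t - c * r)" using L by (auto simp: q_def sgn_if mult.commute)
  then have dq: "2 * degree q = (if L > 0 then 5 else 3) * degree b" using d by auto
  then have "q \<noteq> 0" "degree s < degree q + degree t" using degs d(3,4) by (auto split: if_splits)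
  from based_degree[OF B L q_def this B.degree_s(2)]
  have "2 * int (degree z) = int (2 * degree q) + (\<bar>L\<bar> - 1) * int (2 * degree t)" by (simp add: algebra_simps)
  then show ?thesis unfolding dq d(3) by (auto simp: algebra_simps L)
qed

text \<open>
  Multiplied by the constant \<open>a\<close>, every term of the relation is a quadratic polynomial in \<open>r\<close> with constant
  coefficients, so coefficients may be compared.  The result \<open>a\<^sup>2 = 3\<close>, \<open>M a = 1\<close> is not solvable with
  an integer \<open>M\<close>.\<close>
lemma no_zero_a_base_sum:
  fixes e :: int
  assumes a0: "degree a = 0" and L0: "L \<noteq> 0" and e: "e = 1 \<or> e = -1" and lo: "lo = a + b + 2 * of_int e * r"
    and rel: "of_int (2 * K) * s = of_int (L\<^sup>2 + L) * b + of_int (1 + L - K\<^sup>2) * a + of_int (- L) * lo"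
  shows False
proof -
  have r: "degree r > 0" using degree_r degs by auto
  let ?e = "of_int e :: 'k poly"
  obtain \<alpha> where \<alpha>: "a = [:\<alpha>:]" using a0 by (rule degree_eq_zeroE)
  have \<alpha>0: "\<alpha> \<noteq> 0" using nonzero \<alpha> by auto
  have ee: "?e\<^sup>2 = 1" using e by auto
  have abr: "a * b = r\<^sup>2 - 1" using ab by (simp add: algebra_simps)
  have "co = 0"
  proof -
    have "co * c = (lo - a - b)\<^sup>2 - 4 * (a * b + 1)" using co_c by (simp add: square_simps)
    also have "\<dots> = 0" unfolding lo ab using ee by (simp add: power_mult_distrib)
    finally show ?thesis using nonzero by simp
  qed
  then have c: "c = 2 * (a + b + lo + 2 * a * b * lo)" by (simp add: co_def)
  have "s\<^sup>2 = (2 * r\<^sup>2 + 2 * ?e * a * r - 1)\<^sup>2" using tight_square[OF c lo ee ab] ac by simp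
  then obtain g where g: "g = 1 \<or> g = -1" "s = of_int g * (2 * r\<^sup>2 + 2 * ?e * a * r - 1)" by (rule square_eq_signs)
  define M where "M = K * g"
  have MM: "M\<^sup>2 = K\<^sup>2" using g(1) by (auto simp: M_def)
  have "a * (of_int (2 * K) * s) = a * (of_int (L\<^sup>2 + L) * b + of_int (1 + L - K\<^sup>2) * a + of_int (- L) * lo)"
    unfolding rel ..
  also have "a * (of_int (2 * K) * s) = 2 * of_int M * a * (2 * r\<^sup>2 + 2 * ?e * a * r - 1)"
    unfolding g(2) M_def by simp
  also have "a * (of_int (L\<^sup>2 + L) * b + of_int (1 + L - K\<^sup>2) * a + of_int (- L) * lo)
    = of_int (L\<^sup>2 + L) * (r\<^sup>2 - 1) + of_int (1 + L - M\<^sup>2) * a\<^sup>2 - of_int L * (a\<^sup>2 + (r\<^sup>2 - 1) + 2 * ?e * a * r)"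
    unfolding abr[symmetric] MM lo by (simp add: square_simps)
  finally have "[:4 * of_int M * \<alpha> - (of_int L)\<^sup>2:] * r\<^sup>2 + [:4 * of_int M * of_int e * \<alpha>\<^sup>2 + 2 * of_int L * of_int e * \<alpha>:] * r
    + [:(of_int L)\<^sup>2 - 2 * of_int M * \<alpha> - (1 - (of_int M)\<^sup>2) * \<alpha>\<^sup>2:] = 0"
    unfolding const_simps \<alpha>[symmetric] by (simp add: square_simps)
  note q = quadratic_in_nonconst[OF this r]
  have "(2 * of_int e * \<alpha>) * (2 * of_int M * \<alpha> + of_int L) = 0" using q(2) by (simp add: square_simps)
  then have Ma: "2 * of_int M * \<alpha> = - of_int L" using \<alpha>0 e by (auto simp: eq_neg_iff_add_eq_0)
  have "(of_int L)\<^sup>2 = 2 * (2 * of_int M * \<alpha>)" using q(1) by (simp add: mult.assoc)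
  then have "of_int (L\<^sup>2) = (of_int (- 2 * L) :: 'k)" unfolding Ma by simp
  then have "L\<^sup>2 = - 2 * L" by (simp only: of_int_eq_iff)
  then have "L * (L + 2) = 0" by (simp add: square_simps)
  then have L: "L = -2" using L0 by simp
  then have Ma1: "of_int M * \<alpha> = 1" using Ma by simp
  have "(of_int L)\<^sup>2 - 2 * (of_int M * \<alpha>) - \<alpha>\<^sup>2 + (of_int M * \<alpha>)\<^sup>2 = 0"
    using q(3) by (simp add: square_simps)
  then have "\<alpha>\<^sup>2 = 3" unfolding Ma1 L by (simp add: algebra_simps)
  then have "(of_int M * \<alpha>)\<^sup>2 = of_int (M\<^sup>2 * 3)" by (simp add: power_mult_distrib)
  then have "of_int (M\<^sup>2 * 3) = (of_int 1 :: 'k)" using Ma1 by simp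
  then have "M\<^sup>2 * 3 = 1" by (simp only: of_int_eq_iff)
  then show False by presburger
qed

text \<open>
  The same comparison, now with the parameters of \<open>exceptional_parameter\<close>.  Elimination of \<open>y = \<kappa>\<^sup>2 - 1\<close> from the two
  resulting equations and the degrees of \<open>z\<close> give the hypotheses of \<open>flat_relation_a\<close>; its only solution
  makes \<open>\<kappa>\<close> zero.\<close>
lemma no_zero_a_base_exceptional:
  assumes "odd K" "even L" and a0: "degree a = 0" and flat: "degree lo = degree b" and co: "co = a" and L0: "L \<noteq> 0"
    and A: "based a c s d z 0 1 1 K" and B: "based b c t d z a s r L"
    and rel: "of_int (2 * K) * s = of_int (L\<^sup>2 + L) * b + of_int (1 + L - K\<^sup>2) * a + of_int (- L) * lo"
  shows False
proof -
  have r: "degree r > 0" using degree_r degs by auto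
  from a0 flat co obtain \<alpha> \<kappa> \<omega> where \<alpha>: "a = [:\<alpha>:]" "\<alpha> \<noteq> 0" and \<kappa>: "\<kappa> \<noteq> 0" "\<kappa>\<^sup>2 - 1 = 2 * \<alpha> * \<kappa>"
    and \<omega>: "2 * \<kappa> * \<omega> = \<kappa>\<^sup>2 + 1" "\<omega>\<^sup>2 = \<alpha>\<^sup>2 + 1"
    and lo: "a * lo + 1 = [:\<kappa>:]\<^sup>2 * r\<^sup>2" and s: "s\<^sup>2 = (2 * [:\<kappa>:] * r\<^sup>2 - [:\<omega>:])\<^sup>2"
    by (rule exceptional_parameter)
  obtain g where g: "g = 1 \<or> g = -1" "s = of_int g * (2 * [:\<kappa>:] * r\<^sup>2 - [:\<omega>:])" using s by (rule square_eq_signs)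
  define M where "M = K * g"
  have MM: "M\<^sup>2 = K\<^sup>2" "\<bar>M\<bar> = \<bar>K\<bar>" using g(1) by (auto simp: M_def)
  have "a * (of_int (2 * K) * s) = a * (of_int (L\<^sup>2 + L) * b + of_int (1 + L - K\<^sup>2) * a + of_int (- L) * lo)"
    unfolding rel ..
  also have "a * (of_int (2 * K) * s) = 2 * of_int M * a * (2 * [:\<kappa>:] * r\<^sup>2 - [:\<omega>:])"
    unfolding g(2) M_def by simp
  also have "a * (of_int (L\<^sup>2 + L) * b + of_int (1 + L - K\<^sup>2) * a + of_int (- L) * lo)
    = of_int (L\<^sup>2 + L) * ((a * b + 1) - 1) + of_int (1 + L - M\<^sup>2) * a\<^sup>2 - of_int L * ((a * lo + 1) - 1)"
    unfolding MM by (simp add: square_simps)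
  finally have "[:4 * of_int M * \<alpha> * \<kappa> - ((of_int L)\<^sup>2 + of_int L) + of_int L * \<kappa>\<^sup>2:] * r\<^sup>2 + [:0:] * r
    + [:(of_int L)\<^sup>2 - 2 * of_int M * \<alpha> * \<omega> - (1 + of_int L - (of_int M)\<^sup>2) * \<alpha>\<^sup>2:] = 0"
    unfolding ab lo const_simps \<alpha>(1)[symmetric] by (simp add: square_simps)
  note q = quadratic_in_nonconst[OF this r]
  define m l y :: 'k where "m = of_int M" and "l = of_int L" and "y = \<kappa>\<^sup>2 - 1"
  have y0: "y \<noteq> 0" using \<alpha> \<kappa> by (simp add: y_def)
  have ay: "2 * \<alpha> * \<kappa> = y" using \<kappa> by (simp add: y_def)
  have k2: "\<kappa>\<^sup>2 = y + 1" by (simp add: y_def)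
  have "2 * m * (2 * \<alpha> * \<kappa>) + l * \<kappa>\<^sup>2 - (l\<^sup>2 + l) = 0"
    using q(1) unfolding m_def l_def by (simp add: algebra_simps)
  then have e1: "y * (2 * m + l) = l\<^sup>2" unfolding ay k2 by (simp add: algebra_simps)
  have "4 * \<kappa>\<^sup>2 * (l\<^sup>2 - 2 * m * \<alpha> * \<omega> - (1 + l - m\<^sup>2) * \<alpha>\<^sup>2) = 0"
    using q(3) unfolding m_def l_def by simp
  moreover have "4 * \<kappa>\<^sup>2 * (l\<^sup>2 - 2 * m * \<alpha> * \<omega> - (1 + l - m\<^sup>2) * \<alpha>\<^sup>2)
    = 4 * \<kappa>\<^sup>2 * l\<^sup>2 - 2 * m * (2 * \<alpha> * \<kappa>) * (2 * \<kappa> * \<omega>) - (1 + l - m\<^sup>2) * (2 * \<alpha> * \<kappa>)\<^sup>2"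
    by (simp add: square_simps)
  ultimately have e2: "4 * (y + 1) * l\<^sup>2 - 2 * m * y * (y + 2) - (1 + l - m\<^sup>2) * y\<^sup>2 = 0"
    unfolding ay \<omega>(1) k2 by (simp add: algebra_simps)
  have "y * (y * (m\<^sup>2 + 6 * m + 3 * l - 1) + 4 * (m + l)) = 0"
    using e2 unfolding e1[symmetric] by (simp add: square_simps)
  then have e3: "y * (m\<^sup>2 + 6 * m + 3 * l - 1) + 4 * (m + l) = 0" using y0 by simp
  have "l\<^sup>2 * (m\<^sup>2 + 6 * m + 3 * l - 1) + 4 * (m + l) * (2 * m + l)
    = (2 * m + l) * (y * (m\<^sup>2 + 6 * m + 3 * l - 1) + 4 * (m + l))"
    unfolding e1[symmetric] by (simp add: algebra_simps)
  then have "l\<^sup>2 * (m\<^sup>2 + 6 * m + 3 * l - 1) + 4 * (m + l) * (2 * m + l) = 0" unfolding e3 by simp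
  then have "of_int (L\<^sup>2 * (M\<^sup>2 + 6 * M + 3 * L - 1) + 4 * (M + L) * (2 * M + L)) = (of_int 0 :: 'k)"
    unfolding m_def l_def by simp
  then have "L\<^sup>2 * (M\<^sup>2 + 6 * M + 3 * L - 1) + 4 * (M + L) * (2 * M + L) = 0" by (simp only: of_int_eq_iff)
  then have ie: "L\<^sup>2 * M\<^sup>2 + 6 * M * L\<^sup>2 + 3 * L ^ 3 + 8 * M\<^sup>2 + 12 * M * L + 3 * L\<^sup>2 = 0"
    by (simp add: square_simps power3_eq_cube)
  have dc: "degree c = 2 * degree b" "degree s = degree b"
    using degree_lo(1) flat a0 A.degree_s by auto
  have K0: "K \<noteq> 0" using assms(1) by auto
  define q where "q = s * 1 + of_int (sgn K) * c * 1"
  have "degree (of_int (sgn K) * c) = degree c" using K0 by (simp add: of_int_poly sgn_if)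
  then have dq: "degree q = degree c" unfolding q_def using degree_add_eq_right[of s] degree_lt(4) by simp
  then have "q \<noteq> 0" "degree (1 :: 'k poly) < degree q + degree s" using deg_c by auto
  from based_degree[OF A K0 q_def this A.degree_s(2)]
  have dz: "int (degree z) = (\<bar>K\<bar> + 1) * int (degree b)" using dq dc by (simp add: algebra_simps)
  have "(2 * (\<bar>K\<bar> + 1)) * int (degree b) = (if L > 0 then 2 + 3 * L else - 3 * L) * int (degree b)"
    using a_base_degree[OF a0 flat B L0] dz by (simp add: algebra_simps)
  then have "2 * (\<bar>K\<bar> + 1) = (if L > 0 then 2 + 3 * L else - 3 * L)" using degs by simp
  then have "(L > 0 \<and> 2 * \<bar>M\<bar> = 3 * L) \<or> (L < 0 \<and> 2 * \<bar>M\<bar> + 2 = - 3 * L)"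
    unfolding MM using L0 by (auto split: if_splits)
  moreover have "odd M" using assms(1) g(1) by (auto simp: M_def)
  ultimately have "M = -3 \<and> L = 2" using flat_relation_a ie assms(2) by blast
  then have e4: "y * (- 4) = 4" using e1 by (simp add: m_def l_def)
  have "4 * (y + 1) = 4 - y * (- 4)" by (simp add: algebra_simps)
  then have "4 * (y + 1) = 0" unfolding e4 by simp
  then have "\<kappa>\<^sup>2 = 0" unfolding k2 by (metis mult_eq_0_iff zero_neq_numeral)
  then show False using \<kappa>(1) by simp
qed

lemma no_zero_a_base_const:
  assumes "odd K" "even L" and a0: "degree a = 0" and A: "based a c s d z 0 1 1 K" and B: "based b c t d z a s r L"
  shows False
proof -
  note shape = zero_a_base_shape[OF assms(1,2) A B]
  have flat: "degree lo = degree b" using shape(4) a0 by auto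
  then show False
  proof (cases rule: flat_cases)
    case (sum e)
    then show False using no_zero_a_base_sum[OF a0 shape(2) _ _ shape(1)] by blast
  next
    case exceptional
    then show False using no_zero_a_base_exceptional[OF assms(1,2) a0 flat _ shape(2) A B shape(1)] by blast
  qed
qed

text \<open>Modulo \<open>c\<close> the \<open>{a, c}\<close>-chain stays constant, so \<open>b\<close> and \<open>lo\<close> must have equal degree to cancel.
  Then, as in \<open>no_zero_a_base_sum\<close>, all terms are quadratic polynomials in \<open>r\<close> after multiplication by \<open>a\<close>.\<close>

lemma no_const_a_base:
  assumes a0: "degree a = 0" and w: "a * a + 1 = w\<^sup>2" and "even L"
    and A: "based a c s d z a s w K" and B: "based b c t d z a s r L"
  shows False
proof -
  let ?m = "of_int K :: 'k poly" and ?n = "of_int L :: 'k poly"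
  have dw: "degree w = 0" by (rule const_root[OF a0 w])
  have L0: "L \<noteq> 0" using based_zero B z_not_base(2) by fastforce
  have K0: "K \<noteq> 0" using based_zero A z_not_base(2) by fastforce
  have LL: "L\<^sup>2 + L \<noteq> 0"
  proof
    assume "L\<^sup>2 + L = 0"
    then have "L * (L + 1) = 0" by (simp add: square_simps)
    then have "L = -1" using L0 by auto
    then show False using assms(3) by simp
  qed
  have sws: "s * w * s = w + c * (a * w)"
  proof -
    have "s * w * s = s\<^sup>2 * w" by (simp add: power2_eq_square)
    then show ?thesis unfolding ac[symmetric] by (simp add: algebra_simps)
  qed
  have "(?m\<^sup>2 * a + 2 * ?m * w) - (?n\<^sup>2 * b + ?n * (a + b - lo))
    = ((a + ?m\<^sup>2 * a + 2 * ?m * (s * w * s)) - (a + ?n\<^sup>2 * b + 2 * ?n * (t * r * s)))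
      + (?n * (2 * (r * s * t) - (a + b - lo)) - c * (2 * ?m * a * w))"
    unfolding sws by (simp add: algebra_simps)
  then have "c dvd (?m\<^sup>2 * a + 2 * ?m * w) - (?n\<^sup>2 * b + ?n * (a + b - lo))"
    using collision[OF A B] rst_mod by (metis dvd_add dvd_diff dvd_mult dvd_triv_left)
  then have eq: "?m\<^sup>2 * a + 2 * ?m * w = ?n\<^sup>2 * b + ?n * (a + b - lo)"
    by (rule eq_of_dvd_degree_less) (use deg_c dw in \<open>intro degree_less_intros degree_lt; simp\<close>)+
  have rel: "of_int (L\<^sup>2 + L) * b = ?n * lo + (?m\<^sup>2 * a + 2 * ?m * w - ?n * a)"
    using eq by (simp add: square_simps)
  have small: "degree (?m\<^sup>2 * a + 2 * ?m * w - ?n * a) < n" if "0 < n" for n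
    using that a0 dw by (intro degree_less_intros) auto
  have flat: "degree lo = degree b"
  proof (rule ccontr)
    assume ne: "degree lo \<noteq> degree b"
    show False
    proof (cases "degree lo < degree b")
      case True
      have "degree (?n * lo + (?m\<^sup>2 * a + 2 * ?m * w - ?n * a)) < degree b"
        by (rule degree_add_less[OF degree_of_int_mult_less[OF True] small[OF degs(3)]])
      then have "L\<^sup>2 + L = 0" using of_int_times_dominates rel by blast
      then show False using LL by simp
    next
      case False
      then have lt: "degree b < degree lo" using ne by simp
      have "of_int L * lo = of_int (L\<^sup>2 + L) * b - (?m\<^sup>2 * a + 2 * ?m * w - ?n * a)" unfolding rel by simp
      moreover have "degree (of_int (L\<^sup>2 + L) * b - (?m\<^sup>2 * a + 2 * ?m * w - ?n * a)) < degree lo"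
        by (rule degree_diff_less[OF degree_of_int_mult_less[OF lt] small]) (use lt in simp)
      ultimately have "L = 0" using of_int_times_dominates by blast
      then show False using L0 by simp
    qed
  qed
  have r: "degree r > 0" using degree_r degs by auto
  obtain \<omega>1 where \<omega>1: "w = [:\<omega>1:]" using dw by (rule degree_eq_zeroE)
  have arel: "of_int (L\<^sup>2 + L) * ((a * b + 1) - 1) = ?n * ((a * lo + 1) - 1) + (?m\<^sup>2 * a\<^sup>2 + 2 * ?m * a * w - ?n * a\<^sup>2)"
  proof -
    have "a * (of_int (L\<^sup>2 + L) * b) = a * (?n * lo + (?m\<^sup>2 * a + 2 * ?m * w - ?n * a))" unfolding rel ..
    then show ?thesis by (simp add: square_simps)
  qed
  from flat show False
  proof (cases rule: flat_cases)
    case (sum e)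
    let ?e = "of_int e :: 'k poly"
    obtain \<alpha> where \<alpha>: "a = [:\<alpha>:]" using a0 by (rule degree_eq_zeroE)
    have "a * lo + 1 = a\<^sup>2 + (a * b + 1) + 2 * ?e * a * r" unfolding sum(2) by (simp add: square_simps)
    then have alo: "a * lo + 1 = a\<^sup>2 + r\<^sup>2 + 2 * ?e * a * r" unfolding ab .
    have "[:(of_int L)\<^sup>2:] * r\<^sup>2 + [:- 2 * of_int L * of_int e * \<alpha>:] * r
      + [:- ((of_int L)\<^sup>2) - (of_int K)\<^sup>2 * \<alpha>\<^sup>2 - 2 * of_int K * \<alpha> * \<omega>1:] = 0"
      using arel unfolding ab alo const_simps \<alpha>[symmetric] \<omega>1[symmetric] by (simp add: square_simps)
    then have "(of_int L)\<^sup>2 = (0 :: 'k)" using r by (rule quadratic_in_nonconst(1))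
    then show False using L0 by simp
  next
    case exceptional
    from a0 flat exceptional(2) obtain \<alpha> \<kappa> \<omega> where \<alpha>: "a = [:\<alpha>:]" "\<alpha> \<noteq> 0" and \<kappa>: "\<kappa> \<noteq> 0" "\<kappa>\<^sup>2 - 1 = 2 * \<alpha> * \<kappa>"
      and \<omega>: "2 * \<kappa> * \<omega> = \<kappa>\<^sup>2 + 1" "\<omega>\<^sup>2 = \<alpha>\<^sup>2 + 1"
      and lo: "a * lo + 1 = [:\<kappa>:]\<^sup>2 * r\<^sup>2" and s: "s\<^sup>2 = (2 * [:\<kappa>:] * r\<^sup>2 - [:\<omega>:])\<^sup>2"
      by (rule exceptional_parameter)
    have "[:\<omega>1\<^sup>2:] = [:\<omega>\<^sup>2:]"
      unfolding \<omega>(2) using w unfolding const_simps \<alpha>(1)[symmetric] \<omega>1[symmetric] by (simp add: power2_eq_square)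
    then have "\<omega>1\<^sup>2 = \<omega>\<^sup>2" by simp
    then obtain g where g: "g = 1 \<or> g = -1" "\<omega>1 = of_int g * \<omega>" by (rule square_eq_signs)
    define M where "M = K * g"
    have MM: "M\<^sup>2 = K\<^sup>2" "\<bar>M\<bar> = \<bar>K\<bar>" using g(1) by (auto simp: M_def)
    have "[:of_int L * \<kappa>\<^sup>2 - (of_int L)\<^sup>2 - of_int L:] * r\<^sup>2 + [:0:] * r
      + [:(of_int L)\<^sup>2 + (of_int K)\<^sup>2 * \<alpha>\<^sup>2 + 2 * of_int K * \<alpha> * \<omega>1 - of_int L * \<alpha>\<^sup>2:] = 0"
      using arel unfolding ab lo const_simps \<alpha>(1)[symmetric] \<omega>1[symmetric] by (simp add: square_simps)
    note q = quadratic_in_nonconst[OF this r]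
    define m l :: 'k where "m = of_int M" and "l = of_int L"
    have l0: "l \<noteq> 0" using L0 by (simp add: l_def)
    have "l * (\<kappa>\<^sup>2 - l - 1) = 0" using q(1) by (simp add: l_def square_simps)
    then have "\<kappa>\<^sup>2 - l - 1 = 0" using l0 by (metis mult_eq_0_iff)
    then have k2: "\<kappa>\<^sup>2 = l + 1" by (simp add: algebra_simps)
    have ay: "2 * \<alpha> * \<kappa> = l" using \<kappa>(2) k2 by simp
    have "l\<^sup>2 + m\<^sup>2 * \<alpha>\<^sup>2 + 2 * m * \<alpha> * \<omega> - l * \<alpha>\<^sup>2 = 0"
      using q(3) g unfolding m_def l_def M_def by auto
    then have "4 * \<kappa>\<^sup>2 * (l\<^sup>2 + m\<^sup>2 * \<alpha>\<^sup>2 + 2 * m * \<alpha> * \<omega> - l * \<alpha>\<^sup>2) = 0" by simp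
    moreover have "4 * \<kappa>\<^sup>2 * (l\<^sup>2 + m\<^sup>2 * \<alpha>\<^sup>2 + 2 * m * \<alpha> * \<omega> - l * \<alpha>\<^sup>2)
      = 4 * \<kappa>\<^sup>2 * l\<^sup>2 + (m\<^sup>2 - l) * (2 * \<alpha> * \<kappa>)\<^sup>2 + 2 * m * (2 * \<alpha> * \<kappa>) * (2 * \<kappa> * \<omega>)"
      by (simp add: square_simps)
    ultimately have "4 * (l + 1) * l\<^sup>2 + (m\<^sup>2 - l) * l\<^sup>2 + 2 * m * l * (l + 2) = 0"
      unfolding ay \<omega>(1) k2 by (simp add: algebra_simps)
    then have "l * (m\<^sup>2 * l + 2 * m * (l + 2) + 3 * l\<^sup>2 + 4 * l) = 0" by (simp add: square_simps)
    then have "m\<^sup>2 * l + 2 * m * (l + 2) + 3 * l\<^sup>2 + 4 * l = 0" using l0 by simp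
    then have "of_int (M\<^sup>2 * L + 2 * M * (L + 2) + 3 * L\<^sup>2 + 4 * L) = (of_int 0 :: 'k)"
      unfolding m_def l_def by simp
    then have ie: "M\<^sup>2 * L + 2 * M * (L + 2) + 3 * L\<^sup>2 + 4 * L = 0" by (simp only: of_int_eq_iff)
    have dc: "degree c = 2 * degree b" "degree s = degree b"
      using degree_lo(1) flat a0 A.degree_s by auto
    define q where "q = s * s + of_int (sgn K) * c * w"
    have "q = 1 + c * (a + of_int (sgn K) * w)"
      unfolding q_def using ac by (simp add: square_simps)
    moreover have "a + of_int (sgn K) * w \<noteq> 0"
    proof
      assume "a + of_int (sgn K) * w = 0"
      then have "a = - (of_int (sgn K) * w)" by (simp add: eq_neg_iff_add_eq_0)
      then have "a * a = w\<^sup>2" using K0 by (auto simp: sgn_if power2_eq_square)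
      then show False using w by simp
    qed
    moreover have "degree (a + of_int (sgn K) * w) = 0"
      using degree_add_le[of a 0 "of_int (sgn K) * w"] a0 dw degree_of_int_mult_le[of w 0] by simp
    ultimately have dq: "degree q = degree c"
      using degree_add_eq_right[of 1 "c * (a + of_int (sgn K) * w)"] deg_c nonzero by (simp add: degree_mult_eq)
    then have "q \<noteq> 0" "degree s < degree q + degree s" using deg_c by auto
    from based_degree[OF A K0 q_def this A.degree_s(2)]
    have dz: "int (degree z) = (\<bar>K\<bar> + 1) * int (degree b)" using dq dc by (simp add: algebra_simps)
    have "(2 * (\<bar>K\<bar> + 1)) * int (degree b) = (if L > 0 then 2 + 3 * L else - 3 * L) * int (degree b)"
      using a_base_degree[OF a0 flat B L0] dz by (simp add: algebra_simps)
    then have "2 * (\<bar>K\<bar> + 1) = (if L > 0 then 2 + 3 * L else - 3 * L)" using degs by simp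
    then have "(L > 0 \<and> 2 * \<bar>M\<bar> = 3 * L) \<or> (L < 0 \<and> 2 * \<bar>M\<bar> + 2 = - 3 * L)"
      unfolding MM using L0 by (auto split: if_splits)
    then show False using flat_relation_const ie assms(3) by blast
  qed
qed

lemma lo_base_root: "s * (s * t - c * r) + c * (r * s - a * t) = t" "t * (s * t - c * r) + c * (r * t - b * s) = s"
  "s * t - c * r \<noteq> 0"
proof -
  have "s * (s * t - c * r) + c * (r * s - a * t) = s\<^sup>2 * t - a * c * t"
    "t * (s * t - c * r) + c * (r * t - b * s) = t\<^sup>2 * s - b * c * s"
    by (simp_all add: square_simps)
  then show "s * (s * t - c * r) + c * (r * s - a * t) = t" "t * (s * t - c * r) + c * (r * t - b * s) = s"
    unfolding ac[symmetric] bc[symmetric] by (simp_all add: algebra_simps)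
  show "s * t - c * r \<noteq> 0" using degree_uv(1) deg_c by auto
qed

lemma lo_base_degree:
  "based a c s d z lo (s * t - c * r) (r * s - a * t) K \<Longrightarrow> int (degree z) = (if K > 0
     then int (degree t) + (K - 1) * int (degree s) else int (degree (s * t - c * r)) - K * int (degree s))"
  "based b c t d z lo (s * t - c * r) (r * t - b * s) L \<Longrightarrow> int (degree z) = (if L > 0
     then int (degree s) + (L - 1) * int (degree t) else int (degree (s * t - c * r)) - L * int (degree t))"
proof -
  have deg: "degree t < degree s + degree (s * t - c * r)" "degree (s * t - c * r) < degree t + degree s"
    "degree s < degree t + degree (s * t - c * r)" "degree (s * t - c * r) < degree s + degree t"
    using degree_uv(1) A.degree_s B.degree_s degree_lo degs gap by auto
  note A = lower_base_degree[OF _ lo_base_root(1) B.degree_s(3) lo_base_root(3) A.degree_s(2) deg(1,2)]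
    and B = lower_base_degree[OF _ lo_base_root(2) A.degree_s(3) lo_base_root(3) B.degree_s(2) deg(3,4)]
  show "based a c s d z lo (s * t - c * r) (r * s - a * t) K \<Longrightarrow> int (degree z) = (if K > 0
     then int (degree t) + (K - 1) * int (degree s) else int (degree (s * t - c * r)) - K * int (degree s))"
    "based b c t d z lo (s * t - c * r) (r * t - b * s) L \<Longrightarrow> int (degree z) = (if L > 0
     then int (degree s) + (L - 1) * int (degree t) else int (degree (s * t - c * r)) - L * int (degree t))"
    by (fact A, fact B)
qed

lemma lo_base_relation:
  assumes A: "based a c s d z lo (s * t - c * r) (r * s - a * t) K"
    and B: "based b c t d z lo (s * t - c * r) (r * t - b * s) L"
  shows "of_int (K\<^sup>2 - K - L) * a + of_int (K - L\<^sup>2 + L) * b + of_int (L - K) * lo = 0"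
proof -
  let ?m = "of_int K :: 'k poly" and ?n = "of_int L :: 'k poly"
  have base: "c dvd 2 * p - e" if "2 * p = 2 * (r * s * t) - 2 * f + c * v" "e = a + b - lo - 2 * f" for p e f v
  proof -
    have "2 * p - e = (2 * (r * s * t) - (a + b - lo)) + c * v" unfolding that by simp
    then show ?thesis using rst_mod by (metis dvd_add dvd_triv_left)
  qed
  have d1: "c dvd 2 * (s * (r * s - a * t) * (s * t - c * r)) - (b - a - lo)"
    by (rule base[OF lower_base_product[OF ac bc]]) simp
  have "2 * (t * (r * t - b * s) * (s * t - c * r))
    = 2 * (r * s * t) - 2 * b + c * (2 * (2 * b * (r * s * t) - r\<^sup>2 * t\<^sup>2 - b * (b + a + b * a * c)))"
    using lower_base_product[OF bc ac, of r] by (simp only: ac_simps)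
  then have d2: "c dvd 2 * (t * (r * t - b * s) * (s * t - c * r)) - (a - b - lo)"
    by (rule base) simp
  have "(?m\<^sup>2 * a + ?m * (b - a - lo)) - (?n\<^sup>2 * b + ?n * (a - b - lo))
    = ((lo + ?m\<^sup>2 * a + 2 * ?m * (s * (r * s - a * t) * (s * t - c * r))) - (lo + ?n\<^sup>2 * b + 2 * ?n * (t * (r * t - b * s) * (s * t - c * r))))
      + (?n * (2 * (t * (r * t - b * s) * (s * t - c * r)) - (a - b - lo)) - ?m * (2 * (s * (r * s - a * t) * (s * t - c * r)) - (b - a - lo)))"
    by (simp add: right_diff_distrib)
  then have "c dvd (?m\<^sup>2 * a + ?m * (b - a - lo)) - (?n\<^sup>2 * b + ?n * (a - b - lo))"
    using collision[OF A B] d1 d2 by (metis dvd_add dvd_diff dvd_mult)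
  then have "?m\<^sup>2 * a + ?m * (b - a - lo) = ?n\<^sup>2 * b + ?n * (a - b - lo)"
    by (rule eq_of_dvd_degree_less) (intro degree_less_intros degree_lt)+
  then show ?thesis by (simp add: square_simps)
qed

text \<open>No step from \<open>lo\<close>, and two steps via \<open>b\<close>, give the regular extensions \<open>lo\<close> and \<open>hi\<close>.\<close>

lemma lo_base_steps:
  assumes "based a c s d z lo (s * t - c * r) (r * s - a * t) K"
  shows "K \<noteq> 0" "K \<noteq> 2"
proof -
  show "K \<noteq> 0" using based_zero assms not_regular(2) by metis
  show "K \<noteq> 2"
  proof
    assume "K = 2"
    then have "z\<^sup>2 = (2 * s * (s * (s * t - c * r) + c * (r * s - a * t)) - (s * t - c * r))\<^sup>2"
      using assms unfolding based_def chain_def by (simp add: numeral_2_eq_2)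
    also have "s * (s * t - c * r) + c * (r * s - a * t) = s\<^sup>2 * t - a * c * t"
      by (simp add: square_simps)
    also have "\<dots> = t" unfolding ac[symmetric] by (simp add: algebra_simps)
    also have "2 * s * t - (s * t - c * r) = s * t + c * r" by simp
    finally show False using not_regular(1) by simp
  qed
qed

text \<open>Now \<open>s\<close> and \<open>t\<close> have the same degree \<open>\<sigma>\<close>.  The degree of \<open>z\<close> is \<open>K \<sigma>\<close> for positive and \<open>\<zeta> - K \<sigma>\<close> for
  other \<open>K\<close>, where \<open>\<zeta>\<close> lies strictly between \<open>0\<close> and \<open>2 \<sigma>\<close> and thus is not a difference of even multiples of \<open>\<sigma>\<close>.\<close>

lemma no_lo_base_balanced:
  assumes "even K" "even L" "K \<noteq> L" and eq: "degree a = degree b"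
    and A: "based a c s d z lo (s * t - c * r) (r * s - a * t) K"
    and B: "based b c t d z lo (s * t - c * r) (r * t - b * s) L"
  shows False
proof -
  define \<sigma> where "\<sigma> = int (degree s)"
  define \<zeta> where "\<zeta> = int (degree (s * t - c * r))"
  have \<sigma>: "int (degree s) = \<sigma>" "int (degree t) = \<sigma>" "2 * \<sigma> = int (degree b) + int (degree c)"
    using A.degree_s(1) B.degree_s(1) eq by (simp_all add: \<sigma>_def)
  have \<zeta>: "\<zeta> = int (degree c) - int (degree b)" using degree_uv(1) degree_lo(1) eq by (simp add: \<zeta>_def)
  have "\<zeta> < 2 * \<sigma>" "0 < \<zeta>" "0 < \<sigma>" using \<sigma>(3) \<zeta> gap degs by auto
  have dA: "int (degree z) = (if K > 0 then K * \<sigma> else \<zeta> - K * \<sigma>)"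
    using lo_base_degree(1)[OF A] unfolding \<sigma> \<zeta>_def[symmetric] by (simp add: algebra_simps)
  have dB: "int (degree z) = (if L > 0 then L * \<sigma> else \<zeta> - L * \<sigma>)"
    using lo_base_degree(2)[OF B] unfolding \<sigma> \<zeta>_def[symmetric] by (simp add: algebra_simps)
  have no: "(M + N) * \<sigma> \<noteq> \<zeta>" if "even M" "even N" for M N
  proof
    assume h: "(M + N) * \<sigma> = \<zeta>"
    have "even (M + N)" using that by simp
    then obtain j where j: "M + N = 2 * j" by (rule evenE)
    have e: "j * (2 * \<sigma>) = \<zeta>" using h unfolding j by (simp add: algebra_simps)
    show False
    proof (cases "j \<le> 0")
      case True
      then have "j * (2 * \<sigma>) \<le> 0" using \<open>0 < \<sigma>\<close> by (simp add: mult_nonpos_nonneg)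
      then show False using e \<open>0 < \<zeta>\<close> by simp
    next
      case False
      then have "1 * (2 * \<sigma>) \<le> j * (2 * \<sigma>)" using \<open>0 < \<sigma>\<close> by (intro mult_right_mono) auto
      then show False using e \<open>\<zeta> < 2 * \<sigma>\<close> by simp
    qed
  qed
  consider "K > 0" "L > 0" | "K > 0" "\<not> L > 0" | "\<not> K > 0" "L > 0" | "\<not> K > 0" "\<not> L > 0" by blast
  then show False
  proof cases
    case 1 then show False using dA dB assms(3) \<open>0 < \<sigma>\<close> by simp
  next
    case 2 then show False using dA dB no[OF assms(1,2)] by (simp add: algebra_simps)
  next
    case 3 then show False using dA dB no[OF assms(1,2)] by (simp add: algebra_simps)
  next
    case 4 then show False using dA dB assms(3) \<open>0 < \<sigma>\<close> by simp
  qed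
qed

text \<open>
  As in \<open>no_zero_a_base_exceptional\<close>, the relation is a quadratic equation for \<open>r\<close> after multiplication by \<open>a\<close>.\<close>
lemma no_lo_base_exceptional:
  assumes "even K" "even L" and KL: "K \<noteq> L" and a0: "degree a = 0" and flat: "degree lo = degree b" and co: "co = a"
    and A: "based a c s d z lo (s * t - c * r) (r * s - a * t) K"
    and B: "based b c t d z lo (s * t - c * r) (r * t - b * s) L"
  shows False
proof -
  have rel: "of_int (K\<^sup>2 - K - L) * a + of_int (K - L\<^sup>2 + L) * b + of_int (L - K) * lo = 0"
    by (rule lo_base_relation[OF A B])
  from a0 flat co obtain \<alpha> \<kappa> \<omega> where \<alpha>: "a = [:\<alpha>:]" "\<alpha> \<noteq> 0" and \<kappa>: "\<kappa> \<noteq> 0" "\<kappa>\<^sup>2 - 1 = 2 * \<alpha> * \<kappa>"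
    and \<omega>: "2 * \<kappa> * \<omega> = \<kappa>\<^sup>2 + 1" "\<omega>\<^sup>2 = \<alpha>\<^sup>2 + 1"
    and lo: "a * lo + 1 = [:\<kappa>:]\<^sup>2 * r\<^sup>2" and s: "s\<^sup>2 = (2 * [:\<kappa>:] * r\<^sup>2 - [:\<omega>:])\<^sup>2"
    by (rule exceptional_parameter)
  have r: "degree r > 0" using degree_r degs by auto
  have "a * (of_int (K\<^sup>2 - K - L) * a + of_int (K - L\<^sup>2 + L) * b + of_int (L - K) * lo) = 0"
    unfolding rel by simp
  then have arel: "of_int (K\<^sup>2 - K - L) * a\<^sup>2 + of_int (K - L\<^sup>2 + L) * ((a * b + 1) - 1) + of_int (L - K) * ((a * lo + 1) - 1) = 0"
    by (simp add: square_simps)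
  define k l y :: 'k where "k = of_int K" and "l = of_int L" and "y = \<kappa>\<^sup>2 - 1"
  have "[:(k - l\<^sup>2 + l) + (l - k) * \<kappa>\<^sup>2:] * r\<^sup>2 + [:0:] * r
    + [:(k\<^sup>2 - k - l) * \<alpha>\<^sup>2 - (k - l\<^sup>2 + l) - (l - k):] = 0"
    using arel unfolding ab lo const_simps \<alpha>(1)[symmetric] k_def l_def by (simp add: square_simps)
  note q = quadratic_in_nonconst[OF this r]
  have ay: "2 * \<alpha> * \<kappa> = y" using \<kappa> by (simp add: y_def)
  have y0: "y \<noteq> 0" using \<alpha> \<kappa> by (simp add: y_def)
  have k2: "\<kappa>\<^sup>2 = y + 1" by (simp add: y_def)
  have e1: "(l - k) * y = l\<^sup>2 - 2 * l" using q(1) unfolding k2 by (simp add: algebra_simps)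
  have lk: "l - k \<noteq> 0" using KL by (simp add: k_def l_def)
  have "(k\<^sup>2 - k - l) * \<alpha>\<^sup>2 + (l\<^sup>2 - 2 * l) = 0" using q(3) by (simp add: algebra_simps)
  then have h1: "4 * \<kappa>\<^sup>2 * ((k\<^sup>2 - k - l) * \<alpha>\<^sup>2 + (l\<^sup>2 - 2 * l)) = 0" by (simp only: mult_zero_right)
  have h2: "4 * \<kappa>\<^sup>2 * ((k\<^sup>2 - k - l) * \<alpha>\<^sup>2 + (l\<^sup>2 - 2 * l))
     = (k\<^sup>2 - k - l) * (2 * \<alpha> * \<kappa>)\<^sup>2 + 4 * \<kappa>\<^sup>2 * (l\<^sup>2 - 2 * l)"
    by (simp add: square_simps)
  have "(k\<^sup>2 - k - l) * y\<^sup>2 + 4 * (y + 1) * (l\<^sup>2 - 2 * l) = 0"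
    using trans[OF h2[symmetric] h1] unfolding ay k2 .
  then have "y * (y * (k\<^sup>2 - 5 * k + 3 * l) + 4 * (l - k)) = 0"
    unfolding e1[symmetric] by (simp add: square_simps)
  then have e3: "y * (k\<^sup>2 - 5 * k + 3 * l) + 4 * (l - k) = 0" using y0 by (metis mult_eq_0_iff)
  have "l * (l - 2) * (k\<^sup>2 - 5 * k + 3 * l) + 4 * (l - k)\<^sup>2 = (l\<^sup>2 - 2 * l) * (k\<^sup>2 - 5 * k + 3 * l) + 4 * (l - k)\<^sup>2"
    by (simp add: square_simps)
  also have "\<dots> = (l - k) * (y * (k\<^sup>2 - 5 * k + 3 * l) + 4 * (l - k))"
    unfolding e1[symmetric] by (simp add: square_simps)
  finally have "l * (l - 2) * (k\<^sup>2 - 5 * k + 3 * l) + 4 * (l - k)\<^sup>2 = 0" unfolding e3 mult_zero_right .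
  then have "of_int (L * (L - 2) * (K\<^sup>2 - 5 * K + 3 * L) + 4 * (L - K)\<^sup>2) = (of_int 0 :: 'k)"
    unfolding k_def l_def by simp
  then have ie: "L * (L - 2) * (K\<^sup>2 - 5 * K + 3 * L) + 4 * (L - K)\<^sup>2 = 0" by (simp only: of_int_eq_iff)
  have "l\<^sup>2 - 2 * l \<noteq> 0" unfolding e1[symmetric] using lk y0 by simp
  then have L02: "L \<noteq> 0" "L \<noteq> 2" by (auto simp: l_def)
  have d: "2 * int (degree (s * t - c * r)) = 3 * int (degree b)" "2 * int (degree t) = 3 * int (degree b)"
    "int (degree s) = int (degree b)"
    using degree_uv(1) degree_lo(1) flat a0 B.degree_s A.degree_s by auto
  have dA: "2 * int (degree z) = (if K > 0 then 2 * K + 1 else 3 - 2 * K) * int (degree b)"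
    using lo_base_degree(1)[OF A] d by (auto simp: algebra_simps split: if_splits)
  have dB: "2 * int (degree z) = (if L > 0 then 3 * L - 1 else 3 - 3 * L) * int (degree b)"
  proof (cases "L > 0")
    case True
    have "2 * int (degree z) = 2 * int (degree s) + (L - 1) * (2 * int (degree t))"
      using lo_base_degree(2)[OF B] True by simp
    then show ?thesis unfolding d using True by (simp add: algebra_simps)
  next
    case neg: False
    have "2 * int (degree z) = 2 * int (degree (s * t - c * r)) - L * (2 * int (degree t))"
      using lo_base_degree(2)[OF B] neg by simp
    then show ?thesis unfolding d using neg by (simp add: algebra_simps)
  qed
  have "(if K > 0 then 2 * K + 1 else 3 - 2 * K) = (if L > 0 then 3 * L - 1 else 3 - 3 * L)"
    using dA dB degs by simp
  then show False using flat_relation_lo[OF assms(1,2) L02 ie] by (simp split: if_splits)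
qed

text \<open>The relation is between \<open>a\<close>, \<open>b\<close> and \<open>lo\<close> only.  If \<open>degree a < degree b\<close>, comparison of degrees
  leaves two possibilities: either \<open>b\<close> drops out and \<open>lo\<close> is a rational multiple of \<open>a\<close>, or \<open>lo\<close> and \<open>b\<close> have
  the same degree, where \<open>flat_cases\<close> applies.\<close>

lemma no_lo_base:
  assumes "even K" "even L" and A: "based a c s d z lo (s * t - c * r) (r * s - a * t) K"
    and B: "based b c t d z lo (s * t - c * r) (r * t - b * s) L"
  shows False
proof -
  have rel: "of_int (K\<^sup>2 - K - L) * a + of_int (K - L\<^sup>2 + L) * b + of_int (L - K) * lo = 0"
    by (rule lo_base_relation[OF A B])
  have KL: "K \<noteq> L"
  proof
    assume "K = L"
    then have "of_int (K * (K - 2)) * (a - b) = 0" using rel by (simp add: square_simps)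
    then have "K * (K - 2) = 0" using distinct(1) by (metis mult_eq_0_iff of_int_0_eq_iff right_minus_eq)
    then show False using lo_base_steps[OF A] by auto
  qed
  show False
  proof (cases "degree a = degree b")
    case True
    then show False using no_lo_base_balanced[OF assms(1,2) KL _ A B] by simp
  next
    case False
    then have lt: "degree a < degree b" using degs by simp
    consider "degree b < degree lo" | "degree lo < degree b" | "degree lo = degree b" by linarith
    then show False
    proof cases
      case 1
      have "of_int (L - K) * lo = - (of_int (K\<^sup>2 - K - L) * a) - of_int (K - L\<^sup>2 + L) * b"
        using rel by (simp add: eq_neg_iff_add_eq_0 algebra_simps)
      moreover have "degree (- (of_int (K\<^sup>2 - K - L) * a) - of_int (K - L\<^sup>2 + L) * b) < degree lo"
        using lt 1 by (intro degree_diff_less) (auto simp only: degree_minus intro!: degree_of_int_mult_less)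
      ultimately show False using of_int_times_dominates KL by fastforce
    next
      case 2
      have "of_int (K - L\<^sup>2 + L) * b = - (of_int (K\<^sup>2 - K - L) * a) - of_int (L - K) * lo"
        using rel by (simp add: eq_neg_iff_add_eq_0 algebra_simps)
      moreover have "degree (- (of_int (K\<^sup>2 - K - L) * a) - of_int (L - K) * lo) < degree b"
        using lt 2 by (intro degree_diff_less) (auto simp only: degree_minus intro!: degree_of_int_mult_less)
      ultimately have b0: "K - L\<^sup>2 + L = 0" using of_int_times_dominates by blast
      have rel2: "of_int (K\<^sup>2 - K - L) * a = of_int (K - L) * lo"
        using rel unfolding b0 by (simp add: algebra_simps)
      have ne: "K\<^sup>2 - K - L \<noteq> 0"
      proof
        assume z: "K\<^sup>2 - K - L = 0"
        have "of_int (K - L) * lo = 0" using rel2 unfolding z by simp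
        then show False using KL degree_lo(2) by simp
      qed
      have "degree lo = degree a"
      proof (rule ccontr)
        assume "degree lo \<noteq> degree a"
        then consider "degree a < degree lo" | "degree lo < degree a" by linarith
        then show False
        proof cases
          case 1
          then have "K - L = 0"
            using of_int_times_dominates[OF rel2[symmetric]] degree_of_int_mult_less by blast
          then show False using KL by simp
        next
          case 2
          then have "K\<^sup>2 - K - L = 0"
            using of_int_times_dominates[OF rel2] degree_of_int_mult_less by blast
          then show False using ne by simp
        qed
      qed
      then have a0: "0 < degree a" using degree_lo(1) gap by auto
      let ?i = "of_int (K - L) :: 'k poly" and ?j = "of_int (K\<^sup>2 - K - L) :: 'k poly"
      \<comment> \<open>As \<open>lo\<close> is a rational multiple of \<open>a\<close>, the square \<open>a lo + 1\<close> contradicts the rigidity of squares.\<close>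
      have "(?i * (r * s - a * t))\<^sup>2 = ?i\<^sup>2 * (a * lo + 1)"
        unfolding lo_roots(1) by (rule power_mult_distrib)
      also have "\<dots> = ?i * (a * (?i * lo)) + ?i\<^sup>2" by (simp add: square_simps)
      also have "\<dots> = of_int ((K - L) * (K\<^sup>2 - K - L)) * a\<^sup>2 + of_int ((K - L)\<^sup>2)"
        unfolding rel2[symmetric] of_int_mult of_int_power by (simp add: square_simps)
      finally have "of_int ((K - L) * (K\<^sup>2 - K - L)) * a\<^sup>2 + of_int ((K - L)\<^sup>2) = (?i * (r * s - a * t))\<^sup>2" by simp
      then have "degree a = 0"
        by (rule square_shift_const) (use KL ne in \<open>simp_all only: degree_of_int of_int_eq_0_iff mult_eq_0_iff power_eq_0_iff, auto\<close>)
      then show False using a0 by simp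
    next
      case flat: 3
      then show False
      proof (cases rule: flat_cases)
        case (sum e)
        have dr: "degree a < degree r" "degree r < degree b" using degree_r(1) lt by auto
        have rel3: "of_int (K\<^sup>2 - 2 * K) * a - of_int (L\<^sup>2 - 2 * L) * b + of_int (2 * e * (L - K)) * r = 0"
          using rel unfolding sum(2) by (simp add: algebra_simps)
        have "of_int (L\<^sup>2 - 2 * L) * b = of_int (K\<^sup>2 - 2 * K) * a + of_int (2 * e * (L - K)) * r"
          using rel3 by (simp add: algebra_simps)
        moreover have "degree (of_int (K\<^sup>2 - 2 * K) * a + of_int (2 * e * (L - K)) * r) < degree b"
          by (rule degree_add_less[OF degree_of_int_mult_less[OF lt] degree_of_int_mult_less[OF dr(2)]])
        ultimately have l0: "L\<^sup>2 - 2 * L = 0" using of_int_times_dominates by blast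
        have "of_int (2 * e * (L - K)) * r = of_int (- (K\<^sup>2 - 2 * K)) * a"
          using rel3 unfolding l0 by (simp add: algebra_simps eq_neg_iff_add_eq_0)
        then have "2 * e * (L - K) = 0"
          using of_int_times_dominates degree_of_int_mult_less[OF dr(1)] by blast
        then show False using KL sum(1) by auto
      next
        case exceptional
        then show False using no_lo_base_exceptional[OF assms(1,2) KL _ flat _ A B] by blast
      qed
    qed
  qed
qed

lemma gap_contradiction: False
proof (cases rule: joint_resolution)
  case (common e u v w K L)
  have "e = 0 \<or> (e = a \<and> degree a = 0) \<or> e = lo \<or> e = hi"
    unfolding lo_def hi_def by (rule common_base[OF common(1-8)])
  then consider "e = 0" | "e = a" "degree a = 0" | "e = lo" | "e = hi" by metis
  then show False
  proof cases
    case 1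
    then have "w\<^sup>2 = 1\<^sup>2" "u\<^sup>2 = 1\<^sup>2" "v\<^sup>2 = 1\<^sup>2" using common(5-7) by simp_all
    then show False using based_rebase[OF common(11)] based_rebase[OF common(12)] no_common_zero_base unfolding 1 by blast
  next
    case 2
    then have "w\<^sup>2 = s\<^sup>2" "v\<^sup>2 = r\<^sup>2" "a * a + 1 = u\<^sup>2" using common(5-7) ac ab by (simp_all add: mult.commute)
    then show False
      using based_rebase[OF common(11) _ refl] based_rebase[OF common(12)] no_const_a_base[OF 2(2)] common(10) unfolding 2(1) by metis
  next
    case 3
    then have "w\<^sup>2 = (s * t - c * r)\<^sup>2" "u\<^sup>2 = (r * s - a * t)\<^sup>2" "v\<^sup>2 = (r * t - b * s)\<^sup>2"
      using common(5-7) lo_roots by simp_all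
    then show False
      using based_rebase[OF common(11)] based_rebase[OF common(12)] no_lo_base common(9,10) unfolding 3 by metis
  next
    case 4
    then show False
      using degree_root(1)[OF common(7) nonzero(3)] common(8) degree_hi deg_c by simp
  qed
next
  case (even_zero e u w K L)
  have cb: "c * b + 1 = t\<^sup>2" using bc by (simp add: mult.commute)
  note e = base_of_residue[OF cb even_zero(2,4) degree_lt(5) even_zero(3)]
  have "u\<^sup>2 = r\<^sup>2" using even_zero(1) ab e(1) by simp
  then show False using based_rebase[OF even_zero(7) e(2)] no_b_zero_base even_zero(5,6,8) unfolding e(1) by blast
next
  case (zero_even e v w K L)
  have ca: "c * a + 1 = s\<^sup>2" using ac by (simp add: mult.commute)
  note e = base_of_residue[OF ca zero_even(2,4) degree_lt(4) zero_even(3)]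
  have "v\<^sup>2 = r\<^sup>2" using zero_even(1) ab e(1) by (simp add: mult.commute)
  then obtain L' where "even L'" "based b c t d z a s r L'"
    using based_rebase[OF zero_even(8) e(2)] zero_even(6) unfolding e(1) by blast
  then show False
    using no_zero_a_base_nonconst no_zero_a_base_const zero_even(5,7) by blast
next
  case (zero_zero K L)
  then have "s = t \<or> s = - t"
    using eq_of_dvd_degree_less[of c s t] eq_of_dvd_degree_less[of c s "- t"] degree_lt by auto
  then have "a * c + 1 = b * c + 1" unfolding ac bc by auto
  then show False using distinct nonzero by simp
next
  case (const_zero w K L)
  show False by (rule no_const_zero_base[OF const_zero(1,2,5,6)])
qed

end

section \<open>Triples whose smaller regular extension is zero\<close>

lemma tight_relation:
  fixes K L :: int
  assumes "K\<^sup>2 = L\<^sup>2" "K + L\<^sup>2 + L = 0"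
  shows "L = 0 \<or> L = - 2"
proof -
  have "K = L \<or> K = - L" using assms(1) by (simp add: power2_eq_iff)
  then show ?thesis
  proof
    assume "K = L"
    then have "L * (L + 2) = 0" using assms(2) by (simp add: square_simps)
    then show ?thesis by auto
  next
    assume "K = - L"
    then show ?thesis using assms(2) by simp
  qed
qed

text \<open>Here \<open>c = a + b + 2 r\<close>, which means that \<open>0\<close> is a regular extension of \<open>{a, b, c}\<close>.  Modulo \<open>c\<close> one has
  \<open>b = a - 2 s\<close> and \<open>t = - s\<close>, so that all collisions can be expressed by \<open>a\<close> and \<open>s\<close>.\<close>

locale tight_triple = extended_triple S a b c d r s t x y z
  for S :: "'k::field_char_0 poly set" and a b c d r s t x y z +
  assumes c_eq: "c = a + b + 2 * r" and s_eq: "s = a + r" and t_eq: "t = b + r"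
    and deg_bc: "degree b = degree c"
begin

lemma reflect: "b = c + a - 2 * s" "t = c - s"
  by (simp_all add: c_eq s_eq t_eq)

lemma twice_rst: "2 * (r * s * t) = a + b + c + 2 * a * b * c"
proof -
  have "2 * (r * s * t) = 2 * r * (a * b + 1 + r * (a + b) + r\<^sup>2 - 1)"
    unfolding s_eq t_eq by (simp add: square_simps)
  also have "\<dots> = 2 * r * (2 * (a * b) + r * (a + b) + 1)"
    unfolding ab[symmetric] by (simp add: algebra_simps)
  also have "\<dots> = 4 * (a * b) * r + 2 * r\<^sup>2 * (a + b) + 2 * r" by (simp add: square_simps)
  also have "\<dots> = a + b + c + 2 * a * b * c" unfolding ab[symmetric] c_eq by (simp add: algebra_simps)
  finally show ?thesis .
qed

text \<open>The larger regular extension is \<open>4 r s t\<close>, and its degree exceeds \<open>degree c\<close>.\<close>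

lemma common_base_tight:
  assumes "e \<in> S" "u \<in> S" "v \<in> S" "w \<in> S" "a * e + 1 = u\<^sup>2" "b * e + 1 = v\<^sup>2" "c * e + 1 = w\<^sup>2"
    and lt: "degree w < degree c"
  shows "e = 0 \<or> (e = a \<and> degree a = 0)"
proof (rule ccontr)
  assume no: "\<not> ?thesis"
  have "e = 4 * (r * s * t)"
    using common_base[OF assms] no unfolding twice_rst[symmetric] by auto
  moreover have "r * s * t \<noteq> 0" using degree_r A.degree_s B.degree_s by auto
  ultimately have "degree e = degree r + degree s + degree t"
    using degree_r(2) A.degree_s(3) B.degree_s(3) by (simp add: degree_mult_eq numeral_poly)
  then have "degree c \<le> degree e" using degree_r A.degree_s B.degree_s deg_bc by auto
  moreover have "e \<noteq> 0" using no by simp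
  ultimately show False
    using degree_root(1)[OF assms(7) nonzero(3)] deg_c lt by auto
qed

lemma zero_base_relation:
  assumes "based a c s d z 0 1 1 K" "based b c t d z 0 1 1 L"
  shows "c dvd of_int (K\<^sup>2 - L\<^sup>2) * a + of_int (2 * (K + L\<^sup>2 + L)) * s"
proof -
  let ?m = "of_int K :: 'k poly" and ?n = "of_int L :: 'k poly"
  have "of_int (K\<^sup>2 - L\<^sup>2) * a + of_int (2 * (K + L\<^sup>2 + L)) * s
    = ((0 + ?m\<^sup>2 * a + 2 * ?m * (s * 1 * 1)) - (0 + ?n\<^sup>2 * b + 2 * ?n * (t * 1 * 1))) + c * (?n\<^sup>2 + 2 * ?n)"
    unfolding reflect by (simp add: algebra_simps)
  then show ?thesis using collision[OF assms] by (metis dvd_add dvd_triv_left)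
qed

lemma two_steps: "- (2 * s * (s - c) - 1) = s * t + c * r" "- (2 * t * (t - c) - 1) = s * t + c * r"
proof -
  have rs: "r = s - a" "r = t - b" "s = c - t" using s_eq t_eq reflect by simp_all
  have "s * t + c * r = 2 * s * (c - s) + (s\<^sup>2 - a * c)"
    unfolding reflect(2) rs(1) by (simp add: square_simps)
  also have "\<dots> = - (2 * s * (s - c) - 1)" unfolding ac[symmetric] by (simp add: algebra_simps)
  finally show "- (2 * s * (s - c) - 1) = s * t + c * r" by simp
  have "s * t + c * r = 2 * t * (c - t) + (t\<^sup>2 - b * c)"
    unfolding rs(3) unfolding rs(2) by (simp add: square_simps)
  also have "\<dots> = - (2 * t * (t - c) - 1)" unfolding bc[symmetric] by (simp add: algebra_simps)
  finally show "- (2 * t * (t - c) - 1) = s * t + c * r" by simp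
qed

text \<open>Two steps back from \<open>0\<close> lead to the larger regular extension; the same holds in the other chain.\<close>

lemma zero_base_steps:
  assumes "based a c s d z 0 1 1 K"
  shows "K \<noteq> 0" "K \<noteq> - 2"
proof -
  show "K \<noteq> 0" using based_zero assms z_not_base(1) by fastforce
  show "K \<noteq> - 2"
  proof
    assume "K = - 2"
    then have "z\<^sup>2 = (2 * s * (s - c) - 1)\<^sup>2"
      using assms unfolding based_def chain_def by (simp add: numeral_2_eq_2)
    then show False using not_regular(1) two_steps(1) by (metis power2_minus)
  qed
qed

lemma zero_base_steps_b:
  assumes "based b c t d z 0 1 1 L"
  shows "L \<noteq> 0" "L \<noteq> - 2"
proof -
  show "L \<noteq> 0" using based_zero assms z_not_base(1) by fastforce
  show "L \<noteq> - 2"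
  proof
    assume "L = - 2"
    then have "z\<^sup>2 = (2 * t * (t - c) - 1)\<^sup>2"
      using assms unfolding based_def chain_def by (simp add: numeral_2_eq_2)
    then show False using not_regular(1) two_steps(2) by (metis power2_minus)
  qed
qed

end

locale tight_small_triple = tight_triple +
  assumes small: "degree a < degree c"
begin

lemma degree_s_bounds: "degree a < degree s" "degree s < degree c"
  using A.degree_s small by auto

lemma deg_lt: "degree a < degree c" "degree s < degree c"
  using small degree_s_bounds by auto

lemma no_zero_zero:
  assumes A: "based a c s d z 0 1 1 K" and B: "based b c t d z 0 1 1 L"
  shows False
proof -
  let ?e = "of_int (K\<^sup>2 - L\<^sup>2) * a + of_int (2 * (K + L\<^sup>2 + L)) * s"
  have "c dvd ?e - 0" using zero_base_relation[OF A B] by simp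
  then have e: "?e = 0"
  proof (rule eq_of_dvd_degree_less)
    show "degree ?e < degree c" by (intro degree_less_intros deg_lt)
    show "degree (0 :: 'a poly) < degree c" using deg_c by simp
  qed
  have "of_int (2 * (K + L\<^sup>2 + L)) * s = of_int (- (K\<^sup>2 - L\<^sup>2)) * a"
    using e by (simp add: eq_neg_iff_add_eq_0 algebra_simps)
  then have 1: "2 * (K + L\<^sup>2 + L) = 0"
    using of_int_times_dominates degree_of_int_mult_less[OF degree_s_bounds(1)] by blast
  have "of_int (K\<^sup>2 - L\<^sup>2) * a = 0" using e unfolding 1 by simp
  then have "of_int (K\<^sup>2 - L\<^sup>2) = (0 :: 'a poly)" using nonzero(1) by (metis mult_eq_0_iff)
  then have "K\<^sup>2 = L\<^sup>2" by (simp only: of_int_eq_0_iff right_minus_eq)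
  then show False using tight_relation[of K L] 1 zero_base_steps_b[OF B] by simp
qed

text \<open>As \<open>degree a < degree s < degree c\<close>, the coefficient of \<open>s\<close> in every collision vanishes.\<close>

lemma s_determined:
  assumes rel: "c dvd P + of_int K * s - Q" and "degree P \<le> degree a" "degree Q \<le> degree a"
  shows "K = 0"
proof -
  have "c dvd (P + of_int K * s) - Q" using rel by simp
  then have "P + of_int K * s = Q"
    by (rule eq_of_dvd_degree_less) (use assms(2,3) deg_lt in \<open>auto intro!: degree_add_less degree_of_int_mult_less\<close>)
  then have "of_int K * s = Q - P" by (simp add: algebra_simps)
  moreover have "degree (Q - P) < degree s"
    using assms(2,3) degree_s_bounds by (intro degree_diff_less) auto
  ultimately show ?thesis by (rule of_int_times_dominates)
qed

lemma contradiction: False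
proof -
  have sws: "s * w * s = w + c * (a * w)" for w
  proof -
    have "s * w * s = s\<^sup>2 * w" by (simp add: power2_eq_square)
    then show ?thesis unfolding ac[symmetric] by (simp add: algebra_simps)
  qed
  have trs: "2 * (t * r * s) = 2 * a - 2 * s + c * (2 + 2 * a * b)"
  proof -
    have "2 * (t * r * s) = (a + b) + c + 2 * a * b * c" using twice_rst by (simp add: ac_simps)
    also have "a + b = c + 2 * a - 2 * s" using reflect(1) by simp
    finally show ?thesis by (simp add: algebra_simps)
  qed
  have trs': "2 * N * (t * r * s) = N * (2 * a - 2 * s + c * (2 + 2 * a * b))" for N
    unfolding trs[symmetric] by simp
  have lek: "degree ((of_int K)\<^sup>2 * a) \<le> degree a" for K :: int
    using degree_of_int_mult_le[of a "degree a" "K\<^sup>2"] by simp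
  have lew: "degree (2 * of_int K * w) \<le> degree a" if "degree w = 0" for K :: int and w :: "'a poly"
    using degree_of_int_mult_le[of w "degree a" "2 * K"] that by simp
  have ca: "c * a + 1 = s\<^sup>2" using ac by (simp add: mult.commute)
  have const_zero_base: "L = - 1 \<or> L = 0" if a0: "degree a = 0" and w: "a * a + 1 = w\<^sup>2"
    and A: "based a c s d z a s w K" and B: "based b c t d z 0 1 1 L" for w K L
  proof -
    let ?m = "of_int K :: 'a poly" and ?n = "of_int L :: 'a poly"
    have "(a + ?m\<^sup>2 * a + 2 * ?m * w) + of_int (2 * (L\<^sup>2 + L)) * s - (?n\<^sup>2 * a)
        = ((a + ?m\<^sup>2 * a + 2 * ?m * (s * w * s)) - (0 + ?n\<^sup>2 * b + 2 * ?n * (t * 1 * 1)))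
          + c * (?n\<^sup>2 + 2 * ?n - 2 * ?m * a * w)"
      unfolding sws reflect by (simp add: algebra_simps)
    then have "c dvd (a + ?m\<^sup>2 * a + 2 * ?m * w) + of_int (2 * (L\<^sup>2 + L)) * s - (?n\<^sup>2 * a)"
      using collision[OF A B] by (metis dvd_add dvd_triv_left)
    then have "2 * (L\<^sup>2 + L) = 0"
      by (rule s_determined)
        (use degree_add_le[OF degree_add_le[OF order_refl lek[of K]] lew[OF const_root[OF a0 w], of K]] lek[of L] in simp_all)
    then have "L * (L + 1) = 0" by (simp add: square_simps)
    then show ?thesis by auto
  qed
  show False
  proof (cases rule: joint_resolution)
    case (common e u v w K L)
    from common_base_tight[OF common(1-8)] show False
    proof
      assume 1: "e = 0"
      then have "w\<^sup>2 = 1\<^sup>2" "u\<^sup>2 = 1\<^sup>2" "v\<^sup>2 = 1\<^sup>2" using common(5-7) by simp_all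
      then show False using based_rebase[OF common(11)] based_rebase[OF common(12)] no_zero_zero unfolding 1 by blast
    next
      assume 2: "e = a \<and> degree a = 0"
      then have o: "w\<^sup>2 = s\<^sup>2" "v\<^sup>2 = r\<^sup>2" "a * a + 1 = u\<^sup>2" using common(5-7) ca ab by (simp_all add: mult.commute)
      have du: "degree u = 0" using const_root[OF _ o(3)] 2 by simp
      obtain L' where L': "even L'" "based b c t d z a s r L'"
        using based_rebase[OF common(12) o(1,2)] common(10) 2 by blast
      obtain K' where K': "based a c s d z a s u K'" using based_rebase[OF common(11) o(1) refl] 2 by blast
      let ?m = "of_int K' :: 'a poly" and ?n = "of_int L' :: 'a poly"
      have "(?m\<^sup>2 * a + 2 * ?m * u) + of_int (2 * (L'\<^sup>2 + L')) * s - ((?n\<^sup>2 + 2 * ?n) * a)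
        = ((a + ?m\<^sup>2 * a + 2 * ?m * (s * u * s)) - (a + ?n\<^sup>2 * b + 2 * ?n * (t * r * s)))
          + c * (?n\<^sup>2 + ?n * (2 + 2 * a * b) - 2 * ?m * a * u)"
        unfolding sws trs' reflect(1) by (simp add: algebra_simps)
      then have "c dvd (?m\<^sup>2 * a + 2 * ?m * u) + of_int (2 * (L'\<^sup>2 + L')) * s - ((?n\<^sup>2 + 2 * ?n) * a)"
        using collision[OF K' L'(2)] by (metis dvd_add dvd_triv_left)
      then have "2 * (L'\<^sup>2 + L') = 0"
        by (rule s_determined)
          (use degree_add_le[OF lek[of K'] lew[OF du, of K']] degree_of_int_mult_le[of a "degree a" "L'\<^sup>2 + 2 * L'"] in simp_all)
      then have "L' * (L' + 1) = 0" by (simp add: square_simps)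
      then have "L' = 0" using L'(1) by auto
      then show False using L'(2) based_zero z_not_base(2) by fastforce
    qed
  next
    case (even_zero e u w K L)
    have "c dvd w - s \<or> c dvd w + s"
    proof -
      have "c dvd (w - t) + c \<or> c dvd (w + t) - c" using even_zero(4) by (metis dvd_add dvd_diff dvd_refl)
      then show ?thesis unfolding reflect(2) by (simp add: algebra_simps) blast
    qed
    note e = base_of_residue[OF ca even_zero(2) this deg_lt(2) even_zero(3)]
    have u: "a * a + 1 = u\<^sup>2" using even_zero(1) e(1) by simp
    obtain K' where "based a c s d z a s u K'" using based_rebase[OF even_zero(7) e(2) refl] e(1) by blast
    then have "L = - 1" using const_zero_base[OF _ u _ even_zero(8)] self_product_succ_square[OF u] even_zero(6) by auto
    then have "z\<^sup>2 = (t - c)\<^sup>2" using even_zero(8) unfolding based_def chain_def by simp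
    then show False using z_not_base(2) unfolding reflect(2) by (simp add: power2_commute)
  next
    case (zero_even e v w K L)
    note e = base_of_residue[OF ca zero_even(2,4) deg_lt(2) zero_even(3)]
    have "v\<^sup>2 = r\<^sup>2" using zero_even(1) ab e(1) by (simp add: mult.commute)
    then obtain L' where L': "based b c t d z a s r L'"
      using based_rebase[OF zero_even(8) e(2)] unfolding e(1) by blast
    let ?m = "of_int K :: 'a poly" and ?n = "of_int L' :: 'a poly"
    have "?m\<^sup>2 * a + of_int (2 * (K + L'\<^sup>2 + L')) * s - of_int (1 + L'\<^sup>2 + 2 * L') * a
      = ((0 + ?m\<^sup>2 * a + 2 * ?m * (s * 1 * 1)) - (a + ?n\<^sup>2 * b + 2 * ?n * (t * r * s)))
        + c * (?n\<^sup>2 + ?n * (2 + 2 * a * b))"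
      unfolding trs' reflect(1) by (simp add: algebra_simps)
    then have "c dvd ?m\<^sup>2 * a + of_int (2 * (K + L'\<^sup>2 + L')) * s - of_int (1 + L'\<^sup>2 + 2 * L') * a"
      using collision[OF zero_even(7) L'] by (metis dvd_add dvd_triv_left)
    then have "2 * (K + L'\<^sup>2 + L') = 0"
      by (rule s_determined[OF _ lek degree_of_int_mult_le[OF order_refl]])
    then have "K = - (L'\<^sup>2 + L')" by simp
    then have "even K" by simp
    then show False using zero_even(5) by simp
  next
    case (zero_zero K L)
    then show False using no_zero_zero by blast
  next
    case (const_zero w K L)
    have "even L"
    proof (rule ccontr)
      assume "odd L"
      then have "c dvd 1 - t \<or> c dvd 1 + t" using const_zero(4) by blast
      moreover have "1 - t = (1 + s) - c" "1 + t = (1 - s) + c" unfolding reflect(2) by simp_all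
      ultimately have "c dvd 1 - (- s) \<or> c dvd 1 - s" by (simp add: dvd_diff_left_iff)
      then have "1 = - s \<or> 1 = s"
        using eq_of_dvd_degree_less[of c 1 "- s"] eq_of_dvd_degree_less[of c 1 s] deg_lt deg_c by auto
      then have "degree s = 0" by (metis degree_1 degree_minus)
      then show False using A.degree_s(2) by auto
    qed
    then have "L = 0" using const_zero_base[OF const_zero(1,2,5,6)] by auto
    then show False using zero_base_steps_b(1)[OF const_zero(6)] by simp
  qed
qed

end

lemma degree_const_mult_add:
  fixes c v :: "'k::field_char_0 poly"
  assumes "degree v < degree c"
  shows "degree ([:p:] * c + v) = (if p = 0 then degree v else degree c)"
  using assms by (simp add: degree_add_eq_left)

lemma minus_one_ne_two: "(- 1 :: 'k::field_char_0) \<noteq> 2"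
proof
  assume "(- 1 :: 'k) = 2"
  then have "of_int (- 1) = (of_int 2 :: 'k)" by simp
  then show False by (simp only: of_int_eq_iff)
qed

text \<open>Using \<open>g c = \<sigma>\<^sup>2 - 1\<close>, one finds \<open>a g + 1 = (\<kappa> \<sigma> + g)\<^sup>2 + (1 - \<kappa>\<^sup>2)\<close>, and the rigidity of squares applies.\<close>

lemma constant_multiple_base:
  fixes a c g u \<sigma> :: "'k::field_char_0 poly"
  assumes a: "a = [:\<kappa>:]\<^sup>2 * c + 2 * [:\<kappa>:] * \<sigma> + g" and gc: "g * c = \<sigma>\<^sup>2 - 1" and dg: "degree g < degree \<sigma>"
    and \<kappa>: "\<kappa> \<noteq> 0" and u: "a * g + 1 = u\<^sup>2"
  shows "\<kappa>\<^sup>2 = 1" "u\<^sup>2 = ([:\<kappa>:] * \<sigma> + g)\<^sup>2"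
proof -
  define k where "k = [:\<kappa>:]"
  have "a * g + 1 = k\<^sup>2 * (g * c) + 2 * k * \<sigma> * g + g\<^sup>2 + 1"
    unfolding a k_def[symmetric] by (simp add: square_simps)
  also have "\<dots> = 1 * (k * \<sigma> + g)\<^sup>2 + (1 - k\<^sup>2)" unfolding gc by (simp add: square_simps)
  finally have e: "1 * (k * \<sigma> + g)\<^sup>2 + (1 - k\<^sup>2) = u\<^sup>2" using u by simp
  have "degree (k * \<sigma> + g) = degree \<sigma>"
    using degree_const_mult_add[OF dg] \<kappa> by (simp add: k_def)
  then have "degree (k * \<sigma> + g) \<noteq> 0" using dg by simp
  then have k0: "1 - k\<^sup>2 = 0"
    using square_shift_const[OF e] by (auto simp: k_def power2_eq_square one_pCons)
  then have "[:1 - \<kappa>\<^sup>2:] = 0" unfolding const_simps k_def by simp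
  then show "\<kappa>\<^sup>2 = 1" by simp
  show "u\<^sup>2 = ([:\<kappa>:] * \<sigma> + g)\<^sup>2" using e k0 unfolding k_def by simp
qed

text \<open>With \<open>g c = \<sigma>\<^sup>2 - 1\<close> the collision reduces to a congruence between \<open>\<sigma>\<close> and \<open>g\<close>.  The coefficient of \<open>\<sigma>\<close>
  must vanish, that is, \<open>2 L\<^sup>2 + L = K\<^sup>2 - K\<close>, which is impossible for odd \<open>L\<close>.\<close>

lemma parity_clash:
  fixes c g \<sigma> :: "'k::field_char_0 poly" and K L :: int
  assumes g: "g * c = \<sigma>\<^sup>2 - 1" and dg: "degree g < degree \<sigma>" and d\<sigma>: "degree \<sigma> < degree c" and "odd L"
    and dvd: "c dvd (g + (of_int K)\<^sup>2 * (c - 2 * \<sigma> + g) + 2 * of_int K * ((\<sigma> - c) * (\<sigma> - g) * \<sigma>))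
      - ((of_int L)\<^sup>2 * (4 * c - 4 * \<sigma> + g) + 2 * of_int L * (2 * c - \<sigma>))"
  shows False
proof -
  let ?m = "of_int K :: 'k poly" and ?n = "of_int L :: 'k poly"
  have h: "2 * ?m * ((\<sigma> - c) * (\<sigma> - g) * \<sigma>)
    = 2 * ?m * (\<sigma> - g) + c * (2 * ?m * ((\<sigma> - g) * g - (\<sigma> - g) * \<sigma>))"
  proof -
    have h1: "(\<sigma> - c) * (\<sigma> - g) * \<sigma> = g * c * (\<sigma> - g) + (\<sigma> - g) - c * (\<sigma> - g) * \<sigma>"
      unfolding g by (simp add: square_simps)
    show ?thesis unfolding h1 by (simp add: algebra_simps)
  qed
  have "of_int (4 * L\<^sup>2 + 2 * L - 2 * K\<^sup>2 + 2 * K) * \<sigma> - of_int (L\<^sup>2 - 1 - K\<^sup>2 + 2 * K) * g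
    = ((g + ?m\<^sup>2 * (c - 2 * \<sigma> + g) + 2 * ?m * ((\<sigma> - c) * (\<sigma> - g) * \<sigma>))
      - (?n\<^sup>2 * (4 * c - 4 * \<sigma> + g) + 2 * ?n * (2 * c - \<sigma>)))
      - c * (?m\<^sup>2 + 2 * ?m * ((\<sigma> - g) * g - (\<sigma> - g) * \<sigma>) - 4 * ?n\<^sup>2 - 4 * ?n)"
    unfolding h by (simp add: algebra_simps)
  then have "c dvd of_int (4 * L\<^sup>2 + 2 * L - 2 * K\<^sup>2 + 2 * K) * \<sigma> - of_int (L\<^sup>2 - 1 - K\<^sup>2 + 2 * K) * g"
    using dvd by (metis dvd_diff dvd_triv_left)
  then have "of_int (4 * L\<^sup>2 + 2 * L - 2 * K\<^sup>2 + 2 * K) * \<sigma> = of_int (L\<^sup>2 - 1 - K\<^sup>2 + 2 * K) * g"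
    by (rule eq_of_dvd_degree_less) (use dg d\<sigma> in \<open>auto intro!: degree_of_int_mult_less simp del: of_int_add of_int_diff of_int_mult of_int_power\<close>)
  then have "4 * L\<^sup>2 + 2 * L - 2 * K\<^sup>2 + 2 * K = 0"
    using of_int_times_dominates degree_of_int_mult_less[OF dg] by blast
  then have "2 * L\<^sup>2 + L = K\<^sup>2 - K" by linarith
  moreover have "even (K\<^sup>2 - K)" by simp
  moreover have "odd (2 * L\<^sup>2 + L)" using \<open>odd L\<close> by simp
  ultimately show False by simp
qed

text \<open>If \<open>degree a = degree c\<close> too, \<open>s\<close> and \<open>a\<close> have the degree of \<open>c\<close> and are not reduced.  Division by \<open>c\<close> gives
  the remainders \<open>\<sigma>\<close> of \<open>s\<close> and, up to a multiple of \<open>\<sigma>\<close>, \<open>g\<close> of \<open>a\<close>; the equation \<open>a c + 1 = s\<^sup>2\<close> turns into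
  \<open>g c + 1 = \<sigma>\<^sup>2\<close>.  So \<open>g\<close> is a further partner of \<open>c\<close>, and it takes the part that \<open>a\<close> has as a base in the
  other cases.\<close>

locale tight_balanced_triple = tight_triple S a b c d r s t x y z
  for S :: "'k::field_char_0 poly set" and a b c d r s t x y z +
  fixes \<kappa> :: 'k and \<sigma> g :: "'k poly"
  assumes bal: "degree a = degree c"
    and s_dec: "s = [:\<kappa>:] * c + \<sigma>" and degree_sigma: "degree \<sigma> < degree c"
    and a_dec: "a = [:\<kappa>:]\<^sup>2 * c + 2 * [:\<kappa>:] * \<sigma> + g"
begin

lemma degree_roots: "degree s = degree c" "degree t = degree c"
  using A.degree_s B.degree_s bal deg_bc by auto

lemma kappa_nz: "\<kappa> \<noteq> 0"
  using degree_roots(1) degree_sigma s_dec by auto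

lemma t_dec: "t = [:1 - \<kappa>:] * c - \<sigma>"
  unfolding reflect(2) const_simps s_dec by (simp add: left_diff_distrib)

lemma kappa_ne_one: "\<kappa> \<noteq> 1"
proof
  assume "\<kappa> = 1"
  then have "t = - \<sigma>" using t_dec by simp
  then show False using degree_roots(2) degree_sigma by simp
qed

lemma b_dec: "b = [:1 - \<kappa>:]\<^sup>2 * c - 2 * [:1 - \<kappa>:] * \<sigma> + g"
proof -
  define k where "k = [:\<kappa>:]"
  have "b = c + (k\<^sup>2 * c + 2 * k * \<sigma> + g) - 2 * (k * c + \<sigma>)"
    using reflect(1) unfolding a_dec s_dec k_def .
  then show ?thesis unfolding const_simps k_def[symmetric] by (simp add: square_simps)
qed

lemma g_c: "g * c = \<sigma>\<^sup>2 - 1"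
proof -
  define k where "k = [:\<kappa>:]"
  have "(k\<^sup>2 * c + 2 * k * \<sigma> + g) * c + 1 = (k * c + \<sigma>)\<^sup>2"
    using ac a_dec s_dec unfolding k_def by simp
  then show ?thesis by (simp add: square_simps)
qed

lemma degree_g: "g \<noteq> 0 \<Longrightarrow> degree g < degree \<sigma>"
proof -
  assume "g \<noteq> 0"
  then have "degree g + degree c = degree (\<sigma>\<^sup>2 - 1)" using g_c nonzero by (metis degree_mult_eq)
  also have "\<dots> \<le> 2 * degree \<sigma>" using degree_power_le[of \<sigma> 2] by (intro degree_diff_le) auto
  finally show ?thesis using degree_sigma by simp
qed

lemma degree_g_less: "degree g < degree c"
  using degree_g degree_sigma deg_c by (cases "g = 0") auto

text \<open>The collision is an equation between multiples of \<open>\<sigma>\<close> and \<open>g\<close>.  For \<open>g \<noteq> 0\<close> both multiples vanish, as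
  \<open>degree g < degree \<sigma>\<close>.  For \<open>g = 0\<close> one has \<open>\<sigma> = \<plusminus>1\<close>, and a single equation involving \<open>\<kappa>\<close> is left.  In
  this case the degree of \<open>z\<close> relates \<open>\<bar>K\<bar>\<close> and \<open>\<bar>L\<bar>\<close>; the values \<open>\<kappa> = - 1\<close> and \<open>\<kappa> = 2\<close> are special
  because the first step of one chain then loses its leading term.\<close>

lemma no_zero_zero:
  assumes A: "based a c s d z 0 1 1 K" and B: "based b c t d z 0 1 1 L"
  shows False
proof -
  define E F where "E = K\<^sup>2 - L\<^sup>2" and "F = K + L\<^sup>2 + L"
  define k where "k = [:\<kappa>:]"
  let ?C = "[:2 * (of_int E * \<kappa> + of_int F):]"
  have C: "?C = 2 * (of_int E * k + of_int F)" unfolding const_simps k_def ..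
  have "c dvd (of_int E * a + of_int (2 * F) * s) - c * (of_int E * k\<^sup>2 + 2 * of_int F * k)"
    using zero_base_relation[OF A B] unfolding E_def F_def by (intro dvd_diff) auto
  also have "(of_int E * a + of_int (2 * F) * s) - c * (of_int E * k\<^sup>2 + 2 * of_int F * k) = ?C * \<sigma> - of_int (- E) * g"
  proof -
    have "a = k\<^sup>2 * c + 2 * k * \<sigma> + g" "s = k * c + \<sigma>" using a_dec s_dec unfolding k_def by auto
    then show ?thesis unfolding C by (simp add: algebra_simps)
  qed
  finally have eq: "?C * \<sigma> = of_int (- E) * g"
    by (rule eq_of_dvd_degree_less)
      (use degree_sigma degree_g_less in \<open>auto intro!: degree_of_int_mult_less degree_const_mult_less simp del: of_int_minus mult_pCons_left\<close>)
  note stepsA = zero_base_steps[OF A] and stepsB = zero_base_steps_b[OF B]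
  show False
  proof (cases "g = 0")
    case False
    have "of_int E * \<kappa> + of_int F = 0"
    proof (rule ccontr)
      assume "of_int E * \<kappa> + of_int F \<noteq> 0"
      then have "2 * (of_int E * \<kappa> + of_int F) \<noteq> 0" by (metis mult_eq_0_iff zero_neq_numeral)
      then have "degree (?C * \<sigma>) = degree \<sigma>" by (simp only: mult_pCons_left) simp
      moreover have "degree (of_int (- E) * g) < degree \<sigma>"
        by (rule degree_of_int_mult_less[OF degree_g[OF False]])
      ultimately show False unfolding eq by simp
    qed
    moreover from this have "E = 0" using eq False by simp
    ultimately have "F = 0" by simp
    then show False using \<open>E = 0\<close> tight_relation[of K L] stepsB by (simp add: E_def F_def)
  next
    case True
    then have \<sigma>2: "\<sigma>\<^sup>2 = 1" using g_c by simp
    then have \<sigma>1: "\<sigma> = 1 \<or> \<sigma> = -1" by (simp add: power2_eq_1_iff)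
    have "?C * \<sigma> = 0" unfolding eq True by simp
    moreover have "\<sigma> \<noteq> 0" using \<sigma>1 by auto
    ultimately have "?C = 0" by (metis mult_eq_0_iff)
    then have "2 * (of_int E * \<kappa> + of_int F) = 0" by (simp only: pCons_eq_0_iff)
    then have "of_int E * \<kappa> + of_int F = 0" by (metis mult_eq_0_iff zero_neq_numeral)
    then have rel: "(of_int (K\<^sup>2) - of_int (L\<^sup>2)) * \<kappa> + of_int (K + L\<^sup>2 + L) = 0" by (simp add: E_def F_def)
    have len: "int (degree z) = int (degree q) + (\<bar>M\<bar> - 1) * int (degree c)"
      if "based k' c v d z 0 1 1 M" "M \<noteq> 0" "q = v * 1 + of_int (sgn M) * c * 1" "q \<noteq> 0" "degree v = degree c" for k' v q M
      using based_degree[OF that(1-4)] that(5) deg_c by auto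
    have qA: "s * 1 + of_int (sgn K) * c * 1 = [:\<kappa> + of_int (sgn K):] * c + \<sigma>"
      unfolding const_simps s_dec by (simp add: distrib_right)
    have qB: "t * 1 + of_int (sgn L) * c * 1 = [:1 - \<kappa> + of_int (sgn L):] * c + (- \<sigma>)"
      unfolding t_dec const_simps by (simp add: left_diff_distrib distrib_right)
    have d\<sigma>: "degree \<sigma> = 0" "degree (- \<sigma>) = 0" "\<sigma> \<noteq> 0" using \<sigma>1 by auto
    have dA: "degree (s * 1 + of_int (sgn K) * c * 1) = (if \<kappa> + of_int (sgn K) = 0 then 0 else degree c)"
      unfolding qA using degree_const_mult_add[OF degree_sigma] d\<sigma>(1) by simp
    have dB: "degree (t * 1 + of_int (sgn L) * c * 1) = (if 1 - \<kappa> + of_int (sgn L) = 0 then 0 else degree c)"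
      unfolding qB using degree_const_mult_add[of "- \<sigma>" c] degree_sigma d\<sigma>(2) by simp
    have nA: "s * 1 + of_int (sgn K) * c * 1 \<noteq> 0"
      using dA qA d\<sigma>(3) deg_c by (cases "\<kappa> + of_int (sgn K) = 0") auto
    have nB: "t * 1 + of_int (sgn L) * c * 1 \<noteq> 0"
      using dB qB d\<sigma>(3) deg_c by (cases "1 - \<kappa> + of_int (sgn L) = 0") auto
    have lA: "int (degree z) = (if \<kappa> = -1 \<and> K > 0 then K - 1 else \<bar>K\<bar>) * int (degree c)"
    proof -
      have "\<kappa> + of_int (sgn K) = 0 \<longleftrightarrow> \<kappa> = -1 \<and> K > 0"
        using kappa_ne_one stepsA(1) by (auto simp: sgn_if eq_neg_iff_add_eq_0)
      then show ?thesis using len[OF A stepsA(1) refl nA degree_roots(1)] dA by (auto simp: algebra_simps)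
    qed
    have lB: "int (degree z) = (if \<kappa> = 2 \<and> L > 0 then L - 1 else \<bar>L\<bar>) * int (degree c)"
    proof -
      have "1 - \<kappa> + of_int (sgn L) = 0 \<longleftrightarrow> \<kappa> = 2 \<and> L > 0"
        using kappa_nz stepsB(1) by (auto simp: sgn_if)
      then show ?thesis using len[OF B stepsB(1) refl nB degree_roots(2)] dB by (auto simp: algebra_simps)
    qed
    have KL: "(if \<kappa> = -1 \<and> K > 0 then K - 1 else \<bar>K\<bar>) = (if \<kappa> = 2 \<and> L > 0 then L - 1 else \<bar>L\<bar>)"
      using lA lB deg_c by simp
    consider "\<kappa> = -1" "K > 0" | "\<kappa> = 2" "L > 0" | "\<bar>K\<bar> = \<bar>L\<bar>"
      using KL by (auto split: if_splits)
    then show False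
    proof cases
      case 1
      have "(- 1 :: 'k) \<noteq> 2" by (rule minus_one_ne_two)
      then have L: "L = K - 1 \<or> L = 1 - K" using KL 1 by (auto split: if_splits)
      have "of_int (- (K\<^sup>2 - L\<^sup>2) + (K + L\<^sup>2 + L)) = (of_int 0 :: 'k)" using rel 1 by simp
      then have e: "- (K\<^sup>2 - L\<^sup>2) + (K + L\<^sup>2 + L) = 0" by (simp only: of_int_eq_iff)
      show False
      proof (cases "L = K - 1")
        case True
        have "(K - 1) * (K - 1) = 0" using e unfolding True by (simp add: square_simps)
        then show False using True stepsB(1) by simp
      next
        case False
        then have L': "L = 1 - K" using L by simp
        have "(K - 1) * (K - 3) = 0" using e unfolding L' by (simp add: square_simps)
        then show False using L' stepsB by auto
      qed
    next
      case 2
      have "of_int (2 * (K\<^sup>2 - L\<^sup>2) + (K + L\<^sup>2 + L)) = (of_int 0 :: 'k)" using rel 2 by (simp add: mult.commute)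
      then have e: "2 * (K\<^sup>2 - L\<^sup>2) + (K + L\<^sup>2 + L) = 0" by (simp only: of_int_eq_iff)
      have ne: "(2 :: 'k) \<noteq> -1" by (metis minus_one_ne_two)
      then have K: "K = L - 1 \<or> K = 1 - L" using KL 2 by (auto split: if_splits)
      show False
      proof (cases "K = L - 1")
        case True
        have "(L - 1) * (L - 1) = 0" using e unfolding True by (simp add: square_simps)
        then show False using True stepsA(1) by simp
      next
        case False
        then have K': "K = 1 - L" using K by simp
        have "(L - 1) * (L - 3) = 0" using e unfolding K' by (simp add: square_simps)
        then show False using K' stepsA by auto
      qed
    next
      case 3
      then have sq: "K\<^sup>2 = L\<^sup>2" by (metis power2_abs)
      then have "of_int (K + L\<^sup>2 + L) = (of_int 0 :: 'k)" using rel by simp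
      then have "K + L\<^sup>2 + L = 0" by (simp only: of_int_eq_iff)
      then show False using tight_relation[OF sq] stepsB by simp
    qed
  qed
qed

lemma g_base:
  assumes "a * g + 1 = u\<^sup>2" "g \<noteq> 0"
  shows "\<kappa> = - 1" "u\<^sup>2 = (\<sigma> - g)\<^sup>2"
  using constant_multiple_base[OF a_dec g_c degree_g[OF assms(2)] kappa_nz assms(1)] kappa_ne_one
  by (auto simp: power2_eq_1_iff power2_commute)

lemma g_base_b:
  assumes "b * g + 1 = u\<^sup>2" "g \<noteq> 0"
  shows "\<kappa> = 2" "u\<^sup>2 = (- \<sigma> - g)\<^sup>2"
proof -
  have *: "b = [:1 - \<kappa>:]\<^sup>2 * c + 2 * [:1 - \<kappa>:] * (- \<sigma>) + g" "g * c = (- \<sigma>)\<^sup>2 - 1" "degree g < degree (- \<sigma>)" "1 - \<kappa> \<noteq> 0"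
    using b_dec g_c degree_g[OF assms(2)] kappa_ne_one by simp_all
  note k = constant_multiple_base[OF * assms(1)]
  have "1 - \<kappa> = - 1" using k(1) kappa_nz by (auto simp: power2_eq_1_iff)
  then show "\<kappa> = 2" by (simp add: algebra_simps)
  show "u\<^sup>2 = (- \<sigma> - g)\<^sup>2" using k(2) \<open>1 - \<kappa> = - 1\<close> by (simp add: square_simps)
qed

lemma contradiction: False
proof -
  have a0: "degree a \<noteq> 0" using bal deg_c by simp
  have cg: "c * g + 1 = \<sigma>\<^sup>2" using g_c by (simp add: mult.commute)
  have sigma: "c dvd w - \<sigma> \<or> c dvd w + \<sigma>" if "c dvd w - s \<or> c dvd w + s" for w
  proof -
    have "c dvd s - \<sigma> \<or> c dvd s + \<sigma>" unfolding s_dec by (simp del: mult_pCons_left)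
    moreover have "c dvd s - w \<or> c dvd s + w" using that by (metis add.commute dvd_minus_iff minus_diff_eq)
    moreover have "(s - \<sigma>) - (s - w) = w - \<sigma>" "(s - \<sigma>) - (s + w) = - (w + \<sigma>)"
      "(s + \<sigma>) - (s - w) = w + \<sigma>" "(s + \<sigma>) - (s + w) = - (w - \<sigma>)" by simp_all
    ultimately show ?thesis by (metis dvd_diff dvd_minus_iff)
  qed
  show False
  proof (cases rule: joint_resolution)
    case (common e u v w K L)
    have e: "e = 0" using common_base_tight[OF common(1-8)] a0 by simp
    then have "w\<^sup>2 = 1\<^sup>2" "u\<^sup>2 = 1\<^sup>2" "v\<^sup>2 = 1\<^sup>2" using common(5-7) by simp_all
    then show False using based_rebase[OF common(11)] based_rebase[OF common(12)] no_zero_zero unfolding e by blast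
  next
    case (even_zero e u w K L)
    have "c dvd (w - t) + c \<or> c dvd (w + t) - c" using even_zero(4) by (metis dvd_add dvd_diff dvd_refl)
    then have "c dvd w - s \<or> c dvd w + s" unfolding reflect(2) by (simp add: algebra_simps) blast
    note e = base_of_residue[OF cg even_zero(2) sigma[OF this] degree_sigma even_zero(3)]
    show False
    proof (cases "g = 0")
      case True
      then have "w\<^sup>2 = 1\<^sup>2" "u\<^sup>2 = 1\<^sup>2" using even_zero(1,2) e(1) by simp_all
      then show False using based_rebase[OF even_zero(7)] no_zero_zero[OF _ even_zero(8)] e(1) True by blast
    next
      case False
      have ag: "a * g + 1 = u\<^sup>2" using even_zero(1) e(1) by simp
      note gb = g_base[OF ag False]
      have k: "[:\<kappa>:] = (- 1 :: 'k poly)" "[:1 - \<kappa>:] = (2 :: 'k poly)" using gb(1) by (simp_all add: one_pCons numeral_poly)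
      have dec: "a = c - 2 * \<sigma> + g" "s = \<sigma> - c" "b = 4 * c - 4 * \<sigma> + g" "t = 2 * c - \<sigma>"
        using a_dec s_dec b_dec t_dec unfolding k by simp_all
      obtain K' where K': "based a c s d z g \<sigma> (\<sigma> - g) K'" using based_rebase[OF even_zero(7) e(2) gb(2)] e(1) by blast
      have "c dvd (g + (of_int K')\<^sup>2 * (c - 2 * \<sigma> + g) + 2 * of_int K' * ((\<sigma> - c) * (\<sigma> - g) * \<sigma>))
        - ((of_int L)\<^sup>2 * (4 * c - 4 * \<sigma> + g) + 2 * of_int L * (2 * c - \<sigma>))"
        using collision[OF K' even_zero(8)] dec by simp
      then show False by (rule parity_clash[OF g_c degree_g[OF False] degree_sigma even_zero(6)])
    qed
  next
    case (zero_even e v w K L)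
    note e = base_of_residue[OF cg zero_even(2) sigma[OF zero_even(4)] degree_sigma zero_even(3)]
    show False
    proof (cases "g = 0")
      case True
      then have "w\<^sup>2 = 1\<^sup>2" "v\<^sup>2 = 1\<^sup>2" using zero_even(1,2) e(1) by simp_all
      then show False using based_rebase[OF zero_even(8)] no_zero_zero[OF zero_even(7)] e(1) True by blast
    next
      case False
      have bg: "b * g + 1 = v\<^sup>2" using zero_even(1) e(1) by simp
      note gb = g_base_b[OF bg False]
      have k: "[:\<kappa>:] = (2 :: 'k poly)" "[:1 - \<kappa>:] = (- 1 :: 'k poly)" using gb(1) by (simp_all add: one_pCons numeral_poly)
      have dec: "b = c - 2 * (- \<sigma>) + g" "t = - \<sigma> - c" "a = 4 * c - 4 * (- \<sigma>) + g" "s = 2 * c - (- \<sigma>)"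
        using a_dec s_dec b_dec t_dec unfolding k by simp_all
      have w: "w\<^sup>2 = (- \<sigma>)\<^sup>2" using e(2) by simp
      obtain L' where L': "based b c t d z g (- \<sigma>) (- \<sigma> - g) L'" using based_rebase[OF zero_even(8) w gb(2)] e(1) by blast
      have "c dvd - ((0 + (of_int K)\<^sup>2 * a + 2 * of_int K * (s * 1 * 1))
        - (g + (of_int L')\<^sup>2 * b + 2 * of_int L' * (t * (- \<sigma> - g) * (- \<sigma>))))"
        using collision[OF zero_even(7) L'] by (simp only: dvd_minus_iff)
      then have "c dvd (g + (of_int L')\<^sup>2 * b + 2 * of_int L' * (t * (- \<sigma> - g) * (- \<sigma>)))
        - ((of_int K)\<^sup>2 * a + 2 * of_int K * s)" by simp
      then have "c dvd (g + (of_int L')\<^sup>2 * (c - 2 * (- \<sigma>) + g) + 2 * of_int L' * ((- \<sigma> - c) * (- \<sigma> - g) * (- \<sigma>)))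
        - ((of_int K)\<^sup>2 * (4 * c - 4 * (- \<sigma>) + g) + 2 * of_int K * (2 * c - (- \<sigma>)))"
        unfolding dec(1)[symmetric] dec(2)[symmetric] dec(3)[symmetric] dec(4)[symmetric] .
      moreover have "g * c = (- \<sigma>)\<^sup>2 - 1" "degree g < degree (- \<sigma>)" "degree (- \<sigma>) < degree c"
        using g_c degree_g[OF False] degree_sigma by simp_all
      ultimately show False using parity_clash zero_even(5) by blast
    qed
  next
    case (zero_zero K L)
    then show False using no_zero_zero by blast
  next
    case const_zero
    then show False using a0 by simp
  qed
qed

end

section \<open>Triples whose smaller regular extension is a constant member\<close>

lemma dvd_transfer:
  fixes c :: "'k::field_char_0 poly"
  assumes "c dvd d - p" "c dvd d - q"
  shows "c dvd p - q"
proof -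
  have "p - q = (d - q) - (d - p)" by simp
  then show ?thesis using dvd_diff[OF assms(2,1)] by metis
qed

text \<open>If the constant \<open>a\<close> is a regular extension of \<open>{a, b, c}\<close>, then \<open>s = \<kappa> r\<close> by \<open>proportional_roots\<close>, and \<open>b\<close> and
  \<open>t\<close> are polynomials in \<open>c\<close>: \<open>b = c / \<kappa>\<^sup>2 - 2 / \<kappa>\<close> and \<open>t = \<plusminus>(c / \<kappa> - 1)\<close>.  In the proofs \<open>j\<close> stands for
  \<open>1 / \<kappa>\<close> and \<open>w\<close> for a root of \<open>a\<^sup>2 + 1\<close>, so that \<open>2 a = k - j\<close> and \<open>2 w = k + j\<close>.\<close>

locale proportional_triple = extended_triple S a b c d r s t x y z
  for S :: "'k::field_char_0 poly set" and a b c d r s t x y z +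
  fixes \<alpha> \<kappa> \<omega> :: 'k
  assumes a_const: "a = [:\<alpha>:]" and kappa_nz: "\<kappa> \<noteq> 0" and kappa: "\<kappa>\<^sup>2 - 1 = 2 * \<alpha> * \<kappa>"
    and omega: "2 * \<kappa> * \<omega> = \<kappa>\<^sup>2 + 1"
    and s_eq: "s = [:\<kappa>:] * r" and deg_bc: "degree b = degree c"
    and nonsquare: "\<And>X Y p. X \<in> S \<Longrightarrow> Y \<in> S \<Longrightarrow> 1 \<le> p \<Longrightarrow> X\<^sup>2 = of_int (5 - 8 * p) * Y\<^sup>2 \<Longrightarrow> Y = 0"
begin

definition k where "k = [:\<kappa>:]"
definition j where "j = [:1 / \<kappa>:]"
definition w where "w = [:\<omega>:]"

lemma jk: "j * k = 1"
  using kappa_nz by (simp add: j_def k_def one_pCons)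

lemma a_half: "2 * a = k - j"
proof -
  have "2 * \<alpha> = \<kappa> - 1 / \<kappa>" using kappa kappa_nz by (simp add: field_simps power2_eq_square)
  then have "[:2 * \<alpha>:] = [:\<kappa> - 1 / \<kappa>:]" by simp
  then show ?thesis unfolding const_simps a_const k_def j_def .
qed

lemma w_half: "2 * w = k + j"
proof -
  have "2 * \<omega> = \<kappa> + 1 / \<kappa>" using omega kappa_nz by (simp add: field_simps power2_eq_square)
  then have "[:2 * \<omega>:] = [:\<kappa> + 1 / \<kappa>:]" by simp
  then show ?thesis unfolding const_simps w_def k_def j_def .
qed

lemma a_w: "a + w = k" "a - w = - j"
proof -
  have "2 * (a + w) = 2 * k" "2 * (a - w) = 2 * (- j)" using a_half w_half by (simp_all add: algebra_simps)
  then show "a + w = k" "a - w = - j" by (metis mult_left_cancel zero_neq_numeral)+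
qed

lemma w_square: "a * a + 1 = w\<^sup>2"
proof -
  have "w\<^sup>2 = a * a - (a + w) * (a - w)" by (simp add: square_simps)
  also have "\<dots> = a * a + j * k" unfolding a_w by (simp add: mult.commute)
  finally show ?thesis unfolding jk by simp
qed

lemma j_square: "j\<^sup>2 - 1 = - (2 * a) * j"
  unfolding a_half using jk by (simp add: square_simps)

lemma s_k: "s = k * r"
  using s_eq by (simp add: k_def)

lemma r_square: "r\<^sup>2 = j\<^sup>2 * (a * c + 1)"
proof -
  have "j\<^sup>2 * (a * c + 1) = (j * k)\<^sup>2 * r\<^sup>2" unfolding ac s_k by (simp add: power_mult_distrib)
  then show ?thesis unfolding jk by simp
qed

lemma b_dec: "b = j\<^sup>2 * c - 2 * j"
proof -
  have "a * b = j\<^sup>2 * (a * c) + (j\<^sup>2 - 1)" using ab r_square by (simp add: algebra_simps)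
  also have "\<dots> = a * (j\<^sup>2 * c - 2 * j)" unfolding j_square by (simp add: algebra_simps)
  finally show ?thesis using nonzero(1) by simp
qed

lemma t_square: "t\<^sup>2 = (j * c - 1)\<^sup>2"
  unfolding bc[symmetric] b_dec by (simp add: square_simps)

end

locale exceptional_triple = proportional_triple S a b c d r s t x y z \<alpha> \<kappa> \<omega>
  for S :: "'k::field_char_0 poly set" and a b c d r s t x y z and \<alpha> \<kappa> \<omega> :: 'k +
  assumes t_eq: "t = [:1 / \<kappa>:] * c - 1"
begin

lemma t_j: "t = j * c - 1"
  using t_eq by (simp add: j_def)

lemma rst_dec: "r * s * t = c * (j\<^sup>2 * a * c + j\<^sup>2 - j * a) - j"
proof -
  have "r * s * t = (j * c - 1) * (k * r\<^sup>2)" unfolding s_k t_j by (simp add: square_simps)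
  also have "k * r\<^sup>2 = (j * k) * j * (a * c + 1)" unfolding r_square by (simp add: square_simps)
  finally show ?thesis unfolding jk by (simp add: square_simps)
qed

lemma lower_is_a: "a + b + c + 2 * a * b * c - 2 * (r * s * t) = a"
proof -
  have "a + b + c + 2 * a * b * c - 2 * (r * s * t) = a - c * (j\<^sup>2 - 1 + 2 * a * j)"
    unfolding rst_dec b_dec by (simp add: algebra_simps)
  then show ?thesis unfolding j_square by simp
qed

lemma degree_consts: "degree a = 0" "degree w = 0" "degree j = 0" "degree k = 0"
  by (simp_all add: a_const w_def j_def k_def)

lemma degree_rst: "2 * degree r = degree c" "2 * degree s = degree c" "degree t = degree c"
  using degree_r(1) A.degree_s(1) B.degree_s(1) degree_consts deg_bc by auto

text \<open>The smaller regular extension is \<open>a\<close>, and the larger one differs from it by \<open>4 r s t\<close> of degree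
  \<open>2 degree c\<close>.\<close>

lemma common_base_exceptional:
  assumes "e \<in> S" "u \<in> S" "v \<in> S" "h \<in> S" "a * e + 1 = u\<^sup>2" "b * e + 1 = v\<^sup>2" "c * e + 1 = h\<^sup>2"
    and lt: "degree h < degree c"
  shows "e = 0 \<or> e = a"
proof (rule ccontr)
  assume no: "\<not> ?thesis"
  have "e = a + b + c + 2 * a * b * c + 2 * (r * s * t)"
    using common_base[OF assms] no lower_is_a by auto
  then have e: "e = a + 4 * (r * s * t)" using lower_is_a by (simp add: algebra_simps)
  have "degree (4 * (r * s * t)) = degree r + degree s + degree t"
    using degree_r(2) A.degree_s(3) B.degree_s(3) by (simp add: degree_mult_eq numeral_poly)
  then have big: "degree (4 * (r * s * t)) = 2 * degree c" using degree_rst by simp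
  then have "degree e = 2 * degree c"
    unfolding e using degree_add_eq_right[of a "4 * (r * s * t)"] degree_consts deg_c by simp
  moreover have "e \<noteq> 0" using no by simp
  ultimately show False
    using degree_root(1)[OF assms(7) nonzero(3)] deg_c lt by auto
qed

lemma sws: "s * w * s = w + c * (a * w)"
proof -
  have "s * w * s = s\<^sup>2 * w" by (simp add: power2_eq_square)
  then show ?thesis unfolding ac[symmetric] by (simp add: algebra_simps)
qed

text \<open>The term \<open>2 K s\<close> is not constant modulo \<open>c\<close>, whereas the other chain makes \<open>d\<close> a constant modulo \<open>c\<close>.\<close>

lemma no_zero_a_side:
  assumes "based a c s d z 0 1 1 K" and "c dvd d - e" "degree e = 0"
  shows False
proof -
  have "c dvd d - (0 + (of_int K)\<^sup>2 * a + 2 * of_int K * (s * 1 * 1))"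
    using assms(1) unfolding based_def by simp
  from dvd_transfer[OF this assms(2)] have "c dvd (of_int (K\<^sup>2) * a + of_int (2 * K) * s) - e" by simp
  then have "of_int (K\<^sup>2) * a + of_int (2 * K) * s = e"
    by (rule eq_of_dvd_degree_less)
      (use degree_consts degree_rst assms(3) deg_c in \<open>auto intro!: degree_add_less degree_of_int_mult_less simp del: of_int_mult of_int_power\<close>)
  then have "of_int (2 * K) * s = e - of_int (K\<^sup>2) * a" by (simp add: algebra_simps)
  moreover have "degree (e - of_int (K\<^sup>2) * a) < degree s"
    using assms(3) degree_consts A.degree_s(2) by (intro degree_diff_less degree_of_int_mult_less) auto
  ultimately have "2 * K = 0" by (rule of_int_times_dominates)
  then show False using based_zero assms(1) z_not_base(1) by fastforce
qed

lemma b_side_zero: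
  assumes "based b c t d z 0 1 1 L"
  shows "c dvd d - (- (2 * j) * (of_int L)\<^sup>2 - 2 * of_int L)"
proof -
  have "c dvd d - (0 + (of_int L)\<^sup>2 * b + 2 * of_int L * (t * 1 * 1))" using assms unfolding based_def by simp
  then have "c dvd (d - (0 + (of_int L)\<^sup>2 * b + 2 * of_int L * (t * 1 * 1))) + c * ((of_int L)\<^sup>2 * j\<^sup>2 + 2 * of_int L * j)"
    by (intro dvd_add) auto
  then show ?thesis unfolding b_dec t_j by (simp add: algebra_simps)
qed

lemma b_side_a:
  assumes "based b c t d z a s r L"
  shows "c dvd d - (a - 2 * j * (of_int L)\<^sup>2 - 2 * j * of_int L)"
proof -
  let ?n = "of_int L :: 'k poly"
  have "c dvd (d - (a + ?n\<^sup>2 * b + 2 * ?n * (t * r * s))) + c * (?n\<^sup>2 * j\<^sup>2 + 2 * ?n * (j\<^sup>2 * a * c + j\<^sup>2 - j * a))"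
    using assms unfolding based_def by (intro dvd_add) auto
  also have "(d - (a + ?n\<^sup>2 * b + 2 * ?n * (t * r * s))) + c * (?n\<^sup>2 * j\<^sup>2 + 2 * ?n * (j\<^sup>2 * a * c + j\<^sup>2 - j * a))
     = d - (a - 2 * j * ?n\<^sup>2 - 2 * j * ?n)"
  proof -
    have "t * r * s = c * (j\<^sup>2 * a * c + j\<^sup>2 - j * a) - j" using rst_dec by (simp add: ac_simps)
    then have h: "2 * ?n * (t * r * s) = 2 * ?n * (c * (j\<^sup>2 * a * c + j\<^sup>2 - j * a) - j)" by simp
    show ?thesis unfolding h b_dec by (simp add: algebra_simps)
  qed
  finally show ?thesis .
qed

lemma a_side_a:
  assumes "based a c s d z a s w K"
  shows "c dvd d - (a + (of_int K)\<^sup>2 * a + 2 * of_int K * w)"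
proof -
  let ?m = "of_int K :: 'k poly"
  have "c dvd (d - (a + ?m\<^sup>2 * a + 2 * ?m * (s * w * s))) + c * (2 * ?m * a * w)"
    using assms unfolding based_def by (intro dvd_add) auto
  then show ?thesis unfolding sws by (simp add: algebra_simps)
qed

lemma degree_const_expr:
  "degree (- (2 * j) * (of_int L)\<^sup>2 - 2 * of_int L) = 0" "degree (a - 2 * j * (of_int L)\<^sup>2 - 2 * j * of_int L) = 0"
  "degree (a + (of_int K)\<^sup>2 * a + 2 * of_int K * w) = 0"
proof -
  have "- (2 * j) * (of_int L)\<^sup>2 - 2 * of_int L = [:- (2 * (1 / \<kappa>)) * (of_int L)\<^sup>2 - 2 * of_int L:]"
    "a - 2 * j * (of_int L)\<^sup>2 - 2 * j * of_int L = [:\<alpha> - 2 * (1 / \<kappa>) * (of_int L)\<^sup>2 - 2 * (1 / \<kappa>) * of_int L:]"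
    "a + (of_int K)\<^sup>2 * a + 2 * of_int K * w = [:\<alpha> + (of_int K)\<^sup>2 * \<alpha> + 2 * of_int K * \<omega>:]"
    unfolding const_simps j_def w_def a_const by (rule refl)+
  then show "degree (- (2 * j) * (of_int L)\<^sup>2 - 2 * of_int L) = 0" "degree (a - 2 * j * (of_int L)\<^sup>2 - 2 * j * of_int L) = 0"
    "degree (a + (of_int K)\<^sup>2 * a + 2 * of_int K * w) = 0" by (simp_all only: degree_pCons_0)
qed

lemma double_degree_z: "2 * degree z = degree c + degree d"
  using degree_root(1)[OF cd] nonzero deg_c by simp

text \<open>The first step from the base \<open>a\<close> leads to \<open>1 + c (a \<plusminus> w)\<close>, and neither \<open>a + w = \<kappa>\<close> nor
  \<open>a - w = - 1 / \<kappa>\<close> is zero.\<close>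

lemma a_side_degree:
  assumes A: "based a c s d z a s w K" and K: "K \<noteq> 0"
  shows "2 * int (degree z) = (\<bar>K\<bar> + 1) * int (degree c)"
proof -
  define q where "q = s * s + of_int (sgn K) * c * w"
  have "q = 1 + c * (a + of_int (sgn K) * w)"
    unfolding q_def using ac by (simp add: square_simps)
  also have "a + of_int (sgn K) * w = (if K > 0 then k else - j)" using K a_w by (simp add: sgn_if)
  finally have q: "q = c * (if K > 0 then k else - j) + 1" by simp
  have kj: "k \<noteq> 0" "j \<noteq> 0" using jk by auto
  have "degree (c * (if K > 0 then k else - j)) = degree c"
    using kj nonzero degree_consts by (simp add: degree_mult_eq)
  then have dq: "degree q = degree c" unfolding q using deg_c by (simp add: degree_add_eq_left)
  then have "q \<noteq> 0" "degree s < degree q + degree s" using deg_c by auto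
  from based_degree[OF A K q_def this A.degree_s(2)]
  have "2 * int (degree z) = 2 * int (degree q) + (\<bar>K\<bar> - 1) * int (2 * degree s)" by (simp add: algebra_simps)
  then show ?thesis unfolding dq degree_rst by (simp add: algebra_simps)
qed

lemma j_s: "j * s = r"
  unfolding s_k mult.assoc[symmetric] jk by simp

lemma ts_cr: "t * s + c * r = 2 * (c * r) - s" "t * s - c * r = - s"
proof -
  have "t * s = c * (j * s) - s" unfolding t_j by (simp add: algebra_simps)
  then have ts: "t * s = c * r - s" unfolding j_s .
  show "t * s + c * r = 2 * (c * r) - s" "t * s - c * r = - s" unfolding ts by simp_all
qed

text \<open>The collision is an equation between constants, which becomes
  \<open>K\<^sup>2 (\<kappa>\<^sup>2 - 1) + 2 K (\<kappa>\<^sup>2 + 1) + 4 (L\<^sup>2 + L) = 0\<close> after multiplication by \<open>2 \<kappa>\<close>.  The degrees give \<open>\<bar>K\<bar> = 2 l\<close>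
  with \<open>l = L\<close> or \<open>l = - L - 1\<close>.  The solutions with \<open>l = 1\<close> are the regular extensions.\<close>

lemma even_case:
  assumes A: "based a c s d z a s w K" and B: "based b c t d z a s r L" and "even K" "even L"
  shows "\<exists>l\<ge>2. of_int (l + 1) * \<kappa>\<^sup>2 = - 2 \<and> int (degree d) = 2 * l * int (degree c)"
proof -
  have K0: "K \<noteq> 0" and L0: "L \<noteq> 0" using based_zero A B z_not_base(2) by fastforce+
  let ?m = "of_int K :: 'k" and ?n = "of_int L :: 'k"
  have "c dvd (a + (of_int K)\<^sup>2 * a + 2 * of_int K * w) - (a - 2 * j * (of_int L)\<^sup>2 - 2 * j * of_int L)"
    by (rule dvd_transfer[OF a_side_a[OF A] b_side_a[OF B]])
  then have peq: "a + (of_int K)\<^sup>2 * a + 2 * of_int K * w = a - 2 * j * (of_int L)\<^sup>2 - 2 * j * of_int L"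
    by (rule eq_of_dvd_degree_less) (simp_all only: degree_const_expr deg_c)
  have "k * ((of_int K)\<^sup>2 * (2 * a) + 2 * of_int K * (2 * w)) = 2 * k * ((a + (of_int K)\<^sup>2 * a + 2 * of_int K * w) - a)"
    by (simp add: algebra_simps)
  also have "\<dots> = - (4 * (j * k) * ((of_int L)\<^sup>2 + of_int L))" unfolding peq by (simp add: algebra_simps)
  finally have "k * ((of_int K)\<^sup>2 * (2 * a) + 2 * of_int K * (2 * w)) = - (4 * (j * k) * ((of_int L)\<^sup>2 + of_int L))" .
  then have "(of_int K)\<^sup>2 * (k\<^sup>2 - j * k) + 2 * of_int K * (k\<^sup>2 + j * k) + 4 * (j * k) * ((of_int L)\<^sup>2 + of_int L) = 0"
    unfolding a_half w_half by (simp add: square_simps)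
  then have "[:?m\<^sup>2 * (\<kappa>\<^sup>2 - 1) + 2 * ?m * (\<kappa>\<^sup>2 + 1) + 4 * (?n\<^sup>2 + ?n):] = 0"
    unfolding jk const_simps k_def[symmetric] by simp
  then have eq: "?m\<^sup>2 * (\<kappa>\<^sup>2 - 1) + 2 * ?m * (\<kappa>\<^sup>2 + 1) + 4 * (?n\<^sup>2 + ?n) = 0" by simp
  define l where "l = (if L > 0 then L else - L - 1)"
  have l1: "l \<ge> 1" using L0 assms(4) by (auto simp: l_def)
  have ll: "L\<^sup>2 + L = l\<^sup>2 + l" by (simp add: l_def square_simps)
  have dz: "2 * int (degree z) = (2 * l + 1) * int (degree c)"
  proof -
    define q where "q = t * s + of_int (sgn L) * c * r"
    have q: "q = (if L > 0 then 2 * (c * r) - s else - s)" using ts_cr L0 by (simp add: q_def sgn_if)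
    have "degree (2 * (c * r)) = degree c + degree r"
      using nonzero degree_r by (simp add: degree_mult_eq numeral_poly)
    then have "degree (2 * (c * r) - s) = degree c + degree r"
      using degree_add_eq_left[of "- s" "2 * (c * r)"] degree_rst deg_c by simp
    then have dq: "2 * degree q = (if L > 0 then 3 * degree c else degree c)"
      unfolding q using degree_rst by auto
    then have "q \<noteq> 0" "degree s < degree q + degree t" using degree_rst deg_c by (auto split: if_splits)
    from based_degree[OF B L0 q_def this B.degree_s(2)]
    have "2 * int (degree z) = int (2 * degree q) + 2 * (\<bar>L\<bar> - 1) * int (degree t)" by (simp add: algebra_simps)
    then show ?thesis unfolding dq degree_rst by (auto simp: l_def algebra_simps L0)
  qed
  \<comment> \<open>Comparison with the degree of \<open>z\<close> along the chain of \<open>{a, c}\<close>.\<close>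
  then have Kl: "\<bar>K\<bar> = 2 * l" using a_side_degree[OF A K0] deg_c by simp
  have dd: "int (degree d) = 2 * l * int (degree c)" using dz double_degree_z by (simp add: algebra_simps)
  have l0: "(of_int l :: 'k) \<noteq> 0" using l1 by simp
  have n: "?n\<^sup>2 + ?n = (of_int l)\<^sup>2 + of_int l" using arg_cong[OF ll, of "of_int :: int \<Rightarrow> 'k"] by simp
  \<comment> \<open>Two steps back from \<open>a\<close>; for \<open>w = 0\<close> two steps forward give the same.\<close>
  have two: "2 * s * (s * s - c * w) - s = - (s * t + c * r)"
  proof -
    have ss: "s * s - c * w = 1 + c * (a - w)" using ac by (simp add: square_simps)
    have "2 * s * (s * s - c * w) - s = s - 2 * c * (j * s)"
      unfolding ss a_w by (simp add: algebra_simps)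
    then show ?thesis using ts_cr(1) unfolding j_s by (simp add: mult.commute)
  qed
  have K2: "K \<noteq> - 2"
  proof
    assume "K = - 2"
    then have "z\<^sup>2 = (2 * s * (s * s - c * w) - s)\<^sup>2"
      using A unfolding based_def chain_def by (simp add: numeral_2_eq_2)
    then show False unfolding two using not_regular(1) by (metis power2_minus)
  qed
  have "K = 2 * l \<or> K = - (2 * l)" using Kl l1 by linarith
  then show ?thesis
  proof
    assume K: "K = - (2 * l)"
    have "4 * of_int l * \<kappa>\<^sup>2 * (of_int l - 1) = 0"
      using eq unfolding n K by (simp add: square_simps)
    then have "of_int (l - 1) = (0 :: 'k)" using l0 kappa_nz by simp
    then have "l = 1" by (simp only: of_int_eq_0_iff)
    then show ?thesis using K K2 by simp
  next
    assume K: "K = 2 * l"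
    have "4 * of_int l * (\<kappa>\<^sup>2 * (of_int l + 1) + 2) = 0"
      using eq unfolding n K by (simp add: square_simps)
    then have kl: "\<kappa>\<^sup>2 * (of_int l + 1) + 2 = 0" using l0 by simp
    have "l \<noteq> 1"
    proof
      assume l: "l = 1"
      then have "2 * (\<kappa>\<^sup>2 + 1) = 0" using kl by (simp add: algebra_simps)
      then have "\<kappa>\<^sup>2 + 1 = 0" by (metis mult_eq_0_iff zero_neq_numeral)
      then have "\<omega> = 0" using omega kappa_nz by simp
      then have w0: "w = 0" unfolding w_def by simp
      have "z\<^sup>2 = (2 * s * (s * s - c * w) - s)\<^sup>2"
        using A unfolding based_def chain_def K l w0 by (simp add: numeral_2_eq_2)
      then show False unfolding two using not_regular(1) by (metis power2_minus)
    qed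
    then have "l \<ge> 2" using l1 by simp
    moreover have "of_int (l + 1) * \<kappa>\<^sup>2 = - 2" using kl by (simp add: eq_neg_iff_add_eq_0 algebra_simps)
    ultimately show ?thesis using dd by blast
  qed
qed

text \<open>Here \<open>\<bar>K\<bar> = 2 q - 1\<close> with \<open>q = \<bar>L\<bar>\<close>.  For positive \<open>K\<close> the collision is quadratic in \<open>\<kappa>\<close> with
  discriminant \<open>5 - 8 q\<close>, which is not a square; since \<open>\<kappa>\<close> is the quotient of the members \<open>s\<close> and \<open>r\<close> of the
  subring, this is a contradiction.  For negative \<open>K\<close> it is linear in \<open>\<kappa>\<close>, after
  division by \<open>\<kappa>\<close>.\<close>

lemma odd_case:
  assumes A: "based a c s d z a s w K" and B: "based b c t d z 0 1 1 L" and "odd K"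
  shows "\<exists>q\<ge>2. of_int ((q - 1) ^ 4) * \<kappa>\<^sup>2 = of_int (q\<^sup>2) \<and> int (degree d) = (2 * q - 1) * int (degree c)"
proof -
  have K0: "K \<noteq> 0" using assms(3) by auto
  have L0: "L \<noteq> 0" using based_zero B z_not_base(1) by fastforce
  let ?m = "of_int K :: 'k" and ?n = "of_int L :: 'k"
  have "c dvd (a + (of_int K)\<^sup>2 * a + 2 * of_int K * w) - (- (2 * j) * (of_int L)\<^sup>2 - 2 * of_int L)"
    by (rule dvd_transfer[OF a_side_a[OF A] b_side_zero[OF B]])
  then have peq: "a + (of_int K)\<^sup>2 * a + 2 * of_int K * w = - (2 * j) * (of_int L)\<^sup>2 - 2 * of_int L"
    by (rule eq_of_dvd_degree_less) (simp_all only: degree_const_expr deg_c)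
  have "k * ((1 + (of_int K)\<^sup>2) * (2 * a) + 2 * of_int K * (2 * w)) = 2 * k * (a + (of_int K)\<^sup>2 * a + 2 * of_int K * w)"
    by (simp add: algebra_simps)
  also have "\<dots> = - (4 * (j * k) * (of_int L)\<^sup>2) - 4 * k * of_int L" unfolding peq by (simp add: algebra_simps)
  finally have "k * ((1 + (of_int K)\<^sup>2) * (2 * a) + 2 * of_int K * (2 * w)) = - (4 * (j * k) * (of_int L)\<^sup>2) - 4 * k * of_int L" .
  then have "(1 + (of_int K)\<^sup>2) * (k\<^sup>2 - j * k) + 2 * of_int K * (k\<^sup>2 + j * k) + 4 * (j * k) * (of_int L)\<^sup>2 + 4 * k * of_int L = 0"
    unfolding a_half w_half by (simp add: square_simps)
  then have "[:(1 + ?m\<^sup>2) * (\<kappa>\<^sup>2 - 1) + 2 * ?m * (\<kappa>\<^sup>2 + 1) + 4 * ?n\<^sup>2 + 4 * \<kappa> * ?n:] = 0"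
    unfolding jk const_simps k_def[symmetric] by simp
  then have eq: "(1 + ?m\<^sup>2) * (\<kappa>\<^sup>2 - 1) + 2 * ?m * (\<kappa>\<^sup>2 + 1) + 4 * ?n\<^sup>2 + 4 * \<kappa> * ?n = 0" by simp
  have al: "\<alpha> \<noteq> 0" using nonzero a_const by auto
  have dz: "int (degree z) = \<bar>L\<bar> * int (degree c)"
  proof -
    define q where "q = t * 1 + of_int (sgn L) * c * 1"
    have q: "q = [:1 / \<kappa> + of_int (sgn L):] * c + (- 1)"
      unfolding q_def t_j j_def const_simps by (simp add: algebra_simps)
    have "1 / \<kappa> + of_int (sgn L) \<noteq> 0"
    proof
      assume "1 / \<kappa> + of_int (sgn L) = 0"
      then have "1 / \<kappa> = - of_int (sgn L)" by (simp add: eq_neg_iff_add_eq_0)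
      then have "(1 / \<kappa>)\<^sup>2 = 1" using L0 by (simp add: sgn_if)
      then have "\<kappa>\<^sup>2 = 1" using kappa_nz by (simp add: power_divide)
      then show False using kappa al kappa_nz by simp
    qed
    then have dq: "degree q = degree c"
      unfolding q using degree_const_mult_add[of "- 1" c] deg_c by simp
    then have "q \<noteq> 0" "degree (1 :: 'k poly) < degree q + degree t" using deg_c by auto
    from based_degree[OF B L0 q_def this B.degree_s(2)] show ?thesis
      unfolding dq degree_rst by (simp add: algebra_simps)
  qed
  define q where "q = \<bar>L\<bar>"
  have q1: "q \<ge> 1" using L0 by (simp add: q_def)
  have n2: "?n\<^sup>2 = (of_int q)\<^sup>2" unfolding q_def by (metis of_int_power power2_abs)
  have "2 * int (degree z) = 2 * q * int (degree c)" using dz by (simp add: q_def)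
  then have "(\<bar>K\<bar> + 1) * int (degree c) = 2 * q * int (degree c)" using a_side_degree[OF A K0] by (simp only:)
  then have Kq: "\<bar>K\<bar> = 2 * q - 1" using deg_c by simp
  have dd: "int (degree d) = (2 * q - 1) * int (degree c)" using dz double_degree_z by (simp add: algebra_simps q_def)
  have "K = 2 * q - 1 \<or> K = 1 - 2 * q" using Kq q1 by linarith
  then show ?thesis
  proof
    assume K: "K = 2 * q - 1"
    have "4 * ((of_int q)\<^sup>2 * \<kappa>\<^sup>2 + ?n * \<kappa> + 2 * of_int q - 1) = 0"
      using eq unfolding n2 K by (simp add: square_simps)
    then have "(of_int q)\<^sup>2 * \<kappa>\<^sup>2 + ?n * \<kappa> + 2 * of_int q - 1 = 0" by (metis mult_eq_0_iff zero_neq_numeral)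
    then have e: "?n\<^sup>2 * \<kappa>\<^sup>2 + ?n * \<kappa> + 2 * of_int q - 1 = 0" unfolding n2 .
    have "(2 * ?n * \<kappa> + 1)\<^sup>2 = 4 * (?n\<^sup>2 * \<kappa>\<^sup>2 + ?n * \<kappa> + 2 * of_int q - 1) + (5 - 8 * of_int q)"
      by (simp add: square_simps)
    then have "(2 * ?n * \<kappa> + 1)\<^sup>2 = 5 - 8 * of_int q" unfolding e by simp
    then have "[:(2 * ?n * \<kappa> + 1)\<^sup>2:] = [:of_int (5 - 8 * q):]" by simp
    then have "(2 * of_int L * k + 1)\<^sup>2 = (of_int (5 - 8 * q) :: 'k poly)" unfolding const_simps k_def .
    then have "(2 * of_int L * k + 1)\<^sup>2 * r\<^sup>2 = of_int (5 - 8 * q) * r\<^sup>2" by simp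
    then have "(2 * of_int L * s + r)\<^sup>2 = of_int (5 - 8 * q) * r\<^sup>2"
      unfolding s_k by (simp add: square_simps)
    moreover have "2 * of_int L * s + r \<in> S"
    proof -
      have "of_int i \<in> S" for i
        by (induction i rule: int_induct[of _ 0]) (auto intro: mem)
      then show ?thesis using mems by (auto intro!: mem)
    qed
    ultimately have "r = 0" using nonsquare mems(5) q1 by blast
    then show ?thesis using degree_r(2) by simp
  next
    assume K: "K = 1 - 2 * q"
    have "4 * \<kappa> * (\<kappa> * (of_int q - 1)\<^sup>2 + ?n) = 0"
      using eq unfolding n2 K by (simp add: square_simps)
    then have kq: "\<kappa> * (of_int q - 1)\<^sup>2 = - ?n" using kappa_nz by (simp add: eq_neg_iff_add_eq_0)
    have "q \<noteq> 1" using kq L0 by auto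
    then have "q \<ge> 2" using q1 by simp
    moreover have "of_int ((q - 1) ^ 4) * \<kappa>\<^sup>2 = of_int (q\<^sup>2)"
    proof -
      have "(\<kappa> * (of_int q - 1)\<^sup>2)\<^sup>2 = (of_int q)\<^sup>2" unfolding kq using n2 by simp
      then show ?thesis by (simp add: power_mult_distrib mult.commute flip: power_mult)
    qed
    ultimately show ?thesis using dd by blast
  qed
qed

text \<open>Only two combinations of bases survive: \<open>a\<close> in both chains, and \<open>a\<close> in the first with \<open>0\<close> in the second.
  Each of them yields a one-parameter family.\<close>

lemma outcome:
  "(\<exists>l\<ge>2. of_int (l + 1) * \<kappa>\<^sup>2 = - 2 \<and> int (degree d) = 2 * l * int (degree c))
   \<or> (\<exists>q\<ge>2. of_int ((q - 1) ^ 4) * \<kappa>\<^sup>2 = of_int (q\<^sup>2) \<and> int (degree d) = (2 * q - 1) * int (degree c))"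
proof -
  have zero_a: False if "based a c s d z 0 1 1 K" "based b c t d z 0 1 1 L" for K L
    using no_zero_a_side[OF that(1) b_side_zero[OF that(2)] degree_const_expr(1)] .
  show ?thesis
  proof (cases rule: joint_resolution)
    case (common e u v w' K L)
    from common_base_exceptional[OF common(1-8)] show ?thesis
    proof
      assume 1: "e = 0"
      then have "w'\<^sup>2 = 1\<^sup>2" "u\<^sup>2 = 1\<^sup>2" "v\<^sup>2 = 1\<^sup>2" using common(5-7) by simp_all
      then show ?thesis using based_rebase[OF common(11)] based_rebase[OF common(12)] zero_a unfolding 1 by blast
    next
      assume 2: "e = a"
      then have "w'\<^sup>2 = s\<^sup>2" "u\<^sup>2 = w\<^sup>2" "v\<^sup>2 = r\<^sup>2" using common(5-7) ac ab w_square by (simp_all add: mult.commute)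
      then show ?thesis
        using based_rebase[OF common(11)] based_rebase[OF common(12)] common(9,10) even_case unfolding 2 by metis
    qed
  next
    case (even_zero e u w' K L)
    have "c dvd (w' - t) + c * j \<or> c dvd (w' + t) - c * j" using even_zero(4) by (metis dvd_add dvd_diff dvd_triv_left)
    then have "c dvd w' - 1 \<or> c dvd w' + 1" unfolding t_j by (simp add: algebra_simps) blast
    then have "e = 0" "w'\<^sup>2 = 1\<^sup>2" using base_of_residue[of 0 1 e w'] even_zero(2,3) deg_c by simp_all
    moreover from this have "u\<^sup>2 = 1\<^sup>2" using even_zero(1) by simp
    ultimately show ?thesis using based_rebase[OF even_zero(7)] zero_a[OF _ even_zero(8)] by blast
  next
    case (zero_even e v w' K L)
    have ca: "c * a + 1 = s\<^sup>2" and sc: "degree s < degree c" using ac degree_rst deg_c by (simp_all add: mult.commute)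
    note e = base_of_residue[OF ca zero_even(2,4) sc zero_even(3)]
    have "v\<^sup>2 = r\<^sup>2" using zero_even(1) ab e(1) by (simp add: mult.commute)
    then obtain L' where "based b c t d z a s r L'"
      using based_rebase[OF zero_even(8) e(2)] unfolding e(1) by blast
    then show ?thesis using no_zero_a_side[OF zero_even(7) b_side_a degree_const_expr(2)] by blast
  next
    case (zero_zero K L)
    then show ?thesis using zero_a by blast
  next
    case (const_zero v K L)
    have "v\<^sup>2 = w\<^sup>2" using const_zero(2) w_square by simp
    then show ?thesis
      using based_rebase[OF const_zero(5) refl] odd_case[OF _ const_zero(6)] const_zero(3) by blast
  qed
qed

text \<open>The roles of \<open>b\<close> and \<open>c\<close> may be exchanged because they have the same degree; then \<open>r = - (- 1 / \<kappa>) s\<close>.\<close>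

lemma swapped: "exceptional_triple S a c b d s (- r) (- t) x z y \<alpha> (- 1 / \<kappa>) (- \<omega>)"
proof unfold_locales
  show "c * b + 1 = (- t)\<^sup>2" using bc by (simp add: mult.commute)
  show "a * b + 1 = (- r)\<^sup>2" using ab by simp
  show "(d - (a + c + b + 2 * a * c * b))\<^sup>2 \<noteq> 4 * (s * - r * - t)\<^sup>2"
    using irregular by (simp add: ac_simps)
  show "(e - (a + c + b + 2 * a * c * b))\<^sup>2 = 4 * (s * - r * - t)\<^sup>2"
    if "e \<in> S" "u \<in> S" "v \<in> S" "h \<in> S" "a * e + 1 = u\<^sup>2" "c * e + 1 = v\<^sup>2" "b * e + 1 = h\<^sup>2"
      "e \<noteq> 0" "e \<noteq> a" "e \<noteq> c" "e \<noteq> b" "degree e < degree b" for e u v h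
    using minimal[OF that(1,2,4,3,5,7,6,8,9,11,10)] that(12) deg_bc by (simp add: ac_simps)
  show "(- 1 / \<kappa>)\<^sup>2 - 1 = 2 * \<alpha> * (- 1 / \<kappa>)" "2 * (- 1 / \<kappa>) * (- \<omega>) = (- 1 / \<kappa>)\<^sup>2 + 1"
  proof -
    have "(\<kappa>\<^sup>2 - 1) / \<kappa>\<^sup>2 = 2 * \<alpha> * \<kappa> / \<kappa>\<^sup>2" "2 * \<kappa> * \<omega> / \<kappa>\<^sup>2 = (\<kappa>\<^sup>2 + 1) / \<kappa>\<^sup>2"
      using kappa omega by simp_all
    then have "1 - 1 / \<kappa>\<^sup>2 = 2 * \<alpha> / \<kappa>" "2 * \<omega> / \<kappa> = 1 + 1 / \<kappa>\<^sup>2"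
      using kappa_nz by (simp_all add: diff_divide_distrib add_divide_distrib power2_eq_square)
    then show "(- 1 / \<kappa>)\<^sup>2 - 1 = 2 * \<alpha> * (- 1 / \<kappa>)" "2 * (- 1 / \<kappa>) * (- \<omega>) = (- 1 / \<kappa>)\<^sup>2 + 1"
      by (simp_all add: power_divide algebra_simps)
  qed
  show "- r = [:- 1 / \<kappa>:] * s" using j_s by (simp add: j_def)
  have "- t = - k * b - 1"
  proof -
    have "- k * b - 1 = - (j * k) * (j * c) + 2 * (j * k) - 1" unfolding b_dec by (simp add: square_simps)
    then show ?thesis unfolding jk t_j by simp
  qed
  then show "- t = [:1 / (- 1 / \<kappa>):] * b - 1" using kappa_nz by (simp add: k_def)
  show "- r \<in> S" "- t \<in> S" using mems by (auto intro: uminus_mem)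
  show "a = [:\<alpha>:]" by (rule a_const)
  show "Y = 0" if "X \<in> S" "Y \<in> S" "1 \<le> p" "X\<^sup>2 = of_int (5 - 8 * p) * Y\<^sup>2" for X Y p
    using nonsquare that by blast
qed (use mems ac ad bd cd nonzero distinct degs deg_bc kappa_nz in auto)

text \<open>The parity of \<open>degree d / degree c\<close> tells which family applies, and it is the same after the exchange.  So
  \<open>\<kappa>\<^sup>2\<close> and \<open>1 / \<kappa>\<^sup>2\<close> are given by the same formula with the same integer \<open>l\<close> or \<open>q\<close>; multiplying the two
  leaves \<open>(l + 1)\<^sup>2 = 4\<close> or \<open>(q - 1)\<^sup>2 = q\<close>.\<close>

lemma contradiction: False
proof -
  have D: "0 < int (degree c)" using deg_c by simp
  have k1: "(- 1 / \<kappa>)\<^sup>2 = 1 / \<kappa>\<^sup>2" by (simp add: power_divide)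
  have o': "(\<exists>l\<ge>2. of_int (l + 1) = - 2 * \<kappa>\<^sup>2 \<and> int (degree d) = 2 * l * int (degree c))
   \<or> (\<exists>q\<ge>2. of_int ((q - 1) ^ 4) = of_int (q\<^sup>2) * \<kappa>\<^sup>2 \<and> int (degree d) = (2 * q - 1) * int (degree c))"
    using exceptional_triple.outcome[OF swapped] kappa_nz unfolding k1 deg_bc by (simp add: field_simps)
  have parity: False if "2 * l * int (degree c) = (2 * q - 1) * int (degree c)" for l q
  proof -
    have "2 * l = 2 * q - 1" using that D by simp
    then show False by presburger
  qed
  from outcome show False
  proof
    assume "\<exists>l\<ge>2. of_int (l + 1) * \<kappa>\<^sup>2 = - 2 \<and> int (degree d) = 2 * l * int (degree c)"
    then obtain l where l: "l \<ge> 2" "of_int (l + 1) * \<kappa>\<^sup>2 = - 2" "int (degree d) = 2 * l * int (degree c)" by blast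
    from o' obtain l' where l': "of_int (l' + 1) = - 2 * \<kappa>\<^sup>2" "int (degree d) = 2 * l' * int (degree c)"
      using l(3) parity by metis
    have "l' = l" using l(3) l'(2) D by simp
    then have "of_int ((l + 1) * (l + 1)) = - 2 * (of_int (l + 1) * \<kappa>\<^sup>2)" using l'(1) by simp
    also have "\<dots> = of_int 4" unfolding l(2) by simp
    finally have "(l + 1) * (l + 1) = 4" by (simp only: of_int_eq_iff)
    moreover have "3 * 3 \<le> (l + 1) * (l + 1)" using l(1) by (intro mult_mono) auto
    ultimately show False by simp
  next
    assume "\<exists>q\<ge>2. of_int ((q - 1) ^ 4) * \<kappa>\<^sup>2 = of_int (q\<^sup>2) \<and> int (degree d) = (2 * q - 1) * int (degree c)"
    then obtain q where q: "q \<ge> 2" "of_int ((q - 1) ^ 4) * \<kappa>\<^sup>2 = of_int (q\<^sup>2)" "int (degree d) = (2 * q - 1) * int (degree c)" by blast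
    from o' obtain q' where q': "of_int ((q' - 1) ^ 4) = of_int (q'\<^sup>2) * \<kappa>\<^sup>2" "int (degree d) = (2 * q' - 1) * int (degree c)"
      using q(3) parity by metis
    have "q' = q" using q(3) q'(2) D by simp
    then have "of_int ((q - 1) ^ 4) = of_int (q\<^sup>2) * \<kappa>\<^sup>2" using q'(1) by (simp only:)
    then have "of_int ((q - 1) ^ 4 * (q - 1) ^ 4) = of_int ((q - 1) ^ 4) * (of_int (q\<^sup>2) * \<kappa>\<^sup>2)" by (metis of_int_mult)
    then have "of_int ((q - 1) ^ 4 * (q - 1) ^ 4) = of_int (q\<^sup>2) * (of_int ((q - 1) ^ 4) * \<kappa>\<^sup>2)" by (simp only: ac_simps)
    also have "\<dots> = of_int (q\<^sup>2 * q\<^sup>2)" unfolding q(2) by simp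
    finally have "(q - 1) ^ 4 * (q - 1) ^ 4 = q\<^sup>2 * q\<^sup>2" by (simp only: of_int_eq_iff)
    then have "((q - 1) ^ 4)\<^sup>2 = (q\<^sup>2)\<^sup>2" by (simp add: power2_eq_square)
    then have "(q - 1) ^ 4 = q\<^sup>2" by (rule power2_eq_imp_eq) simp_all
    then have "((q - 1)\<^sup>2)\<^sup>2 = q\<^sup>2" by (simp flip: power_mult)
    then have e: "(q - 1)\<^sup>2 = q" by (rule power2_eq_imp_eq) (use q(1) in simp_all)
    then have "q * (q - 3) = - 1" by (simp add: square_simps)
    then have "q dvd 1" by (metis dvd_minus_iff dvd_triv_left)
    then show False using q(1) by (auto dest: zdvd_imp_le)
  qed
qed

end

section \<open>Exclusion of irregular extensions\<close>

lemma sign_choice: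
  fixes a b c r s t :: "'k::field_char_0 poly"
  assumes r: "a * b + 1 = r\<^sup>2" and s: "a * c + 1 = s\<^sup>2" and t: "b * c + 1 = t\<^sup>2"
    and nz: "a \<noteq> 0" "b \<noteq> 0" "c \<noteq> 0" and d: "0 < degree b" "0 < degree c"
  shows "lead_coeff (r * s * t) = lead_coeff (a * b * c) \<or> lead_coeff ((- r) * s * t) = lead_coeff (a * b * c)"
proof -
  have "(lead_coeff (r * s * t))\<^sup>2 = (lead_coeff (a * b * c))\<^sup>2"
    using degree_root(2)[OF r] degree_root(2)[OF s] degree_root(2)[OF t] nz d
    by (simp add: lead_coeff_mult power_mult_distrib) (simp add: power2_eq_square)
  then have "lead_coeff (r * s * t) = lead_coeff (a * b * c) \<or> lead_coeff (r * s * t) = - lead_coeff (a * b * c)"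
    by (simp only: power2_eq_iff)
  then show ?thesis by (auto simp: lead_coeff_mult)
qed

text \<open>The product of the two regular extensions has degree at most \<open>2 degree c\<close>, and the larger one has degree
  \<open>degree a + 2 degree c\<close>.  So the smaller one is zero or a constant along with \<open>a\<close>, hence equal to \<open>a\<close> as a
  constant partner of \<open>b\<close>.\<close>

lemma equal_degree_triple:
  fixes a b c r s t :: "'k::field_char_0 poly"
  assumes r: "a * b + 1 = r\<^sup>2" and s: "a * c + 1 = s\<^sup>2" and t: "b * c + 1 = t\<^sup>2"
    and nz: "a \<noteq> 0" "b \<noteq> 0" "c \<noteq> 0" and deg: "degree a \<le> degree b" "degree b = degree c" "0 < degree b"
  shows "(c - a - b)\<^sup>2 = (2 * r)\<^sup>2 \<or> (degree a = 0 \<and> (b + c - 2 * a)\<^sup>2 = 4 * (a\<^sup>2 + 1) * (b * c + 1))"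
proof -
  obtain v where v: "v\<^sup>2 = r\<^sup>2" "lead_coeff (v * s * t) = lead_coeff (a * b * c)"
    using sign_choice[OF r s t nz] deg by (metis power2_minus)
  define e where "e = a + b + c + 2 * a * b * c"
  define lo hi where "lo = e - 2 * (v * s * t)" and "hi = e + 2 * (v * s * t)"
  have sq: "4 * (v * s * t)\<^sup>2 = 4 * ((a * b + 1) * (a * c + 1) * (b * c + 1))"
    unfolding r s t power_mult_distrib v(1) by simp
  have v': "a * b + 1 = v\<^sup>2" using v r by simp
  have lh: "lo * hi = a\<^sup>2 + b\<^sup>2 + c\<^sup>2 - 2 * a * b - 2 * a * c - 2 * b * c - 4"
    unfolding lo_def hi_def e_def by (rule regular_extension_product[OF v' s t])
  have dhi: "degree hi = degree a + degree b + degree c"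
    unfolding hi_def e_def by (rule degree_upper_extension[OF v' s t nz deg(1) _ deg(3) v(2)]) (simp add: deg(2))
  have two: "degree (2 * p * q) \<le> degree p + degree q" for p q :: "'k poly"
    using degree_mult_le[of "2 * p" q] by (simp add: numeral_poly)
  have dlh: "degree (lo * hi) \<le> 2 * degree c" unfolding lh
    using deg two[of a b] two[of a c] two[of b c] degree_power_le[of a 2] degree_power_le[of b 2] degree_power_le[of c 2]
    by (intro degree_add_le degree_diff_le) auto
  show ?thesis
  proof (cases "lo = 0")
    case True
    then have "(c - a - b)\<^sup>2 = 4 * (a * b + 1)" using lh by (simp add: square_simps)
    then show ?thesis unfolding r by (simp add: power_mult_distrib)
  next
    case False
    have "hi \<noteq> 0" using dhi deg by auto
    then have d: "degree lo = 0" "degree a = 0"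
      using dlh dhi deg degree_mult_eq[OF False] by auto
    have la: "lo * b + 1 = (v * t - b * s)\<^sup>2"
    proof -
      have "(v * t - b * s)\<^sup>2 = v\<^sup>2 * t\<^sup>2 - 2 * b * (v * s * t) + b\<^sup>2 * s\<^sup>2" by (simp add: square_simps)
      then show ?thesis unfolding v'[symmetric] s[symmetric] t[symmetric] lo_def e_def
        by (simp add: square_simps)
    qed
    have "a = lo" by (rule constant_partners_eq[OF d(2,1) nz(1) False deg(3) r la])
    then have "2 * (v * s * t) = e - a" unfolding lo_def by (simp only: eq_diff_eq add.commute)
    then have "2 * (v * s * t) = b + c + 2 * a * b * c" unfolding e_def by (simp only: add.assoc add_diff_cancel_left')
    then have "(b + c + 2 * a * b * c)\<^sup>2 = (2 * (v * s * t))\<^sup>2" by (simp only:)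
    also have "\<dots> = 4 * (v * s * t)\<^sup>2" by (simp add: power_mult_distrib)
    finally have "(b + c + 2 * a * b * c)\<^sup>2 = 4 * (v * s * t)\<^sup>2" .
    then have "(b + c - 2 * a)\<^sup>2 = 4 * (a\<^sup>2 + 1) * (b * c + 1)"
      unfolding sq by (simp add: square_simps)
    then show ?thesis using d by simp
  qed
qed

text \<open>The case \<open>p = 1\<close>, that \<open>- 3\<close> has no square root, is used to separate the two largest degrees; the general
  case concerns the discriminants in \<open>odd_case\<close>.\<close>

locale restricted_subring = poly_subring S for S :: "'k::field_char_0 poly set" +
  assumes nonsquare: "X \<in> S \<Longrightarrow> Y \<in> S \<Longrightarrow> 1 \<le> p \<Longrightarrow> X\<^sup>2 = of_int (5 - 8 * p) * Y\<^sup>2 \<Longrightarrow> Y = 0"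
begin

text \<open>After a change of the signs of \<open>r\<close>, \<open>s\<close>, \<open>t\<close>, which the hypotheses tolerate, the triple has one of the shapes
  treated above.\<close>

lemma no_extension:
  assumes E: "extended_triple S a b c d r s t x y z"
  shows False
proof -
  interpret extended_triple S a b c d r s t x y z by (rule E)
  have change: "extended_triple S a b c d r' s' t' x y z"
    if "r'\<^sup>2 = r\<^sup>2" "s'\<^sup>2 = s\<^sup>2" "t'\<^sup>2 = t\<^sup>2" for r' s' t'
  proof -
    have mem': "r' \<in> S" "s' \<in> S" "t' \<in> S"
      using that mems(5-7) uminus_mem by (metis power2_eq_iff)+
    have sq: "(r' * s' * t')\<^sup>2 = (r * s * t)\<^sup>2" using that by (simp add: power_mult_distrib)
    show ?thesis
    proof unfold_locales
      show "(d - (a + b + c + 2 * a * b * c))\<^sup>2 \<noteq> 4 * (r' * s' * t')\<^sup>2" unfolding sq by (rule irregular)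
      show "(e - (a + b + c + 2 * a * b * c))\<^sup>2 = 4 * (r' * s' * t')\<^sup>2"
        if "e \<in> S" "u \<in> S" "v \<in> S" "w \<in> S" "a * e + 1 = u\<^sup>2" "b * e + 1 = v\<^sup>2" "c * e + 1 = w\<^sup>2"
          "e \<noteq> 0" "e \<noteq> a" "e \<noteq> b" "e \<noteq> c" "degree e < degree c" for e u v w
        unfolding sq by (rule minimal[OF that])
      show "a * b + 1 = r'\<^sup>2" "a * c + 1 = s'\<^sup>2" "b * c + 1 = t'\<^sup>2" using ab ac bc that by simp_all
    qed (rule mems mem' ad bd cd nonzero distinct degs)+
  qed
  show False
  proof (cases "degree b < degree c")
    case True
    obtain r' where r': "r'\<^sup>2 = r\<^sup>2" "lead_coeff (r' * s * t) = lead_coeff (a * b * c)"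
      using sign_choice[OF ab ac bc nonzero(1-3) degs(3) deg_c] by (metis power2_minus)
    interpret G: extended_triple S a b c d r' s t x y z by (rule change[OF r'(1) refl refl])
    interpret G: gap_triple S a b c d r' s t x y z by unfold_locales (use True r' in auto)
    show False by (rule G.gap_contradiction)
  next
    case False
    then have eq: "degree b = degree c" using degs by simp
    from equal_degree_triple[OF ab ac bc nonzero(1-3) degs(1) eq degs(3)] show False
    proof
      assume "(c - a - b)\<^sup>2 = (2 * r)\<^sup>2"
      then obtain e :: int where e: "e = 1 \<or> e = -1" "c - a - b = of_int e * (2 * r)" by (rule square_eq_signs)
      define v where "v = of_int e * r"
      have v: "v\<^sup>2 = r\<^sup>2" "c = a + b + 2 * v" using e by (auto simp: v_def power_mult_distrib algebra_simps)
      have abv: "a * b + 1 = v\<^sup>2" using v ab by simp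
      have sv: "(a + v)\<^sup>2 = s\<^sup>2" "(b + v)\<^sup>2 = t\<^sup>2"
      proof -
        have "(a + v)\<^sup>2 = a\<^sup>2 + 2 * a * v + v\<^sup>2" "(b + v)\<^sup>2 = b\<^sup>2 + 2 * b * v + v\<^sup>2"
          by (simp_all add: square_simps)
        then show "(a + v)\<^sup>2 = s\<^sup>2" "(b + v)\<^sup>2 = t\<^sup>2"
          unfolding abv[symmetric] ac[symmetric] bc[symmetric] v(2) by (simp_all add: square_simps)
      qed
      interpret T: extended_triple S a b c d v "a + v" "b + v" x y z by (rule change[OF v(1) sv])
      interpret T: tight_triple S a b c d v "a + v" "b + v" x y z
        by unfold_locales (use v(2) eq in auto)
      show False
      proof (cases "degree a = degree c")
        case False
        interpret T: tight_small_triple S a b c d v "a + v" "b + v" x y z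
          by unfold_locales (use False degs in simp)
        show False by (rule T.contradiction)
      next
        case True
        define \<kappa> where "\<kappa> = lead_coeff (a + v) / lead_coeff c"
        define \<sigma> where "\<sigma> = (a + v) - [:\<kappa>:] * c"
        define g where "g = a - [:\<kappa>:]\<^sup>2 * c - 2 * [:\<kappa>:] * \<sigma>"
        have ds: "degree (a + v) = degree c" using T.A.degree_s(1) True by simp
        have "degree \<sigma> < degree c"
        proof -
          have "degree \<sigma> \<le> degree c" unfolding \<sigma>_def using ds by (intro degree_diff_le) auto
          moreover have "coeff \<sigma> (degree c) = 0" using ds nonzero by (simp add: \<sigma>_def \<kappa>_def)
          ultimately show ?thesis using deg_c by (metis degree_0 le_neq_implies_less leading_coeff_0_iff)
        qed
        interpret T: tight_balanced_triple S a b c d v "a + v" "b + v" x y z \<kappa> \<sigma> g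
          by unfold_locales (use True \<open>degree \<sigma> < degree c\<close> in \<open>simp_all add: \<sigma>_def g_def del: mult_pCons_left\<close>)
        show False by (rule T.contradiction)
      qed
    next
      assume h: "degree a = 0 \<and> (b + c - 2 * a)\<^sup>2 = 4 * (a\<^sup>2 + 1) * (b * c + 1)"
      then obtain \<alpha> where \<alpha>: "a = [:\<alpha>:]" by (metis degree_eq_zeroE)
      have \<alpha>0: "\<alpha> \<noteq> 0" using nonzero \<alpha> by auto
      obtain \<kappa> \<omega> where \<kappa>: "\<kappa> \<noteq> 0" "\<kappa>\<^sup>2 - 1 = 2 * \<alpha> * \<kappa>" "s\<^sup>2 = ([:\<kappa>:] * r)\<^sup>2" and \<omega>: "2 * \<kappa> * \<omega> = \<kappa>\<^sup>2 + 1"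
        using proportional_roots[of \<alpha> b r c s] ab ac h \<alpha>0 degs nonzero(3) unfolding \<alpha> by blast
      interpret P: extended_triple S a b c d r "[:\<kappa>:] * r" t x y z by (rule change[OF refl \<kappa>(3)[symmetric] refl])
      interpret P: proportional_triple S a b c d r "[:\<kappa>:] * r" t x y z \<alpha> \<kappa> \<omega>
        by unfold_locales (rule \<alpha> \<kappa>(1,2) \<omega> refl eq nonsquare | assumption)+
      have tt: "([:1 / \<kappa>:] * c - 1)\<^sup>2 = t\<^sup>2" using P.t_square P.j_def by simp
      interpret Q: extended_triple S a b c d r "[:\<kappa>:] * r" "[:1 / \<kappa>:] * c - 1" x y z
        by (rule change[OF refl \<kappa>(3)[symmetric] tt])
      interpret Q: proportional_triple S a b c d r "[:\<kappa>:] * r" "[:1 / \<kappa>:] * c - 1" x y z \<alpha> \<kappa> \<omega>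
        by unfold_locales (rule \<alpha> \<kappa>(1,2) \<omega> refl eq nonsquare | assumption)+
      interpret Q: exceptional_triple S a b c d r "[:\<kappa>:] * r" "[:1 / \<kappa>:] * c - 1" x y z \<alpha> \<kappa> \<omega>
        by unfold_locales simp
      show False by (rule Q.contradiction)
    qed
  qed
qed

text \<open>Both \<open>{b, c, d}\<close> and \<open>{a, c, d}\<close> are covered by \<open>equal_degree_triple\<close>.  For the first one \<open>b\<close> is not constant,
  so \<open>d = b + c \<plusminus> 2 t\<close>.  If also \<open>d = a + c \<plusminus> 2 s\<close>, then \<open>a b + 1 = (a + 2 s)\<^sup>2 - 3\<close>, up to the sign of \<open>s\<close>,
  and the rigidity of squares applies.  If \<open>a\<close> is constant and \<open>x = \<kappa> s\<close>, one finds
  \<open>r\<^sup>2 = (\<kappa> \<plusminus> 1)\<^sup>2 s\<^sup>2 - (1 \<plusminus> 2 \<omega>)\<close> with \<open>\<omega>\<^sup>2 = a\<^sup>2 + 1\<close>, whence \<open>4 \<omega>\<^sup>2 = 1\<close> and \<open>(2 a)\<^sup>2 = - 3\<close>.\<close>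

lemma no_equal_largest:
  assumes S: "a \<in> S" "s \<in> S"
    and ab: "a * b + 1 = r\<^sup>2" and ac: "a * c + 1 = s\<^sup>2" and bc: "b * c + 1 = t\<^sup>2"
    and ad: "a * d + 1 = x\<^sup>2" and bd: "b * d + 1 = y\<^sup>2" and cd: "c * d + 1 = z\<^sup>2"
    and nz: "a \<noteq> 0" "b \<noteq> 0" "c \<noteq> 0" "d \<noteq> 0" and ne: "a \<noteq> b"
    and deg: "degree a \<le> degree b" "degree b \<le> degree c" "degree c = degree d" "0 < degree b"
  shows False
proof -
  have dc: "0 < degree c" using deg by simp
  have bcd: "(d - b - c)\<^sup>2 = (2 * t)\<^sup>2"
    using equal_degree_triple[OF bc bd cd nz(2,3,4) deg(2,3) dc] deg(4) by simp
  from equal_degree_triple[OF ac ad cd nz(1,3,4) _ deg(3) dc] deg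
  have "(d - a - c)\<^sup>2 = (2 * s)\<^sup>2 \<or> (degree a = 0 \<and> (c + d - 2 * a)\<^sup>2 = 4 * (a\<^sup>2 + 1) * (c * d + 1))" by simp
  then show False
  proof
    assume "(d - a - c)\<^sup>2 = (2 * s)\<^sup>2"
    then obtain e :: int where e: "e = 1 \<or> e = -1" "d - a - c = of_int e * (2 * s)" by (rule square_eq_signs)
    from bcd obtain f :: int where f: "f = 1 \<or> f = -1" "d - b - c = of_int f * (2 * t)" by (rule square_eq_signs)
    define S' T where "S' = of_int e * s" and "T = of_int f * t"
    have ST: "S'\<^sup>2 = a * c + 1" "T\<^sup>2 = b * c + 1" "d = a + c + 2 * S'" "d = b + c + 2 * T"
      using e f ac bc by (auto simp: S'_def T_def algebra_simps)
    have ba: "b - a = 2 * (S' - T)" using ST(3,4) by (simp add: algebra_simps)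
    have "(T - S') * (T + S') = T\<^sup>2 - S'\<^sup>2" by (simp add: square_simps)
    also have "\<dots> = c * (b - a)" unfolding ST by (simp add: algebra_simps)
    also have "\<dots> = (T - S') * (- 2 * c)" unfolding ba by (simp add: algebra_simps)
    finally have "T = S' \<or> T + S' = - 2 * c" by (simp only: mult_cancel_left right_minus_eq)
    moreover have "T \<noteq> S'" using ba ne by auto
    ultimately have T: "T = - 2 * c - S'" by (simp add: algebra_simps)
    \<comment> \<open>As \<open>b \<noteq> a\<close>, the roots satisfy \<open>S' + T = - 2 c\<close>, which determines \<open>b\<close>.\<close>
    have b: "b = a + 4 * c + 4 * S'" using ba T by (simp add: algebra_simps)
    have "1 * (a + 2 * S')\<^sup>2 + (- 3) = a\<^sup>2 + 4 * a * S' + 4 * S'\<^sup>2 - 3" by (simp add: square_simps)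
    also have "\<dots> = a * b + 1" unfolding ST(1) b by (simp add: square_simps)
    finally have e1: "1 * (a + 2 * S')\<^sup>2 + (- 3) = r\<^sup>2" unfolding ab .
    have "degree (a + 2 * S') = 0" by (rule square_shift_const[OF e1]) simp_all
    then have "degree (r\<^sup>2) \<le> 0"
      unfolding e1[symmetric] using degree_power_le[of "a + 2 * S'" 2] by (intro degree_add_le) auto
    moreover have "r \<noteq> 0" "2 * degree r = degree a + degree b" using degree_root[OF ab nz(1,2)] deg by auto
    ultimately show False using deg by (simp add: degree_power_eq)
  next
    assume h: "degree a = 0 \<and> (c + d - 2 * a)\<^sup>2 = 4 * (a\<^sup>2 + 1) * (c * d + 1)"
    then obtain \<alpha> where \<alpha>: "a = [:\<alpha>:]" by (metis degree_eq_zeroE)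
    have \<alpha>0: "\<alpha> \<noteq> 0" using nz \<alpha> by auto
    obtain \<kappa> \<omega> where \<kappa>: "\<kappa> \<noteq> 0" "\<kappa>\<^sup>2 - 1 = 2 * \<alpha> * \<kappa>" "x\<^sup>2 = ([:\<kappa>:] * s)\<^sup>2"
      and \<omega>: "2 * \<kappa> * \<omega> = \<kappa>\<^sup>2 + 1" and \<omega>2: "\<omega>\<^sup>2 = \<alpha>\<^sup>2 + 1"
      using proportional_roots[of \<alpha> c s d x] ac ad h \<alpha>0 dc nz(4) unfolding \<alpha> by blast
    define k w where "k = [:\<kappa>:]" and "w = [:\<omega>:]"
    have kw: "2 * k * w = k\<^sup>2 + 1" "w\<^sup>2 = a\<^sup>2 + 1"
    proof -
      have "[:2 * \<kappa> * \<omega>:] = [:\<kappa>\<^sup>2 + 1:]" "[:\<omega>\<^sup>2:] = [:\<alpha>\<^sup>2 + 1:]" using \<omega> \<omega>2 by simp_all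
      then show "2 * k * w = k\<^sup>2 + 1" "w\<^sup>2 = a\<^sup>2 + 1" unfolding const_simps k_def w_def \<alpha> .
    qed
    have acs: "a * c = s\<^sup>2 - 1" "a * d = k\<^sup>2 * s\<^sup>2 - 1"
      using ac ad \<kappa>(3) unfolding k_def by (simp_all only: power_mult_distrib) (simp_all add: algebra_simps)
    have "(a * z)\<^sup>2 = (a * c) * (a * d) + a\<^sup>2" unfolding power_mult_distrib cd[symmetric] by (simp add: square_simps)
    also have "\<dots> = (k * s\<^sup>2)\<^sup>2 - (k\<^sup>2 + 1) * s\<^sup>2 + (a\<^sup>2 + 1)" unfolding acs by (simp add: square_simps)
    also have "\<dots> = (k * s\<^sup>2 - w)\<^sup>2" unfolding kw[symmetric] by (simp add: square_simps)
    finally have az: "(a * z)\<^sup>2 = (k * s\<^sup>2 - w)\<^sup>2" .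
    \<comment> \<open>The relation \<open>d = b + c \<plusminus> 2 t\<close> is symmetric in \<open>b\<close>, \<open>c\<close>, \<open>d\<close>, so also \<open>b = c + d \<plusminus> 2 z\<close>.\<close>
    have "(b - c - d)\<^sup>2 = 4 * (c * d + 1) + ((d - b - c)\<^sup>2 - 4 * (b * c + 1))" by (simp add: square_simps)
    also have "\<dots> = 4 * z\<^sup>2" unfolding bcd bc cd by (simp add: power_mult_distrib)
    finally have bz: "(b - c - d)\<^sup>2 = 4 * z\<^sup>2" .
    have "(a * (b - c - d))\<^sup>2 = a\<^sup>2 * (b - c - d)\<^sup>2" by (rule power_mult_distrib)
    also have "\<dots> = 4 * (a * z)\<^sup>2" unfolding bz by (simp add: power_mult_distrib)
    also have "\<dots> = (2 * (k * s\<^sup>2 - w))\<^sup>2" unfolding az by (simp add: square_simps)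
    finally obtain e :: int where e: "e = 1 \<or> e = -1" "a * (b - c - d) = of_int e * (2 * (k * s\<^sup>2 - w))"
      by (rule square_eq_signs)
    let ?e = "of_int e :: 'k poly"
    have ee: "?e\<^sup>2 = 1" using e(1) by auto
    have "r\<^sup>2 = a * c + a * d + a * (b - c - d) + 1" unfolding ab[symmetric] by (simp add: algebra_simps)
    also have "\<dots> = (?e\<^sup>2 + k\<^sup>2 + 2 * ?e * k) * s\<^sup>2 + (- 1 - 2 * ?e * w)" unfolding acs e(2) ee by (simp add: algebra_simps)
    finally have e1: "(k + ?e)\<^sup>2 * s\<^sup>2 + (- 1 - 2 * ?e * w) = r\<^sup>2" by (simp add: square_simps)
    have ke: "k + ?e \<noteq> 0"
    proof
      assume "k + ?e = 0"
      then have "[:\<kappa> + of_int e:] = 0" unfolding const_simps k_def by simp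
      then have "\<kappa> = - of_int e" by (simp add: eq_neg_iff_add_eq_0)
      then have "\<kappa>\<^sup>2 = 1" using e(1) by auto
      then show False using \<kappa> \<alpha>0 by simp
    qed
    have "(k + ?e)\<^sup>2 = [:(\<kappa> + of_int e)\<^sup>2:]" "- 1 - 2 * ?e * w = [:- 1 - 2 * of_int e * \<omega>:]"
      unfolding const_simps k_def w_def by simp_all
    then have dg: "degree ((k + ?e)\<^sup>2) = 0" "degree (- 1 - 2 * ?e * w) = 0" by (simp_all only: degree_pCons_0)
    have "2 * degree s = degree a + degree c" using degree_root(1)[OF ac nz(1,3)] dc by simp
    then have "degree s \<noteq> 0" using dc h by simp
    then have z0: "- 1 - 2 * ?e * w = 0" using square_shift_const[OF e1 dg(1) _ dg(2)] ke by auto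
    have "2 * ?e * w = - 1 - (- 1 - 2 * ?e * w)" by simp
    then have "2 * ?e * w = - 1" unfolding z0 by simp
    then have "1 = (2 * ?e * w)\<^sup>2" by simp
    then have w4: "4 * w\<^sup>2 = 1" using ee by (simp add: power_mult_distrib)
    have "(2 * a)\<^sup>2 = 4 * w\<^sup>2 - 4" unfolding kw by (simp add: power_mult_distrib)
    then have "(2 * a)\<^sup>2 = of_int (5 - 8 * 1) * 1\<^sup>2" unfolding w4 by simp
    moreover have "2 * a \<in> S" using S by (auto intro: mem)
    ultimately have "(1 :: 'k poly) = 0" using nonsquare one_mem by (metis order_refl)
    then show False by simp
  qed
qed

end

section \<open>Regularity by induction on the largest degree\<close>

text \<open>Written with power sums, the equation of a regular quadruple depends only on the set of its members.\<close>

lemma regular_quadruple_power_sums: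
  assumes "distinct [a, b, c, d]"
  shows "regular_quadruple a b c d \<longleftrightarrow>
    2 * (\<Sum>f\<in>{a, b, c, d}. f\<^sup>2) - (\<Sum>f\<in>{a, b, c, d}. f)\<^sup>2 - 4 * (\<Prod>f\<in>{a, b, c, d}. f) = 4"
proof -
  have "(\<Sum>f\<in>{a, b, c, d}. f\<^sup>2) = a\<^sup>2 + b\<^sup>2 + c\<^sup>2 + d\<^sup>2" "(\<Sum>f\<in>{a, b, c, d}. f) = a + b + c + d"
    "(\<Prod>f\<in>{a, b, c, d}. f) = a * b * c * d"
    using assms by (simp_all add: algebra_simps)
  moreover have "(a + b - c - d)\<^sup>2 - 4 * (a * b + 1) * (c * d + 1)
    = 2 * (a\<^sup>2 + b\<^sup>2 + c\<^sup>2 + d\<^sup>2) - (a + b + c + d)\<^sup>2 - 4 * (a * b * c * d) - 4"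
    by (simp add: square_simps)
  ultimately show ?thesis
    unfolding regular_quadruple_def by (metis eq_iff_diff_eq_0)
qed

lemma regular_quadruple_cong_set:
  assumes "distinct [a, b, c, d]" "distinct [a', b', c', d']" "{a, b, c, d} = {a', b', c', d'}"
  shows "regular_quadruple a b c d \<longleftrightarrow> regular_quadruple a' b' c' d'"
  using regular_quadruple_power_sums assms by metis

lemma regular_quadruple_iff_extension:
  assumes "a * b + 1 = r\<^sup>2" "a * c + 1 = s\<^sup>2" "b * c + 1 = t\<^sup>2"
  shows "regular_quadruple a b c d \<longleftrightarrow> (d - (a + b + c + 2 * a * b * c))\<^sup>2 = 4 * (r * s * t)\<^sup>2"
proof -
  have rst: "(r * s * t)\<^sup>2 = (a * b + 1) * (a * c + 1) * (b * c + 1)" unfolding assms by (simp add: power_mult_distrib)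
  have "(d - (a + b + c + 2 * a * b * c))\<^sup>2 - 4 * ((a * b + 1) * (a * c + 1) * (b * c + 1))
    = (a + b - c - d)\<^sup>2 - 4 * (a * b + 1) * (c * d + 1)"
    by (simp add: square_simps)
  then show ?thesis unfolding rst regular_quadruple_def by (metis eq_iff_diff_eq_0)
qed

lemma four_by_degree:
  fixes A :: "'k::zero poly set"
  assumes "card A = 4"
  obtains a b c d where "A = {a, b, c, d}" "distinct [a, b, c, d]" "degree a \<le> degree b" "degree b \<le> degree c" "degree c \<le> degree d"
proof -
  have "finite A" using assms by (simp add: card_ge_0_finite)
  then obtain xs where xs: "set xs = A" "distinct xs" using finite_distinct_list by blast
  define ys where "ys = sort_key degree xs"
  have ys: "set ys = A" "distinct ys" "sorted (map degree ys)" using xs by (simp_all add: ys_def)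
  have "length ys = 4" using ys assms distinct_card by fastforce
  then obtain a b c d where "ys = [a, b, c, d]" by (auto simp: length_Suc_conv numeral_eq_Suc)
  then show thesis using that[of a b c d] ys by auto
qed

locale restricted_complex_subring = restricted_subring S for S :: "complex poly set"
begin

text \<open>The induction is on a bound for the degrees.  Replacing the largest member \<open>d\<close> by an extension of degree less
  than \<open>degree c\<close> gives a quadruple to which the induction hypothesis applies.\<close>

lemma regular_if_degrees_less:
  assumes "A \<subseteq> S" "card A = 4" "0 \<notin> A" "\<forall>u\<in>A. \<forall>v\<in>A. u \<noteq> v \<longrightarrow> (\<exists>r\<in>S. u * v + 1 = r\<^sup>2)"
    and "\<exists>f\<in>A. 0 < degree f" "\<forall>f\<in>A. degree f < n"
    and "A = {a, b, c, d}" "distinct [a, b, c, d]"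
  shows "regular_quadruple a b c d"
  using assms
proof (induction n arbitrary: A a b c d)
  case 0
  then show ?case by auto
next
  case (Suc n A a' b' c' d')
  obtain a b c d where A: "A = {a, b, c, d}" and dist: "distinct [a, b, c, d]"
    and deg: "degree a \<le> degree b" "degree b \<le> degree c" "degree c \<le> degree d"
    using four_by_degree[OF Suc.prems(2)] by blast
  have nz: "a \<noteq> 0" "b \<noteq> 0" "c \<noteq> 0" "d \<noteq> 0" and mem_S: "a \<in> S" "b \<in> S" "c \<in> S" "d \<in> S"
    using Suc.prems(1,3) A by auto
  have root: "\<exists>r\<in>S. u * v + 1 = r\<^sup>2" if "u \<in> A" "v \<in> A" "u \<noteq> v" for u v using Suc.prems(4) that by blast
  obtain r s t x y z where R: "r \<in> S" "s \<in> S" "t \<in> S" "x \<in> S" "y \<in> S" "z \<in> S"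
    and ab: "a * b + 1 = r\<^sup>2" and ac: "a * c + 1 = s\<^sup>2" and bc: "b * c + 1 = t\<^sup>2"
    and ad: "a * d + 1 = x\<^sup>2" and bd: "b * d + 1 = y\<^sup>2" and cd: "c * d + 1 = z\<^sup>2"
    using root[of a b] root[of a c] root[of b c] root[of a d] root[of b d] root[of c d] A dist by auto
  have dd: "0 < degree d" using Suc.prems(5) A deg by auto
  have db: "0 < degree b"
  proof (rule ccontr)
    assume "\<not> 0 < degree b"
    then have "a = b" using constant_partners_eq[OF _ _ nz(1,2) dd ad bd] deg by simp
    then show False using dist by simp
  qed
  have "degree c \<noteq> degree d"
    using no_equal_largest[OF mem_S(1) R(2) ab ac bc ad bd cd nz _ deg(1,2) _ db] dist by auto
  then have cd_lt: "degree c < degree d" using deg by simp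
  have "regular_quadruple a b c d"
  proof (rule ccontr)
    assume irr: "\<not> regular_quadruple a b c d"
    have "extended_triple S a b c d r s t x y z"
    proof unfold_locales
      show "(d - (a + b + c + 2 * a * b * c))\<^sup>2 \<noteq> 4 * (r * s * t)\<^sup>2"
        using irr regular_quadruple_iff_extension[OF ab ac bc] by simp
      show "(e - (a + b + c + 2 * a * b * c))\<^sup>2 = 4 * (r * s * t)\<^sup>2"
        if e: "e \<in> S" "u \<in> S" "v \<in> S" "w \<in> S" "a * e + 1 = u\<^sup>2" "b * e + 1 = v\<^sup>2" "c * e + 1 = w\<^sup>2"
          "e \<noteq> 0" "e \<noteq> a" "e \<noteq> b" "e \<noteq> c" "degree e < degree c" for e u v w
      proof -
        have "regular_quadruple a b c e"
        proof (rule Suc.IH)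
          show "{a, b, c, e} \<subseteq> S" "0 \<notin> {a, b, c, e}" "\<exists>f\<in>{a, b, c, e}. 0 < degree f"
            using mem_S nz e db by auto
          show "distinct [a, b, c, e]" using dist e by auto
          then show "card {a, b, c, e} = 4" using distinct_card[of "[a, b, c, e]"] by simp
          show "\<forall>f\<in>{a, b, c, e}. degree f < n"
            using Suc.prems(6) A deg cd_lt e(12) by auto
          show "\<forall>p\<in>{a, b, c, e}. \<forall>q\<in>{a, b, c, e}. p \<noteq> q \<longrightarrow> (\<exists>r\<in>S. p * q + 1 = r\<^sup>2)"
            using R(1-3) e(2-4) ab ac bc e(5-7) by (auto simp: mult.commute)
        qed (rule refl)
        then show ?thesis using regular_quadruple_iff_extension[OF ab ac bc] by simp
      qed
    qed (use mem_S R ab ac bc ad bd cd nz dist deg db in auto)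
    then show False by (rule no_extension)
  qed
  then show ?case using regular_quadruple_cong_set[OF dist Suc.prems(8)] A Suc.prems(7) by simp
qed

end

section \<open>Polynomials over the Gaussian rationals\<close>

lemma gauss_rat_intro: "of_rat p + of_rat q * \<i> \<in> gauss_rat"
  unfolding gauss_rat_def by blast

lemma gauss_rat_closed:
  assumes "u \<in> gauss_rat" "v \<in> gauss_rat"
  shows "u + v \<in> gauss_rat" "u - v \<in> gauss_rat" "u * v \<in> gauss_rat" "u / v \<in> gauss_rat"
proof -
  obtain p q p' q' where u: "u = of_rat p + of_rat q * \<i>" and v: "v = of_rat p' + of_rat q' * \<i>"
    using assms unfolding gauss_rat_def by auto
  have "u + v = of_rat (p + p') + of_rat (q + q') * \<i>" "u - v = of_rat (p - p') + of_rat (q - q') * \<i>"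
    "u * v = of_rat (p * p' - q * q') + of_rat (p * q' + q * p') * \<i>"
    unfolding u v by (simp_all add: of_rat_add of_rat_diff of_rat_mult algebra_simps)
  then show "u + v \<in> gauss_rat" "u - v \<in> gauss_rat" "u * v \<in> gauss_rat" using gauss_rat_intro by metis+
  define N where "N = p' * p' + q' * q'"
  have N: "of_rat N = v * (of_rat p' - of_rat q' * \<i>)"
    unfolding v N_def by (simp add: of_rat_add of_rat_mult algebra_simps)
  show "u / v \<in> gauss_rat"
  proof (cases "v = 0")
    case True
    then show ?thesis using gauss_rat_intro[of 0 0] by simp
  next
    case False
    have "N \<noteq> 0"
    proof
      assume "N = 0"
      then have "p' = 0" "q' = 0" unfolding N_def by (simp_all add: sum_squares_eq_zero_iff)
      then show False using False v by simp
    qed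
    then have N0: "(of_rat N :: complex) \<noteq> 0" by simp
    have "u / v = u * (of_rat p' - of_rat q' * \<i>) / of_rat N"
      using N0 unfolding N by (auto simp: mult_divide_mult_cancel_right)
    also have "\<dots> = of_rat ((p * p' + q * q') / N) + of_rat ((q * p' - p * q') / N) * \<i>"
      unfolding u using N0 by (simp add: of_rat_add of_rat_diff of_rat_mult of_rat_divide field_simps)
    finally show ?thesis using gauss_rat_intro by metis
  qed
qed

text \<open>A rational number with integral square is an integer, and odd squares are \<open>1\<close> modulo \<open>8\<close>.\<close>

lemma rat_square_not_3_mod_8:
  fixes q :: rat and m :: int
  assumes "q\<^sup>2 = of_int m" "m mod 8 = 3"
  shows False
proof -
  obtain a b where ab: "quotient_of q = (a, b)" by (cases "quotient_of q")
  have q: "q = of_int a / of_int b" and b: "b > 0" and cop: "coprime a b"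
    using quotient_of_div[OF ab] quotient_of_denom_pos[OF ab] quotient_of_coprime[OF ab] by auto
  have "(of_int (a\<^sup>2) :: rat) = of_int (m * b\<^sup>2)"
    using assms(1) b unfolding q by (simp add: power_divide field_simps)
  then have e: "a\<^sup>2 = m * b\<^sup>2" by (simp only: of_int_eq_iff)
  have "is_unit b"
  proof -
    have "b dvd a\<^sup>2" using e by (simp add: power2_eq_square)
    moreover have "coprime (a\<^sup>2) b" using cop by simp
    ultimately show ?thesis by (metis coprime_absorb_right)
  qed
  then have "b = 1" using b by auto
  then have am: "a\<^sup>2 = m" using e by simp
  have "odd m" using assms(2) by presburger
  then have "odd a" using am by auto
  then obtain i where i: "a = 2 * i + 1" by (rule oddE)
  have "m = 4 * (i * (i + 1)) + 1" unfolding am[symmetric] i by (simp add: square_simps)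
  moreover obtain h where "i * (i + 1) = 2 * h" by (metis evenE even_mult_iff even_plus_one_iff)
  ultimately have "m = 8 * h + 1" by simp
  then show False using assms(2) by presburger
qed

text \<open>A real square in \<open>\<rat>(i)\<close> is the square of a rational number or the negative of one.\<close>

lemma gauss_rat_nonsquare:
  assumes "u \<in> gauss_rat" "1 \<le> p"
  shows "u\<^sup>2 \<noteq> of_int (5 - 8 * p)"
proof
  assume e: "u\<^sup>2 = of_int (5 - 8 * p)"
  obtain v w where u: "u = of_rat v + of_rat w * \<i>" using assms(1) unfolding gauss_rat_def by auto
  have "u\<^sup>2 = of_rat (v\<^sup>2 - w\<^sup>2) + of_rat (2 * v * w) * \<i>"
    unfolding u by (simp add: of_rat_add of_rat_diff of_rat_mult square_simps)
  then have *: "of_rat (v\<^sup>2 - w\<^sup>2) + of_rat (2 * v * w) * \<i> = (of_int (5 - 8 * p) :: complex)" using e by simp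
  have "of_rat a = complex_of_real (of_rat a)" for a by (cases a) (simp add: of_rat_rat)
  then have re: "Re (of_rat a) = of_rat a" "Im (of_rat a) = 0" for a
    by (metis Re_complex_of_real, metis Im_complex_of_real)
  have "of_rat (v\<^sup>2 - w\<^sup>2) = real_of_int (5 - 8 * p)" "of_rat (2 * v * w) = (0 :: real)"
    using arg_cong[OF *, of Re] arg_cong[OF *, of Im] by (simp_all add: re)
  then have "of_rat (v\<^sup>2 - w\<^sup>2) = (of_rat (of_int (5 - 8 * p)) :: real)" "of_rat (2 * v * w) = (of_rat 0 :: real)"
    by (simp_all only: of_rat_of_int_eq of_rat_0)
  then have vw: "v\<^sup>2 - w\<^sup>2 = of_int (5 - 8 * p)" "2 * v * w = 0" by (simp_all only: of_rat_eq_iff)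
  then have "v = 0 \<or> w = 0" by simp
  then show False
  proof
    assume "v = 0"
    then have "w\<^sup>2 = of_int (8 * p - 5)" using vw(1) by simp
    then show False by (rule rat_square_not_3_mod_8) presburger
  next
    assume "w = 0"
    then have "v\<^sup>2 = of_int (5 - 8 * p)" using vw(1) by simp
    moreover have "0 \<le> v\<^sup>2" by simp
    ultimately have "(0 :: rat) \<le> of_int (5 - 8 * p)" by simp
    then have "0 \<le> 5 - 8 * p" by (simp only: of_int_0_le_iff)
    then show False using assms(2) by simp
  qed
qed

interpretation gauss: restricted_complex_subring gauss_rat_polys
proof unfold_locales
  have zero: "0 \<in> gauss_rat" and one: "1 \<in> gauss_rat" using gauss_rat_intro[of 0 0] gauss_rat_intro[of 1 0] by simp_all
  show "1 \<in> gauss_rat_polys" unfolding gauss_rat_polys_def using zero one by (simp add: coeff_1)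
  show "p + q \<in> gauss_rat_polys" "p - q \<in> gauss_rat_polys" "p * q \<in> gauss_rat_polys"
    if "p \<in> gauss_rat_polys" "q \<in> gauss_rat_polys" for p q
  proof -
    show "p + q \<in> gauss_rat_polys" "p - q \<in> gauss_rat_polys"
      using that unfolding gauss_rat_polys_def by (auto intro: gauss_rat_closed)
    have sum: "(\<Sum>i\<in>I. h i) \<in> gauss_rat" if "\<And>i. h i \<in> gauss_rat" for h :: "nat \<Rightarrow> complex" and I
      by (induction I rule: infinite_finite_induct) (auto intro: gauss_rat_closed zero that)
    show "p * q \<in> gauss_rat_polys"
      using that unfolding gauss_rat_polys_def by (auto simp: coeff_mult intro!: sum gauss_rat_closed)
  qed
  show "Y = 0" if "X \<in> gauss_rat_polys" "Y \<in> gauss_rat_polys" "1 \<le> p" "X\<^sup>2 = of_int (5 - 8 * p) * Y\<^sup>2" for X Y p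
  proof (rule ccontr)
    assume Y: "Y \<noteq> 0"
    have "lead_coeff (X\<^sup>2) = lead_coeff (of_int (5 - 8 * p) * Y\<^sup>2)" using that(4) by simp
    then have "(lead_coeff X)\<^sup>2 = of_int (5 - 8 * p) * (lead_coeff Y)\<^sup>2"
      by (simp only: lead_coeff_mult lead_coeff_power lead_coeff_of_int)
    then have "(lead_coeff X / lead_coeff Y)\<^sup>2 = of_int (5 - 8 * p)" using Y by (simp add: power_divide)
    moreover have "lead_coeff X / lead_coeff Y \<in> gauss_rat"
      using that(1,2) unfolding gauss_rat_polys_def by (auto intro: gauss_rat_closed)
    ultimately show False using gauss_rat_nonsquare that(3) by blast
  qed
qed

theorem theorem1p1:
  fixes a b c d :: "complex poly"
  assumes "diophantine_quadruple {a, b, c, d}"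
    and "\<exists>f\<in>{a, b, c, d}. degree f > 0"
  shows "regular_quadruple a b c d"
proof -
  have q: "{a, b, c, d} \<subseteq> gauss_rat_polys" "card {a, b, c, d} = 4" "0 \<notin> {a, b, c, d}"
    "\<forall>u\<in>{a, b, c, d}. \<forall>v\<in>{a, b, c, d}. u \<noteq> v \<longrightarrow> (\<exists>r\<in>gauss_rat_polys. u * v + 1 = r\<^sup>2)"
    using assms(1) unfolding diophantine_quadruple_def by blast+
  have "card (set [a, b, c, d]) = length [a, b, c, d]" using q(2) by simp
  then have dist: "distinct [a, b, c, d]" by (rule card_distinct)
  have "\<forall>f\<in>{a, b, c, d}. degree f < Suc (Max (degree ` {a, b, c, d}))"
    by (simp only: less_Suc_eq_le) (intro ballI Max_ge finite_imageI imageI, auto)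
  then show ?thesis
    by (rule gauss.regular_if_degrees_less[OF q assms(2) _ refl dist])
qed

end
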